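(* Let $\mathcal{C}$ be a triangulated category with suspension functor $\Sigma$, and let $\mathcal{T}$ be a contravariantly finite, rigid subcategory of $\mathcal{C}$ (strictly full and stable under taking direct summands). Let $\mathcal{W}$ be the class of morphisms $f:X\to Y$ such that, for any (equivalently, some) triangle $Z\xrightarrow{u}X\xrightarrow{f}Y\xrightarrow{v}\Sigma Z$, the morphisms $u$ and $v$ are in $(\mathcal{T}^\perp)$. Then there is a left-weak model category structure on $\mathcal{C}$ whose class of weak equivalences is $\mathcal{W}$, whose null-homotopic morphisms are exactly those in the ideal $(\mathcal{T}^\perp)$, and whose objects that are both fibrant and cofibrant are exactly the objects of $\mathcal{T}\ast\Sigma\mathcal{T}$. Moreover, if $\mathcal{T}$ is skeletally small, then this left-weak model category structure is cofibrantly generated.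
   Context: **Triangulated notions.** Strictly full means full and closed under isomorphism. For a full subcategory $\mathcal{D}$ of $\mathcal{C}$: $\mathcal{D}^\perp$ is the full subcategory of objects $X$ with $\mathcal{C}(D,X)=0$ for all $D\in\mathcal{D}$; $(\mathcal{D})$ is the ideal of morphisms factoring through some object of $\mathcal{D}$; $\mathcal{D}$ is rigid if $\Sigma\mathcal{D}\subseteq\mathcal{D}^\perp$; $\mathcal{D}$ is contravariantly finite if every $X\in\mathcal{C}$ has a right $\mathcal{D}$-approximation, i.e. a morphism $D\to X$ with $D\in\mathcal{D}$ through which every morphism $D'\to X$ with $D'\in\mathcal{D}$ factors. $\mathcal{T}\ast\Sigma\mathcal{T}$ is the full subcategory of objects $Y$ for which there is a triangle $T_1\to T_0\to Y\to\Sigma T_1$ with $T_0,T_1\in\mathcal{T}$. **Homotopical notions.** Let $\mathcal{C}$ be a category with three classes of morphisms: $\mathcal{W}$ (weak equivalences), $\mathcal{C}of$ (cofibrations), $\mathcal{F}ib$ (fibrations). A trivial (or weak) cofibration, resp. fibration, is a cofibration, resp. fibration, which is in $\mathcal{W}$. Write $f\,\square\,g$, for $f:A\to B$ and $g:X\to Y$, if for all $u:A\to X$, $v:B\to Y$ with $gu=vf$ there is $\alpha:B\to X$ with $\alpha f=u$ and $g\alpha=v$. For a class $\mathcal{A}$ of morphisms, ${}^\square\mathcal{A}$ (resp. $\mathcal{A}^\square$) is the class of morphisms $f$ with $f\,\square\,a$ (resp. $a\,\square\,f$) for all $a\in\mathcal{A}$. A cylinder object for $X$ is a factorisation $X\coprod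 X\to X'\xrightarrow{\sim}X$ of the codiagonal $\nabla$ whose second morphism is in $\mathcal{W}$. A left homotopy from $f$ to $g$ ($f,g:X\to Y$) is a morphism $H:X'\to Y$ from a cylinder object such that $X\coprod X\to X'\xrightarrow{H}Y$ is $[f\ g]$; if one exists write $f\sim^l g$. A path object for $Y$ is a factorisation $Y\xrightarrow{\sim}Y'\to Y\times Y$ of the diagonal whose first morphism is in $\mathcal{W}$. A right homotopy from $f$ to $g$ is a morphism $K:X\to Y'$ to a path object such that $X\xrightarrow{K}Y'\to Y\times Y$ is $(f,g)$; if one exists write $f\sim^r g$. $f$ and $g$ are homotopic, $f\sim g$, if $f\sim^l g$ and $f\sim^r g$. A morphism is null-homotopic if it is homotopic to the zero morphism. With $\emptyset$ initial and $\ast$ final, $X$ is fibrant if $X\to\ast$ is a fibration, and $B$ is cofibrant if $\emptyset\to B$ is a cofibration. For $f:A\to B$, $g:X\to Y$, write $f\,\square^r\,g$ (resp. $f\,\square^l\,g$) if for all $u:A\to X$, $v:B\to Y$ with $gu=vf$ there is $\alpha:B\to X$ with $g\alpha=v$ and $\alpha f\sim^r u$ (resp. $g\alpha\sim^l v$ and $\alpha f=u$). A morphism $j$ is a homotopy cofibration if $j\,\square^r\,p$ and $j\,\square^l\,p$ for every $p\in\mathcal{W}\cap\mathcal{F}ib$. $\mathcal{C}$ with $(\mathcal{W},\mathcal{C}of,\mathcal{F}ib)$ is a left-weak model category if: (0) $\mathcal{C}$ has finite products and coproducts (including an initial object $\emptyset$ and a final object $\ast$). Pull-backs of trivial fibrations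 along epimorphisms exist and are trivial fibrations. (0.5) If $A$ is cofibrant and $A\to B$ is a homotopy cofibration, then $B$ is cofibrant. If $B$ is cofibrant, then for every $A$ the canonical inclusions $A\to A\coprod B$ and $A\to B\coprod A$ are cofibrations. (1) If $f,g$ are composable and any two of $f,g,gf$ are in $\mathcal{W}$, then so is the third. (2) $\mathcal{W},\mathcal{C}of,\mathcal{F}ib$ contain all identities and are stable under composition and retracts (in the category of morphisms). (3) $\mathcal{W}\cap\mathcal{C}of\subseteq{}^\square\mathcal{F}ib$ and $\mathcal{C}of\subseteq{}^\square(\mathcal{F}ib\cap\mathcal{W})$. (4) Every morphism factors as a trivial cofibration followed by a fibration. Every morphism with cofibrant domain factors as a homotopy cofibration followed by a trivial fibration. Such a structure is cofibrantly generated if there are two sets of morphisms $I$ and $J$ with $\mathcal{F}ib=J^\square$, $\mathcal{W}\cap\mathcal{F}ib=I^\square$ and $\mathcal{C}of={}^\square(I^\square)$. *)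

theory Defs
  imports "HOL-Algebra.Group"
begin

unbundle cardinal_syntax

text \<open>
  Collections of objects or arrows are HOL sets; they play the role of the classes of the usual
  set-theoretic language. ``Small'' is therefore a separate notion, see \<open>small_wrt\<close> below.
  Composition \<open>g \<cdot> f\<close> is meaningful only if \<open>Cod f = Dom g\<close>.
\<close>

section \<open>Categories\<close>

record ('o, 'm) cat =
  Obj :: "'o set"
  Arr :: "'m set"
  Dom :: "'m \<Rightarrow> 'o"
  Cod :: "'m \<Rightarrow> 'o"
  Id :: "'o \<Rightarrow> 'm"
  Comp :: "'m \<Rightarrow> 'm \<Rightarrow> 'm"  (infixr "\<cdot>\<index>" 75)

definition Hom :: "('o, 'm, 'c) cat_scheme \<Rightarrow> 'o \<Rightarrow> 'o \<Rightarrow> 'm set" where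
  "Hom C X Y = {f \<in> Arr C. Dom C f = X \<and> Cod C f = Y}"

locale category =
  fixes C :: "('o, 'm, 'c) cat_scheme" (structure)
  assumes Dom_in_Obj: "f \<in> Arr C \<Longrightarrow> Dom C f \<in> Obj C"
    and Cod_in_Obj: "f \<in> Arr C \<Longrightarrow> Cod C f \<in> Obj C"
    and Id_in_Hom: "X \<in> Obj C \<Longrightarrow> Id C X \<in> Hom C X X"
    and Comp_in_Hom: "\<lbrakk>f \<in> Hom C X Y; g \<in> Hom C Y Z\<rbrakk> \<Longrightarrow> g \<cdot> f \<in> Hom C X Z"
    and Comp_Id: "f \<in> Hom C X Y \<Longrightarrow> f \<cdot> Id C X = f"
    and Id_Comp: "f \<in> Hom C X Y \<Longrightarrow> Id C Y \<cdot> f = f"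
    and Comp_assoc:
      "\<lbrakk>f \<in> Hom C X Y; g \<in> Hom C Y Z; h \<in> Hom C Z A\<rbrakk> \<Longrightarrow> (h \<cdot> g) \<cdot> f = h \<cdot> (g \<cdot> f)"

context
  fixes C :: "('o, 'm, 'c) cat_scheme" (structure)
begin

definition is_iso :: "'m \<Rightarrow> bool" where
  "is_iso f \<longleftrightarrow> f \<in> Arr C \<and>
     (\<exists>g \<in> Hom C (Cod C f) (Dom C f). g \<cdot> f = Id C (Dom C f) \<and> f \<cdot> g = Id C (Cod C f))"

definition isomorphic :: "'o \<Rightarrow> 'o \<Rightarrow> bool" where
  "isomorphic X Y \<longleftrightarrow> (\<exists>f \<in> Hom C X Y. is_iso f)"

definition is_epi :: "'m \<Rightarrow> bool" where
  "is_epi f \<longleftrightarrow> f \<in> Arr C \<and>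
     (\<forall>Z \<in> Obj C. \<forall>g \<in> Hom C (Cod C f) Z. \<forall>h \<in> Hom C (Cod C f) Z. g \<cdot> f = h \<cdot> f \<longrightarrow> g = h)"

definition is_product :: "'i set \<Rightarrow> ('i \<Rightarrow> 'o) \<Rightarrow> 'o \<Rightarrow> ('i \<Rightarrow> 'm) \<Rightarrow> bool" where
  "is_product I X P p \<longleftrightarrow> P \<in> Obj C \<and> (\<forall>i \<in> I. p i \<in> Hom C P (X i)) \<and>
     (\<forall>A \<in> Obj C. \<forall>f. (\<forall>i \<in> I. f i \<in> Hom C A (X i)) \<longrightarrow>
        (\<exists>!h. h \<in> Hom C A P \<and> (\<forall>i \<in> I. p i \<cdot> h = f i)))"

definition is_coproduct :: "'i set \<Rightarrow> ('i \<Rightarrow> 'o) \<Rightarrow> 'o \<Rightarrow> ('i \<Rightarrow> 'm) \<Rightarrow> bool" where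
  "is_coproduct I X P e \<longleftrightarrow> P \<in> Obj C \<and> (\<forall>i \<in> I. e i \<in> Hom C (X i) P) \<and>
     (\<forall>A \<in> Obj C. \<forall>f. (\<forall>i \<in> I. f i \<in> Hom C (X i) A) \<longrightarrow>
        (\<exists>!h. h \<in> Hom C P A \<and> (\<forall>i \<in> I. h \<cdot> e i = f i)))"

definition is_binary_product :: "'o \<Rightarrow> 'o \<Rightarrow> 'o \<Rightarrow> 'm \<Rightarrow> 'm \<Rightarrow> bool" where
  "is_binary_product X Y P p q \<longleftrightarrow>
     is_product (UNIV :: bool set) (\<lambda>b. if b then X else Y) P (\<lambda>b. if b then p else q)"

definition is_binary_coproduct :: "'o \<Rightarrow> 'o \<Rightarrow> 'o \<Rightarrow> 'm \<Rightarrow> 'm \<Rightarrow> bool" where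
  "is_binary_coproduct X Y P i j \<longleftrightarrow>
     is_coproduct (UNIV :: bool set) (\<lambda>b. if b then X else Y) P (\<lambda>b. if b then i else j)"

text \<open>The case \<open>n = 0\<close> provides a final object, respectively an initial object.\<close>

definition has_finite_products :: bool where
  "has_finite_products \<longleftrightarrow>
     (\<forall>(n::nat) X. (\<forall>i<n. X i \<in> Obj C) \<longrightarrow> (\<exists>P p. is_product {..<n} X P p))"

definition has_finite_coproducts :: bool where
  "has_finite_coproducts \<longleftrightarrow>
     (\<forall>(n::nat) X. (\<forall>i<n. X i \<in> Obj C) \<longrightarrow> (\<exists>P e. is_coproduct {..<n} X P e))"

definition is_initial :: "'o \<Rightarrow> bool" where
  "is_initial X \<longleftrightarrow> X \<in> Obj C \<and> (\<forall>Y \<in> Obj C. \<exists>!f. f \<in> Hom C X Y)"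

definition is_final :: "'o \<Rightarrow> bool" where
  "is_final X \<longleftrightarrow> X \<in> Obj C \<and> (\<forall>Y \<in> Obj C. \<exists>!f. f \<in> Hom C Y X)"

text \<open>\<open>q\<close> is the pull-back of \<open>p\<close> along \<open>e\<close>, and \<open>r\<close> is the other projection.\<close>

definition is_pullback :: "'m \<Rightarrow> 'm \<Rightarrow> 'm \<Rightarrow> 'm \<Rightarrow> bool" where
  "is_pullback p e q r \<longleftrightarrow>
     p \<in> Arr C \<and> e \<in> Arr C \<and> q \<in> Arr C \<and> r \<in> Arr C \<and>
     Cod C p = Cod C e \<and> Dom C q = Dom C r \<and> Cod C q = Dom C e \<and> Cod C r = Dom C p \<and>
     p \<cdot> r = e \<cdot> q \<and>
     (\<forall>A \<in> Obj C. \<forall>a \<in> Hom C A (Dom C e). \<forall>b \<in> Hom C A (Dom C p). p \<cdot> b = e \<cdot> a \<longrightarrow>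
        (\<exists>!h. h \<in> Hom C A (Dom C q) \<and> q \<cdot> h = a \<and> r \<cdot> h = b))"

text \<open>\<open>f\<close> is a retract of \<open>g\<close> in the category of morphisms.\<close>

definition is_retract :: "'m \<Rightarrow> 'm \<Rightarrow> bool" where
  "is_retract f g \<longleftrightarrow> f \<in> Arr C \<and> g \<in> Arr C \<and>
     (\<exists>i \<in> Hom C (Dom C f) (Dom C g). \<exists>r \<in> Hom C (Dom C g) (Dom C f).
      \<exists>i' \<in> Hom C (Cod C f) (Cod C g). \<exists>r' \<in> Hom C (Cod C g) (Cod C f).
        r \<cdot> i = Id C (Dom C f) \<and> r' \<cdot> i' = Id C (Cod C f) \<and>
        g \<cdot> i = i' \<cdot> f \<and> f \<cdot> r = r' \<cdot> g)"


section \<open>Homotopical notions\<close>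

definition lifts :: "'m \<Rightarrow> 'm \<Rightarrow> bool" where
  "lifts f g \<longleftrightarrow>
     (\<forall>u \<in> Hom C (Dom C f) (Dom C g). \<forall>v \<in> Hom C (Cod C f) (Cod C g). g \<cdot> u = v \<cdot> f \<longrightarrow>
        (\<exists>\<alpha> \<in> Hom C (Cod C f) (Dom C g). \<alpha> \<cdot> f = u \<and> g \<cdot> \<alpha> = v))"

definition llp :: "'m set \<Rightarrow> 'm set" where
  "llp A = {f \<in> Arr C. \<forall>a \<in> A. lifts f a}"

definition rlp :: "'m set \<Rightarrow> 'm set" where
  "rlp A = {f \<in> Arr C. \<forall>a \<in> A. lifts a f}"

text \<open>
  Here \<open>c : X \<amalg> X \<rightarrow> X'\<close> and \<open>s : X' \<rightarrow> X\<close> form a cylinder object: the equations on \<open>s \<cdot> c\<close> say that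
  it is the codiagonal. Likewise \<open>H \<cdot> c = [f g]\<close> is expressed through the coproduct inclusions.
  Right homotopies are described dually.
\<close>

definition left_homotopic :: "'m set \<Rightarrow> 'm \<Rightarrow> 'm \<Rightarrow> bool" where
  "left_homotopic W f g \<longleftrightarrow> f \<in> Arr C \<and> g \<in> Hom C (Dom C f) (Cod C f) \<and>
     (\<exists>P i j X' c s H.
        is_binary_coproduct (Dom C f) (Dom C f) P i j \<and>
        c \<in> Hom C P X' \<and> s \<in> Hom C X' (Dom C f) \<and> s \<in> W \<and>
        (s \<cdot> c) \<cdot> i = Id C (Dom C f) \<and> (s \<cdot> c) \<cdot> j = Id C (Dom C f) \<and>
        H \<in> Hom C X' (Cod C f) \<and> (H \<cdot> c) \<cdot> i = f \<and> (H \<cdot> c) \<cdot> j = g)"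

definition right_homotopic :: "'m set \<Rightarrow> 'm \<Rightarrow> 'm \<Rightarrow> bool" where
  "right_homotopic W f g \<longleftrightarrow> f \<in> Arr C \<and> g \<in> Hom C (Dom C f) (Cod C f) \<and>
     (\<exists>P p q Y' s d K.
        is_binary_product (Cod C f) (Cod C f) P p q \<and>
        s \<in> Hom C (Cod C f) Y' \<and> s \<in> W \<and> d \<in> Hom C Y' P \<and>
        p \<cdot> (d \<cdot> s) = Id C (Cod C f) \<and> q \<cdot> (d \<cdot> s) = Id C (Cod C f) \<and>
        K \<in> Hom C (Dom C f) Y' \<and> p \<cdot> (d \<cdot> K) = f \<and> q \<cdot> (d \<cdot> K) = g)"

definition homotopic :: "'m set \<Rightarrow> 'm \<Rightarrow> 'm \<Rightarrow> bool" where
  "homotopic W f g \<longleftrightarrow> left_homotopic W f g \<and> right_homotopic W f g"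

definition fibrant :: "'m set \<Rightarrow> 'o \<Rightarrow> bool" where
  "fibrant Fib X \<longleftrightarrow> (\<exists>Z. is_final Z \<and> (\<exists>f \<in> Hom C X Z. f \<in> Fib))"

definition cofibrant :: "'m set \<Rightarrow> 'o \<Rightarrow> bool" where
  "cofibrant Cof B \<longleftrightarrow> (\<exists>Z. is_initial Z \<and> (\<exists>f \<in> Hom C Z B. f \<in> Cof))"

definition lifts_right :: "'m set \<Rightarrow> 'm \<Rightarrow> 'm \<Rightarrow> bool" where
  "lifts_right W f g \<longleftrightarrow>
     (\<forall>u \<in> Hom C (Dom C f) (Dom C g). \<forall>v \<in> Hom C (Cod C f) (Cod C g). g \<cdot> u = v \<cdot> f \<longrightarrow>
        (\<exists>\<alpha> \<in> Hom C (Cod C f) (Dom C g). g \<cdot> \<alpha> = v \<and> right_homotopic W (\<alpha> \<cdot> f) u))"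

definition lifts_left :: "'m set \<Rightarrow> 'm \<Rightarrow> 'm \<Rightarrow> bool" where
  "lifts_left W f g \<longleftrightarrow>
     (\<forall>u \<in> Hom C (Dom C f) (Dom C g). \<forall>v \<in> Hom C (Cod C f) (Cod C g). g \<cdot> u = v \<cdot> f \<longrightarrow>
        (\<exists>\<alpha> \<in> Hom C (Cod C f) (Dom C g). left_homotopic W (g \<cdot> \<alpha>) v \<and> \<alpha> \<cdot> f = u))"

definition homotopy_cofibration :: "'m set \<Rightarrow> 'm set \<Rightarrow> 'm \<Rightarrow> bool" where
  "homotopy_cofibration W Fib j \<longleftrightarrow> j \<in> Arr C \<and>
     (\<forall>p \<in> W \<inter> Fib. lifts_right W j p \<and> lifts_left W j p)"

definition stable_class :: "'m set \<Rightarrow> bool" where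
  "stable_class A \<longleftrightarrow> A \<subseteq> Arr C \<and> (\<forall>X \<in> Obj C. Id C X \<in> A) \<and>
     (\<forall>f \<in> A. \<forall>g \<in> A. Cod C f = Dom C g \<longrightarrow> g \<cdot> f \<in> A) \<and>
     (\<forall>f g. is_retract f g \<and> g \<in> A \<longrightarrow> f \<in> A)"

end

locale left_weak_model_category = category C
  for C :: "('o, 'm, 'c) cat_scheme" (structure) +
  fixes W Cof Fib :: "'m set"
  assumes finite_products: "has_finite_products C"
    and finite_coproducts: "has_finite_coproducts C"
    and pullback_exists:
      "\<lbrakk>p \<in> W \<inter> Fib; is_epi C e; Cod C e = Cod C p\<rbrakk> \<Longrightarrow> \<exists>q r. is_pullback C p e q r"
    and pullback_trivial_fibration:
      "\<lbrakk>p \<in> W \<inter> Fib; is_epi C e; is_pullback C p e q r\<rbrakk> \<Longrightarrow> q \<in> W \<inter> Fib"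
    and cofibrant_cod:
      "\<lbrakk>cofibrant C Cof A; j \<in> Hom C A B; homotopy_cofibration C W Fib j\<rbrakk> \<Longrightarrow> cofibrant C Cof B"
    and inclusion_left:
      "\<lbrakk>cofibrant C Cof B; A \<in> Obj C; is_binary_coproduct C A B P i j\<rbrakk> \<Longrightarrow> i \<in> Cof"
    and inclusion_right:
      "\<lbrakk>cofibrant C Cof B; A \<in> Obj C; is_binary_coproduct C B A P i j\<rbrakk> \<Longrightarrow> j \<in> Cof"
    and two_of_three:
      "\<lbrakk>f \<in> Hom C X Y; g \<in> Hom C Y Z\<rbrakk> \<Longrightarrow>
         (f \<in> W \<and> g \<in> W \<longrightarrow> g \<cdot> f \<in> W) \<and> (f \<in> W \<and> g \<cdot> f \<in> W \<longrightarrow> g \<in> W) \<and>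
         (g \<in> W \<and> g \<cdot> f \<in> W \<longrightarrow> f \<in> W)"
    and stable_W: "stable_class C W"
    and stable_Cof: "stable_class C Cof"
    and stable_Fib: "stable_class C Fib"
    and lifting_trivial_cofibration: "W \<inter> Cof \<subseteq> llp C Fib"
    and lifting_trivial_fibration: "Cof \<subseteq> llp C (Fib \<inter> W)"
    and factorisation:
      "f \<in> Hom C X Y \<Longrightarrow>
         \<exists>Z. \<exists>j \<in> Hom C X Z. \<exists>p \<in> Hom C Z Y. j \<in> W \<inter> Cof \<and> p \<in> Fib \<and> f = p \<cdot> j"
    and weak_factorisation:
      "\<lbrakk>f \<in> Hom C X Y; cofibrant C Cof X\<rbrakk> \<Longrightarrow>
         \<exists>Z. \<exists>j \<in> Hom C X Z. \<exists>p \<in> Hom C Z Y.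
           homotopy_cofibration C W Fib j \<and> p \<in> W \<inter> Fib \<and> f = p \<cdot> j"


section \<open>Smallness\<close>

text \<open>
  A collection is small if its cardinality is below a fixed infinite cardinal \<open>\<kappa>\<close>. Sets as opposed
  to proper classes correspond to \<open>\<kappa>\<close> being the cardinality of a Grothendieck universe; nothing
  beyond the infinity of \<open>\<kappa>\<close> is required below. The cardinal \<open>\<kappa>\<close> is a well-order on an arbitrary type,
  unrelated to the types of objects and arrows.
\<close>

definition small_wrt :: "'k rel \<Rightarrow> 'a set \<Rightarrow> bool" where
  "small_wrt \<kappa> A \<longleftrightarrow> |A| <o \<kappa>"

definition skeletally_small :: "'k rel \<Rightarrow> ('o, 'm, 'c) cat_scheme \<Rightarrow> 'o set \<Rightarrow> bool" where
  "skeletally_small \<kappa> C T \<longleftrightarrow>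
     (\<exists>S \<subseteq> T. small_wrt \<kappa> S \<and> (\<forall>X \<in> T. \<exists>Y \<in> S. isomorphic C X Y))"

definition cofibrantly_generated ::
    "'k rel \<Rightarrow> ('o, 'm, 'c) cat_scheme \<Rightarrow> 'm set \<Rightarrow> 'm set \<Rightarrow> 'm set \<Rightarrow> bool" where
  "cofibrantly_generated \<kappa> C W Cof Fib \<longleftrightarrow>
     (\<exists>I J. I \<subseteq> Arr C \<and> J \<subseteq> Arr C \<and> small_wrt \<kappa> I \<and> small_wrt \<kappa> J \<and>
        Fib = rlp C J \<and> W \<inter> Fib = rlp C I \<and> Cof = llp C (rlp C I))"


section \<open>Triangulated categories\<close>

record ('o, 'm) preadd_cat = "('o, 'm) cat" +
  Zero :: "'o \<Rightarrow> 'o \<Rightarrow> 'm"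
  Add :: "'m \<Rightarrow> 'm \<Rightarrow> 'm"  (infixl "\<oplus>\<index>" 65)

text \<open>The abelian group \<open>C(X, Y)\<close>, in the multiplicative vocabulary of \<open>comm_group\<close>.\<close>

definition Hom_group :: "('o, 'm, 'c) preadd_cat_scheme \<Rightarrow> 'o \<Rightarrow> 'o \<Rightarrow> 'm monoid" where
  "Hom_group C X Y = \<lparr>carrier = Hom C X Y, monoid.mult = Add C, one = Zero C X Y\<rparr>"

definition Neg :: "('o, 'm, 'c) preadd_cat_scheme \<Rightarrow> 'm \<Rightarrow> 'm" where
  "Neg C f = inv\<^bsub>Hom_group C (Dom C f) (Cod C f)\<^esub> f"

definition is_zero_object :: "('o, 'm, 'c) cat_scheme \<Rightarrow> 'o \<Rightarrow> bool" where
  "is_zero_object C Z \<longleftrightarrow> is_initial C Z \<and> is_final C Z"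

definition is_biproduct ::
    "('o, 'm, 'c) preadd_cat_scheme \<Rightarrow> 'o \<Rightarrow> 'o \<Rightarrow> 'o \<Rightarrow> 'm \<Rightarrow> 'm \<Rightarrow> 'm \<Rightarrow> 'm \<Rightarrow> bool" where
  "is_biproduct C X Y P i j p q \<longleftrightarrow>
     X \<in> Obj C \<and> Y \<in> Obj C \<and> P \<in> Obj C \<and>
     i \<in> Hom C X P \<and> j \<in> Hom C Y P \<and> p \<in> Hom C P X \<and> q \<in> Hom C P Y \<and>
     p \<cdot>\<^bsub>C\<^esub> i = Id C X \<and> q \<cdot>\<^bsub>C\<^esub> j = Id C Y \<and> p \<cdot>\<^bsub>C\<^esub> j = Zero C Y X \<and> q \<cdot>\<^bsub>C\<^esub> i = Zero C X Y \<and>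
     (i \<cdot>\<^bsub>C\<^esub> p) \<oplus>\<^bsub>C\<^esub> (j \<cdot>\<^bsub>C\<^esub> q) = Id C P"

locale additive_category = category C
  for C :: "('o, 'm, 'c) preadd_cat_scheme" (structure) +
  assumes Hom_comm_group:
      "\<lbrakk>X \<in> Obj C; Y \<in> Obj C\<rbrakk> \<Longrightarrow> comm_group (Hom_group C X Y)"
    and Comp_Add_left: "\<lbrakk>f \<in> Hom C X Y; g \<in> Hom C Y Z; h \<in> Hom C Y Z\<rbrakk> \<Longrightarrow>
          (g \<oplus> h) \<cdot> f = (g \<cdot> f) \<oplus> (h \<cdot> f)"
    and Comp_Add_right: "\<lbrakk>f \<in> Hom C X Y; g \<in> Hom C X Y; h \<in> Hom C Y Z\<rbrakk> \<Longrightarrow>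
          h \<cdot> (f \<oplus> g) = (h \<cdot> f) \<oplus> (h \<cdot> g)"
    and zero_object_exists: "\<exists>Z. is_zero_object C Z"
    and biproduct_exists:
      "\<lbrakk>X \<in> Obj C; Y \<in> Obj C\<rbrakk> \<Longrightarrow> \<exists>P i j p q. is_biproduct C X Y P i j p q"

text \<open>
  \<open>Tri\<close> is the class of distinguished triangles \<open>X \<rightarrow> Y \<rightarrow> Z \<rightarrow> \<Sigma>X\<close>, each given by its three morphisms.
\<close>

record ('o, 'm) tri_cat = "('o, 'm) preadd_cat" +
  SuspO :: "'o \<Rightarrow> 'o"
  Susp :: "'m \<Rightarrow> 'm"
  Tri :: "('m \<times> 'm \<times> 'm) set"

text \<open>The suspension is an additive auto-equivalence; it need not be strictly invertible.\<close>

locale triangulated_category = additive_category C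
  for C :: "('o, 'm, 'c) tri_cat_scheme" (structure) +
  assumes SuspO_in_Obj: "X \<in> Obj C \<Longrightarrow> SuspO C X \<in> Obj C"
    and Susp_in_Hom: "f \<in> Hom C X Y \<Longrightarrow> Susp C f \<in> Hom C (SuspO C X) (SuspO C Y)"
    and Susp_Id: "X \<in> Obj C \<Longrightarrow> Susp C (Id C X) = Id C (SuspO C X)"
    and Susp_Comp:
      "\<lbrakk>f \<in> Hom C X Y; g \<in> Hom C Y Z\<rbrakk> \<Longrightarrow> Susp C (g \<cdot> f) = Susp C g \<cdot> Susp C f"
    and Susp_Add:
      "\<lbrakk>f \<in> Hom C X Y; g \<in> Hom C X Y\<rbrakk> \<Longrightarrow> Susp C (f \<oplus> g) = Susp C f \<oplus> Susp C g"
    and Susp_fully_faithful: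
      "\<lbrakk>X \<in> Obj C; Y \<in> Obj C\<rbrakk> \<Longrightarrow>
         bij_betw (Susp C) (Hom C X Y) (Hom C (SuspO C X) (SuspO C Y))"
    and Susp_essentially_surjective:
      "Y \<in> Obj C \<Longrightarrow> \<exists>X \<in> Obj C. isomorphic C (SuspO C X) Y"
    and Tri_form:
      "(u, v, w) \<in> Tri C \<Longrightarrow>
         \<exists>X Y Z. u \<in> Hom C X Y \<and> v \<in> Hom C Y Z \<and> w \<in> Hom C Z (SuspO C X)"
    and Tri_iso:
      "\<lbrakk>(u, v, w) \<in> Tri C;
        u' \<in> Hom C X' Y'; v' \<in> Hom C Y' Z'; w' \<in> Hom C Z' (SuspO C X');
        a \<in> Hom C (Dom C u) X'; b \<in> Hom C (Dom C v) Y'; c \<in> Hom C (Dom C w) Z';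
        is_iso C a; is_iso C b; is_iso C c;
        u' \<cdot> a = b \<cdot> u; v' \<cdot> b = c \<cdot> v; w' \<cdot> c = Susp C a \<cdot> w\<rbrakk> \<Longrightarrow> (u', v', w') \<in> Tri C"
    and Tri_Id:
      "\<lbrakk>X \<in> Obj C; is_zero_object C Z\<rbrakk> \<Longrightarrow> (Id C X, Zero C X Z, Zero C Z (SuspO C X)) \<in> Tri C"
    and Tri_complete: "u \<in> Arr C \<Longrightarrow> \<exists>v w. (u, v, w) \<in> Tri C"
    and Tri_rotate:
      "\<lbrakk>u \<in> Hom C X Y; v \<in> Hom C Y Z; w \<in> Hom C Z (SuspO C X)\<rbrakk> \<Longrightarrow>
         (u, v, w) \<in> Tri C \<longleftrightarrow> (v, w, Neg C (Susp C u)) \<in> Tri C"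
    and Tri_morphism:
      "\<lbrakk>(u, v, w) \<in> Tri C; (u', v', w') \<in> Tri C;
        f \<in> Hom C (Dom C u) (Dom C u'); g \<in> Hom C (Cod C u) (Cod C u'); u' \<cdot> f = g \<cdot> u\<rbrakk> \<Longrightarrow>
         \<exists>h \<in> Hom C (Cod C v) (Cod C v'). v' \<cdot> g = h \<cdot> v \<and> w' \<cdot> h = Susp C f \<cdot> w"
    and Tri_octahedral:
      "\<lbrakk>f \<in> Hom C X Y; g \<in> Hom C Y Z;
        (f, p1, d1) \<in> Tri C; (g \<cdot> f, p2, d2) \<in> Tri C; (g, p3, d3) \<in> Tri C\<rbrakk> \<Longrightarrow>
         \<exists>a \<in> Hom C (Cod C p1) (Cod C p2). \<exists>b \<in> Hom C (Cod C p2) (Cod C p3).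
           (a, b, Susp C p1 \<cdot> d3) \<in> Tri C \<and>
           a \<cdot> p1 = p2 \<cdot> g \<and> d2 \<cdot> a = d1 \<and> b \<cdot> p2 = p3 \<and> d3 \<cdot> b = Susp C f \<cdot> d2"


text \<open>A full subcategory is given by its set of objects.\<close>

definition strictly_full :: "('o, 'm, 'c) cat_scheme \<Rightarrow> 'o set \<Rightarrow> bool" where
  "strictly_full C D \<longleftrightarrow> D \<subseteq> Obj C \<and> (\<forall>X \<in> D. \<forall>Y \<in> Obj C. isomorphic C X Y \<longrightarrow> Y \<in> D)"

definition summand_closed :: "('o, 'm, 'c) preadd_cat_scheme \<Rightarrow> 'o set \<Rightarrow> bool" where
  "summand_closed C D \<longleftrightarrow> (\<forall>X Y P i j p q. is_biproduct C X Y P i j p q \<and> P \<in> D \<longrightarrow> X \<in> D \<and> Y \<in> D)"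

definition perp :: "('o, 'm, 'c) preadd_cat_scheme \<Rightarrow> 'o set \<Rightarrow> 'o set" where
  "perp C D = {X \<in> Obj C. \<forall>A \<in> D. Hom C A X = {Zero C A X}}"

definition ideal_of :: "('o, 'm, 'c) cat_scheme \<Rightarrow> 'o set \<Rightarrow> 'm set" where
  "ideal_of C D = {f \<in> Arr C. \<exists>A \<in> D. \<exists>g \<in> Hom C (Dom C f) A. \<exists>h \<in> Hom C A (Cod C f). f = h \<cdot>\<^bsub>C\<^esub> g}"

definition rigid :: "('o, 'm, 'c) tri_cat_scheme \<Rightarrow> 'o set \<Rightarrow> bool" where
  "rigid C D \<longleftrightarrow> SuspO C ` D \<subseteq> perp C D"

definition contravariantly_finite :: "('o, 'm, 'c) cat_scheme \<Rightarrow> 'o set \<Rightarrow> bool" where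
  "contravariantly_finite C D \<longleftrightarrow>
     (\<forall>X \<in> Obj C. \<exists>A \<in> D. \<exists>f \<in> Hom C A X. \<forall>A' \<in> D. \<forall>g \<in> Hom C A' X. \<exists>h \<in> Hom C A' A. f \<cdot>\<^bsub>C\<^esub> h = g)"

text \<open>The objects of \<open>T * \<Sigma>T\<close>.\<close>

definition star_susp :: "('o, 'm, 'c) tri_cat_scheme \<Rightarrow> 'o set \<Rightarrow> 'o set" where
  "star_susp C T = {Y \<in> Obj C. \<exists>T1 \<in> T. \<exists>T0 \<in> T. \<exists>u v w. (u, v, w) \<in> Tri C \<and>
     u \<in> Hom C T1 T0 \<and> v \<in> Hom C T0 Y \<and> w \<in> Hom C Y (SuspO C T1)}"

definition null_homotopic :: "('o, 'm, 'c) preadd_cat_scheme \<Rightarrow> 'm set \<Rightarrow> 'm \<Rightarrow> bool" where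
  "null_homotopic C W f \<longleftrightarrow> homotopic C W f (Zero C (Dom C f) (Cod C f))"

definition weak_equivs :: "('o, 'm, 'c) tri_cat_scheme \<Rightarrow> 'o set \<Rightarrow> 'm set" where
  "weak_equivs C T = {f \<in> Arr C. \<forall>u v. (u, f, v) \<in> Tri C \<longrightarrow>
     u \<in> ideal_of C (perp C T) \<and> v \<in> ideal_of C (perp C T)}"

end

theory Submission
  imports Defs
begin

text \<open>
  Everything is controlled by the functors \<open>C(A,-)\<close> for \<open>A\<close> in \<open>T\<close>.  The cone \<open>U\<close> of a right
  approximation \<open>T\<^sub>0 \<rightarrow> X\<close> lies in \<open>T\<^sup>\<bottom>\<close>: a map \<open>A \<rightarrow> U\<close> dies in \<open>\<Sigma>T\<^sub>0\<close> by rigidity, so it comes from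
  \<open>X\<close>, hence from \<open>T\<^sub>0\<close> (\<open>approximation_cone_perp\<close>).  Therefore a map is in the ideal \<open>(T\<^sup>\<bottom>)\<close> if and
  only if all \<open>C(A,-)\<close> kill it (\<open>ideal_iff\<close>), and by the long exact sequence of one triangle \<open>f\<close> is a
  weak equivalence if and only if all \<open>C(A,f)\<close> are bijective (\<open>W_iff\<close>).  Left and right homotopy both
  become equality of the maps induced on all \<open>C(A,-)\<close>, which identifies the null-homotopic maps
  (\<open>left_homotopic_iff\<close>, \<open>right_homotopic_iff\<close>).

  Fibrations are the maps \<open>f\<close> with \<open>C(\<Sigma>A,f)\<close> surjective for \<open>A\<close> in \<open>T\<close>, and cofibrations are the maps
  with the left lifting property against trivial fibrations.  Every object is fibrant.  A map is a
  trivial fibration if and only if it is surjective on all \<open>C(A,-)\<close> and its fibre is in \<open>T\<^sup>\<bottom>\<close>, and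
  this makes the objects of \<open>T * \<Sigma>T\<close> cofibrant.  Conversely, approximating \<open>B\<close> and then the fibre of
  that approximation gives, by the octahedral axiom, a trivial fibration \<open>Q \<rightarrow> B\<close> with \<open>Q\<close> in
  \<open>T * \<Sigma>T\<close> (\<open>cofibrant_replacement\<close>); if \<open>B\<close> is cofibrant this map splits, and the splitting makes the
  fibre of \<open>T\<^sub>0 \<rightarrow> B\<close> a summand of an object of \<open>T\<close> (\<open>surj_trivial_fibration_star_susp\<close>).

  A map \<open>X \<rightarrow> Y\<close> factors as \<open>X \<rightarrow> X \<oplus> \<Sigma>A \<rightarrow> Y\<close> where \<open>\<Sigma>A \<rightarrow> Y\<close> is an approximation from \<open>\<Sigma>T\<close>; the first
  map lifts against all fibrations.  If \<open>X\<close> is in \<open>T * \<Sigma>T\<close>, with triangle \<open>T\<^sub>1 \<rightarrow> T\<^sub>0 \<rightarrow> X \<rightarrow> \<Sigma>T\<^sub>1\<close>, the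
  map also lifts to a cofibrant replacement \<open>Q \<rightarrow> Y\<close>, and \<open>X \<rightarrow> Q \<oplus> \<Sigma>T\<^sub>1 \<rightarrow> Y\<close> is a cofibration followed
  by a trivial fibration (\<open>factor_Cof_trivial_fibration\<close>); since homotopy is reflexive, a cofibration
  is in particular a homotopy cofibration.  Pull-backs along epimorphisms exist because
  epimorphisms split.

  The conditions that define fibrations and trivial fibrations are lifting properties against
  \<open>0 \<rightarrow> A\<close>, \<open>A \<rightarrow> 0\<close> and \<open>0 \<rightarrow> \<Sigma>A\<close>, where it is enough that \<open>A\<close> runs through representatives of the
  isomorphism classes of \<open>T\<close>; this gives cofibrant generation.
\<close>

section \<open>Categories\<close>

context category
begin

text \<open>
  Membership in \<open>Hom\<close> is split into conditions on \<open>Arr\<close>, \<open>Dom\<close> and \<open>Cod\<close>, so that the simplifier can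
  discharge the side conditions of the category laws without guessing intermediate objects.
\<close>

lemma Hom_iff [simp]: "f \<in> Hom C X Y \<longleftrightarrow> f \<in> Arr C \<and> Dom C f = X \<and> Cod C f = Y"
  by (auto simp: Hom_def)

lemma Hom_Obj: "f \<in> Hom C X Y \<Longrightarrow> X \<in> Obj C \<and> Y \<in> Obj C"
  using Dom_in_Obj Cod_in_Obj by auto

lemma Arr_Id [simp]: "X \<in> Obj C \<Longrightarrow> Id C X \<in> Arr C"
  and Dom_Id [simp]: "X \<in> Obj C \<Longrightarrow> Dom C (Id C X) = X"
  and Cod_Id [simp]: "X \<in> Obj C \<Longrightarrow> Cod C (Id C X) = X"
  using Id_in_Hom by auto

lemma Arr_Comp [simp]: "\<lbrakk>f \<in> Arr C; g \<in> Arr C; Cod C f = Dom C g\<rbrakk> \<Longrightarrow> g \<cdot> f \<in> Arr C"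
  and Dom_Comp [simp]: "\<lbrakk>f \<in> Arr C; g \<in> Arr C; Cod C f = Dom C g\<rbrakk> \<Longrightarrow> Dom C (g \<cdot> f) = Dom C f"
  and Cod_Comp [simp]: "\<lbrakk>f \<in> Arr C; g \<in> Arr C; Cod C f = Dom C g\<rbrakk> \<Longrightarrow> Cod C (g \<cdot> f) = Cod C g"
  using Comp_in_Hom[of f "Dom C f" "Dom C g" g "Cod C g"] by auto

lemma Comp_Id_right [simp]: "\<lbrakk>f \<in> Arr C; Dom C f = X\<rbrakk> \<Longrightarrow> f \<cdot> Id C X = f"
  using Comp_Id[of f "Dom C f" "Cod C f"] by auto

lemma Comp_Id_left [simp]: "\<lbrakk>f \<in> Arr C; Cod C f = X\<rbrakk> \<Longrightarrow> Id C X \<cdot> f = f"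
  using Id_Comp[of f "Dom C f" "Cod C f"] by auto

lemma Comp_reassoc [simp]:
  "\<lbrakk>f \<in> Arr C; g \<in> Arr C; h \<in> Arr C; Cod C f = Dom C g; Cod C g = Dom C h\<rbrakk>
    \<Longrightarrow> (h \<cdot> g) \<cdot> f = h \<cdot> (g \<cdot> f)"
  using Comp_assoc[of f "Dom C f" "Dom C g" g "Dom C h" h "Cod C h"] by auto

lemma Comp_eq_assoc:
  assumes "b \<cdot> a = k" "a \<in> Hom C X Y" "b \<in> Hom C Y Z" "x \<in> Hom C A X"
  shows "b \<cdot> (a \<cdot> x) = k \<cdot> x"
  using assms Comp_reassoc[of x a b] by auto

lemma ideal_of_iff:
  assumes "f \<in> Hom C X Y"
  shows "f \<in> ideal_of C D \<longleftrightarrow> (\<exists>A \<in> D. \<exists>g \<in> Hom C X A. \<exists>h \<in> Hom C A Y. f = h \<cdot> g)"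
proof -
  have "f \<in> Arr C" "Dom C f = X" "Cod C f = Y" using assms by simp_all
  then show ?thesis unfolding ideal_of_def by (simp del: Hom_iff)
qed

lemma is_isoE:
  assumes "is_iso C f" "f \<in> Hom C X Y"
  obtains g where "g \<in> Hom C Y X" "g \<cdot> f = Id C X" "f \<cdot> g = Id C Y"
  using assms unfolding is_iso_def by auto

lemma is_isoI:
  assumes "f \<in> Hom C X Y" "g \<in> Hom C Y X" "g \<cdot> f = Id C X" "f \<cdot> g = Id C Y"
  shows "is_iso C f"
  using assms unfolding is_iso_def by auto

lemma is_iso_Id: "X \<in> Obj C \<Longrightarrow> is_iso C (Id C X)"
  by (rule is_isoI[of _ X X "Id C X"]) auto

section \<open>Arrows seen from a fixed object\<close>

text \<open>
  Surjectivity and injectivity of the map that \<open>f\<close> induces on \<open>C(A,-)\<close>; the notions of fibration and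
  weak equivalence below are of this form.
\<close>

definition surj_from :: "'o \<Rightarrow> 'm \<Rightarrow> bool" where
  "surj_from A f \<longleftrightarrow> (\<forall>g \<in> Hom C A (Cod C f). \<exists>h \<in> Hom C A (Dom C f). f \<cdot> h = g)"

definition inj_from :: "'o \<Rightarrow> 'm \<Rightarrow> bool" where
  "inj_from A f \<longleftrightarrow> inj_on (\<lambda>g. f \<cdot> g) (Hom C A (Dom C f))"

lemma surj_fromE:
  assumes "surj_from A f" "f \<in> Hom C X Y" "g \<in> Hom C A Y"
  obtains h where "h \<in> Hom C A X" "f \<cdot> h = g"
proof -
  have "Dom C f = X" "Cod C f = Y" using assms(2) by auto
  then show ?thesis using that assms(1,3) unfolding surj_from_def by blast
qed

lemma surj_fromI:
  assumes "f \<in> Hom C X Y" "\<And>g. g \<in> Hom C A Y \<Longrightarrow> \<exists>h \<in> Hom C A X. f \<cdot> h = g"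
  shows "surj_from A f"
  using assms unfolding surj_from_def by auto

lemma inj_fromD:
  assumes "inj_from A f" "f \<in> Hom C X Y" "g \<in> Hom C A X" "h \<in> Hom C A X" "f \<cdot> g = f \<cdot> h"
  shows "g = h"
  using assms unfolding inj_from_def inj_on_def by auto

lemma inj_fromI:
  assumes "f \<in> Hom C X Y" "\<And>g h. \<lbrakk>g \<in> Hom C A X; h \<in> Hom C A X; f \<cdot> g = f \<cdot> h\<rbrakk> \<Longrightarrow> g = h"
  shows "inj_from A f"
  using assms unfolding inj_from_def inj_on_def by auto

lemma surj_from_Id: "X \<in> Obj C \<Longrightarrow> surj_from A (Id C X)"
  by (rule surj_fromI[of _ X X]) auto

lemma inj_from_Id: "X \<in> Obj C \<Longrightarrow> inj_from A (Id C X)"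
  by (rule inj_fromI[of _ X X]) auto

lemma surj_from_Comp:
  assumes f: "f \<in> Hom C X Y" and g: "g \<in> Hom C Y Z" and "surj_from A f" "surj_from A g"
  shows "surj_from A (g \<cdot> f)"
proof (rule surj_fromI)
  show "g \<cdot> f \<in> Hom C X Z" using f g by simp
  fix z assume "z \<in> Hom C A Z"
  then obtain y where y: "y \<in> Hom C A Y" "g \<cdot> y = z" using assms surj_fromE by blast
  then obtain x where x: "x \<in> Hom C A X" "f \<cdot> x = y" using assms surj_fromE by blast
  have "(g \<cdot> f) \<cdot> x = z" using x y f g by simp
  then show "\<exists>h \<in> Hom C A X. (g \<cdot> f) \<cdot> h = z" using x by blast
qed

lemma inj_from_Comp:
  assumes f: "f \<in> Hom C X Y" and g: "g \<in> Hom C Y Z" and "inj_from A f" "inj_from A g"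
  shows "inj_from A (g \<cdot> f)"
proof (rule inj_fromI)
  show "g \<cdot> f \<in> Hom C X Z" using f g by simp
  fix x y assume xy: "x \<in> Hom C A X" "y \<in> Hom C A X" "(g \<cdot> f) \<cdot> x = (g \<cdot> f) \<cdot> y"
  then have "g \<cdot> (f \<cdot> x) = g \<cdot> (f \<cdot> y)" using f g by simp
  then have "f \<cdot> x = f \<cdot> y" using inj_fromD[OF assms(4) g, of "f \<cdot> x" "f \<cdot> y"] xy f by simp
  then show "x = y" using inj_fromD[OF assms(3) f] xy by blast
qed

lemma surj_from_cancel_right:
  assumes f: "f \<in> Hom C X Y" and g: "g \<in> Hom C Y Z" and "surj_from A (g \<cdot> f)"
  shows "surj_from A g"
proof (rule surj_fromI[OF g])
  fix z assume "z \<in> Hom C A Z"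
  then obtain x where x: "x \<in> Hom C A X" "(g \<cdot> f) \<cdot> x = z"
    using surj_fromE[OF assms(3), of X Z z] f g by auto
  then show "\<exists>h \<in> Hom C A Y. g \<cdot> h = z" using f g by (intro bexI[of _ "f \<cdot> x"]) auto
qed

lemma inj_from_cancel_left:
  assumes f: "f \<in> Hom C X Y" and g: "g \<in> Hom C Y Z" and "inj_from A (g \<cdot> f)"
  shows "inj_from A f"
proof (rule inj_fromI[OF f])
  fix x y assume xy: "x \<in> Hom C A X" "y \<in> Hom C A X" "f \<cdot> x = f \<cdot> y"
  then have "(g \<cdot> f) \<cdot> x = (g \<cdot> f) \<cdot> y" using f g by simp
  then show "x = y" using inj_fromD[OF assms(3), of X Z x y] xy f g by auto
qed

lemma inj_from_cancel_right:
  assumes f: "f \<in> Hom C X Y" and g: "g \<in> Hom C Y Z" and "inj_from A (g \<cdot> f)" "surj_from A f"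
  shows "inj_from A g"
proof (rule inj_fromI[OF g])
  fix x y assume xy: "x \<in> Hom C A Y" "y \<in> Hom C A Y" "g \<cdot> x = g \<cdot> y"
  obtain x' where x': "x' \<in> Hom C A X" "f \<cdot> x' = x" using surj_fromE[OF assms(4) f xy(1)] .
  obtain y' where y': "y' \<in> Hom C A X" "f \<cdot> y' = y" using surj_fromE[OF assms(4) f xy(2)] .
  have "(g \<cdot> f) \<cdot> x' = (g \<cdot> f) \<cdot> y'" using x' y' f g xy by simp
  then have "x' = y'" using inj_fromD[OF assms(3), of X Z x' y'] x' y' f g by auto
  then show "x = y" using x' y' by simp
qed

lemma surj_from_cancel_left:
  assumes f: "f \<in> Hom C X Y" and g: "g \<in> Hom C Y Z" and "surj_from A (g \<cdot> f)" "inj_from A g"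
  shows "surj_from A f"
proof (rule surj_fromI[OF f])
  fix y assume y: "y \<in> Hom C A Y"
  then obtain x where x: "x \<in> Hom C A X" "(g \<cdot> f) \<cdot> x = g \<cdot> y"
    using surj_fromE[OF assms(3), of X Z "g \<cdot> y"] f g by auto
  then have "f \<cdot> x = y" using inj_fromD[OF assms(4) g, of "f \<cdot> x" y] y f g by simp
  then show "\<exists>h \<in> Hom C A X. f \<cdot> h = y" using x by blast
qed

lemma surj_from_retract:
  assumes "is_retract C f g" "surj_from A g"
  shows "surj_from A f"
proof -
  obtain i r i' r' where fA: "f \<in> Arr C" and gA: "g \<in> Arr C"
    and r: "r \<in> Hom C (Dom C g) (Dom C f)"
    and i': "i' \<in> Hom C (Cod C f) (Cod C g)" and r': "r' \<in> Hom C (Cod C g) (Cod C f)"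
    and ri': "r' \<cdot> i' = Id C (Cod C f)" and fr: "f \<cdot> r = r' \<cdot> g"
    using assms(1) unfolding is_retract_def by blast
  show ?thesis
  proof (rule surj_fromI)
    show "f \<in> Hom C (Dom C f) (Cod C f)" using fA by simp
    fix y assume y: "y \<in> Hom C A (Cod C f)"
    obtain x where x: "x \<in> Hom C A (Dom C g)" "g \<cdot> x = i' \<cdot> y"
      using surj_fromE[OF assms(2), of "Dom C g" "Cod C g" "i' \<cdot> y"] gA i' y by auto
    have "f \<cdot> (r \<cdot> x) = r' \<cdot> (g \<cdot> x)"
      using Comp_eq_assoc[OF fr, of "Dom C g" "Dom C f" "Cod C f" x A] x(1) r r' fA gA by simp
    also have "\<dots> = y" unfolding x(2)
      using Comp_eq_assoc[OF ri', of "Cod C f" "Cod C g" "Cod C f" y A] y i' r' fA by simp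
    finally show "\<exists>h \<in> Hom C A (Dom C f). f \<cdot> h = y" using x(1) r by (intro bexI[of _ "r \<cdot> x"]) auto
  qed
qed

lemma inj_from_retract:
  assumes "is_retract C f g" "inj_from A g"
  shows "inj_from A f"
proof -
  obtain i r i' where fA: "f \<in> Arr C" and gA: "g \<in> Arr C"
    and i: "i \<in> Hom C (Dom C f) (Dom C g)" and r: "r \<in> Hom C (Dom C g) (Dom C f)"
    and i': "i' \<in> Hom C (Cod C f) (Cod C g)"
    and ri: "r \<cdot> i = Id C (Dom C f)" and gi: "g \<cdot> i = i' \<cdot> f"
    using assms(1) unfolding is_retract_def by blast
  have "inj_from A i"
    by (rule inj_from_cancel_left[OF i r]) (use ri fA Dom_in_Obj inj_from_Id in auto)
  then have "inj_from A (g \<cdot> i)"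
    using inj_from_Comp[OF i, of g "Cod C g"] gA assms(2) by simp
  then have "inj_from A (i' \<cdot> f)" using gi by simp
  then show ?thesis using inj_from_cancel_left[of f "Dom C f" "Cod C f" i'] fA i' by simp
qed

text \<open>
  An isomorphism \<open>A \<cong> B\<close> identifies the functors \<open>C(A,-)\<close> and \<open>C(B,-)\<close>.  This reduces conditions on
  all objects of a skeletally small subcategory to conditions on a small set of objects.
\<close>

lemma surj_from_isomorphic:
  assumes "isomorphic C A B" "surj_from B f" "f \<in> Arr C"
  shows "surj_from A f"
proof -
  obtain a where a: "a \<in> Hom C A B" "is_iso C a" using assms(1) unfolding isomorphic_def by blast
  obtain b where b: "b \<in> Hom C B A" "b \<cdot> a = Id C A" "a \<cdot> b = Id C B" using is_isoE[OF a(2,1)] .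
  show ?thesis
  proof (rule surj_fromI)
    show f: "f \<in> Hom C (Dom C f) (Cod C f)" using assms by simp
    fix g assume g: "g \<in> Hom C A (Cod C f)"
    obtain h where h: "h \<in> Hom C B (Dom C f)" "f \<cdot> h = g \<cdot> b"
      using surj_fromE[OF assms(2) f, of "g \<cdot> b"] g b by auto
    have "f \<cdot> (h \<cdot> a) = g"
      using Comp_eq_assoc[OF h(2,1) f a(1)] g a b by simp
    then show "\<exists>h \<in> Hom C A (Dom C f). f \<cdot> h = g" using h a by (intro bexI[of _ "h \<cdot> a"]) auto
  qed
qed

lemma inj_from_isomorphic:
  assumes "isomorphic C A B" "inj_from B f" "f \<in> Arr C"
  shows "inj_from A f"
proof -
  obtain a where a: "a \<in> Hom C A B" "is_iso C a" using assms(1) unfolding isomorphic_def by blast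
  obtain b where b: "b \<in> Hom C B A" "b \<cdot> a = Id C A" "a \<cdot> b = Id C B" using is_isoE[OF a(2,1)] .
  show ?thesis
  proof (rule inj_fromI)
    show f: "f \<in> Hom C (Dom C f) (Cod C f)" using assms by simp
    fix g h assume g: "g \<in> Hom C A (Dom C f)" and h: "h \<in> Hom C A (Dom C f)" and eq: "f \<cdot> g = f \<cdot> h"
    have "f \<cdot> (g \<cdot> b) = f \<cdot> (h \<cdot> b)"
      using Comp_eq_assoc[OF eq g f b(1)] f h b by simp
    then have "g \<cdot> b = h \<cdot> b" using inj_fromD[OF assms(2) f, of "g \<cdot> b" "h \<cdot> b"] g h b by simp
    then have "(g \<cdot> b) \<cdot> a = (h \<cdot> b) \<cdot> a" by simp
    then show "g = h" using g h a b by simp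
  qed
qed


section \<open>Lifting properties\<close>

lemma liftsD:
  assumes "lifts C f g" "f \<in> Hom C A B" "g \<in> Hom C X Y" "u \<in> Hom C A X" "v \<in> Hom C B Y"
    "g \<cdot> u = v \<cdot> f"
  obtains \<alpha> where "\<alpha> \<in> Hom C B X" "\<alpha> \<cdot> f = u" "g \<cdot> \<alpha> = v"
proof -
  have "Dom C f = A" "Cod C f = B" "Dom C g = X" "Cod C g = Y" using assms(2,3) by auto
  then show ?thesis using that assms(1,4-6) unfolding lifts_def by blast
qed

lemma liftsI:
  assumes f: "f \<in> Hom C A B" and g: "g \<in> Hom C X Y"
    and "\<And>u v. \<lbrakk>u \<in> Hom C A X; v \<in> Hom C B Y; g \<cdot> u = v \<cdot> f\<rbrakk>
      \<Longrightarrow> \<exists>\<alpha> \<in> Hom C B X. \<alpha> \<cdot> f = u \<and> g \<cdot> \<alpha> = v"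
  shows "lifts C f g"
  using assms unfolding lifts_def by auto

lemma binary_coproductD:
  assumes P: "is_binary_coproduct C X Y P i j"
  shows "P \<in> Obj C" "i \<in> Hom C X P" "j \<in> Hom C Y P"
proof -
  have "(if t then i else j) \<in> Hom C (if t then X else Y) P" for t
    using P unfolding is_binary_coproduct_def is_coproduct_def by blast
  from this[of True] this[of False] show "i \<in> Hom C X P" "j \<in> Hom C Y P" by simp_all
  show "P \<in> Obj C" using P unfolding is_binary_coproduct_def is_coproduct_def by blast
qed

lemma binary_coproduct_universal:
  assumes P: "is_binary_coproduct C X Y P i j" and f: "f \<in> Hom C X A" and g: "g \<in> Hom C Y A"
  shows "\<exists>!h. h \<in> Hom C P A \<and> h \<cdot> i = f \<and> h \<cdot> j = g"
proof -
  have A: "A \<in> Obj C" using Hom_Obj[OF f] by blast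
  have "\<exists>!h. h \<in> Hom C P A \<and>
      (\<forall>t \<in> UNIV. h \<cdot> (if t then i else j) = (if t then f else g))"
    using P[unfolded is_binary_coproduct_def is_coproduct_def, THEN conjunct2, THEN conjunct2,
        THEN bspec[OF _ A], THEN spec[of _ "\<lambda>t. if t then f else g"], THEN mp] f g by simp
  moreover have "(\<forall>t \<in> UNIV. h \<cdot> (if t then i else j) = (if t then f else g)) \<longleftrightarrow>
      h \<cdot> i = f \<and> h \<cdot> j = g" for h
    by (auto split: if_splits)
  ultimately show ?thesis by simp
qed

lemma binary_coproduct_swap:
  assumes P: "is_binary_coproduct C X Y P i j" shows "is_binary_coproduct C Y X P j i"
  unfolding is_binary_coproduct_def is_coproduct_def
proof (intro conjI ballI allI impI)
  show "P \<in> Obj C" "(if t then j else i) \<in> Hom C (if t then Y else X) P" for t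
    using binary_coproductD[OF P] by auto
  fix A f assume f: "\<forall>t \<in> UNIV. f t \<in> Hom C (if t then Y else X) A"
  have "f False \<in> Hom C X A" "f True \<in> Hom C Y A"
    using bspec[OF f, of True] bspec[OF f, of False] by simp_all
  from binary_coproduct_universal[OF P this]
  have "\<exists>!h. h \<in> Hom C P A \<and> h \<cdot> i = f False \<and> h \<cdot> j = f True" .
  moreover have "(\<forall>t \<in> UNIV. h \<cdot> (if t then j else i) = f t) \<longleftrightarrow>
      h \<cdot> i = f False \<and> h \<cdot> j = f True" for h
    by (auto split: if_splits)
  ultimately show "\<exists>!h. h \<in> Hom C P A \<and> (\<forall>t \<in> UNIV. h \<cdot> (if t then j else i) = f t)" by simp
qed

text \<open>
  The universal property of a coproduct turns a lifting problem for an inclusion \<open>X \<rightarrow> X \<amalg> Y\<close> into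
  a factorisation problem for a map out of \<open>Y\<close>.
\<close>

lemma coproduct_inclusion_lifts:
  assumes P: "is_binary_coproduct C X Y P i j" and f: "f \<in> Hom C E B" and surj: "surj_from Y f"
  shows "lifts C i f"
proof (rule liftsI[OF binary_coproductD(2)[OF P] f])
  note d = binary_coproductD[OF P]
  fix u v assume u: "u \<in> Hom C X E" and v: "v \<in> Hom C P B" and sq: "f \<cdot> u = v \<cdot> i"
  obtain \<beta> where \<beta>: "\<beta> \<in> Hom C Y E" "f \<cdot> \<beta> = v \<cdot> j"
    using surj_fromE[OF surj f Comp_in_Hom[OF d(3) v]] .
  obtain \<alpha> where \<alpha>: "\<alpha> \<in> Hom C P E" "\<alpha> \<cdot> i = u" "\<alpha> \<cdot> j = \<beta>"
    using binary_coproduct_universal[OF P u \<beta>(1)] by blast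
  have "(f \<cdot> \<alpha>) \<cdot> i = v \<cdot> i" "(f \<cdot> \<alpha>) \<cdot> j = v \<cdot> j" using \<alpha> \<beta> sq f d by simp_all
  then have "f \<cdot> \<alpha> = v"
    using binary_coproduct_universal[OF P Comp_in_Hom[OF d(2) v] Comp_in_Hom[OF d(3) v]]
      v Comp_in_Hom[OF \<alpha>(1) f] by blast
  then show "\<exists>\<alpha> \<in> Hom C P E. \<alpha> \<cdot> i = u \<and> f \<cdot> \<alpha> = v" using \<alpha> by blast
qed

lemma stable_class_llp: "stable_class C (llp C A)" if A: "A \<subseteq> Arr C"
  unfolding stable_class_def
proof (intro conjI ballI allI impI)
  show "llp C A \<subseteq> Arr C" by (auto simp: llp_def)
next
  fix X assume "X \<in> Obj C"
  then show "Id C X \<in> llp C A" using A by (auto simp: llp_def lifts_def)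
next
  fix f g assume f: "f \<in> llp C A" and g: "g \<in> llp C A" and fg: "Cod C f = Dom C g"
  have fA: "f \<in> Arr C" and gA: "g \<in> Arr C" using f g by (auto simp: llp_def)
  have "lifts C (g \<cdot> f) a" if a: "a \<in> A" for a
  proof (rule liftsI)
    have aA: "a \<in> Arr C" using a A by auto
    fix u v assume u: "u \<in> Hom C (Dom C f) (Dom C a)" and v: "v \<in> Hom C (Cod C g) (Cod C a)"
      and sq: "a \<cdot> u = v \<cdot> (g \<cdot> f)"
    have "a \<cdot> u = (v \<cdot> g) \<cdot> f" using sq u v fA gA fg by simp
    then obtain \<beta> where \<beta>: "\<beta> \<in> Hom C (Dom C g) (Dom C a)" "\<beta> \<cdot> f = u" "a \<cdot> \<beta> = v \<cdot> g"
      using liftsD[of f a "Dom C f" "Dom C g" "Dom C a" "Cod C a" u "v \<cdot> g"] f a u v fA gA aA fg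
      by (auto simp: llp_def)
    then obtain \<alpha> where \<alpha>: "\<alpha> \<in> Hom C (Cod C g) (Dom C a)" "\<alpha> \<cdot> g = \<beta>" "a \<cdot> \<alpha> = v"
      using liftsD[of g a "Dom C g" "Cod C g" "Dom C a" "Cod C a" \<beta> v] g a v gA aA
      by (auto simp: llp_def)
    have "\<alpha> \<cdot> (g \<cdot> f) = u" using Comp_eq_assoc[of \<alpha> g \<beta>] \<alpha> \<beta> gA fA fg by simp
    then show "\<exists>\<alpha> \<in> Hom C (Cod C g) (Dom C a). \<alpha> \<cdot> (g \<cdot> f) = u \<and> a \<cdot> \<alpha> = v" using \<alpha> by blast
  qed (use fA gA fg a A in auto)
  then show "g \<cdot> f \<in> llp C A" using fA gA fg by (simp add: llp_def)
next
  fix f g assume "is_retract C f g \<and> g \<in> llp C A"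
  then obtain i r i' r' where fA: "f \<in> Arr C" and gA: "g \<in> Arr C" and g: "g \<in> llp C A"
    and i: "i \<in> Hom C (Dom C f) (Dom C g)" and r: "r \<in> Hom C (Dom C g) (Dom C f)"
    and i': "i' \<in> Hom C (Cod C f) (Cod C g)" and r': "r' \<in> Hom C (Cod C g) (Cod C f)"
    and ri: "r \<cdot> i = Id C (Dom C f)" and ri': "r' \<cdot> i' = Id C (Cod C f)"
    and gi: "g \<cdot> i = i' \<cdot> f" and fr: "f \<cdot> r = r' \<cdot> g"
    unfolding is_retract_def by blast
  have "lifts C f a" if a: "a \<in> A" for a
  proof (rule liftsI)
    have aA: "a \<in> Arr C" using a A by auto
    fix u v assume u: "u \<in> Hom C (Dom C f) (Dom C a)" and v: "v \<in> Hom C (Cod C f) (Cod C a)"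
      and sq: "a \<cdot> u = v \<cdot> f"
    have "a \<cdot> (u \<cdot> r) = (v \<cdot> r') \<cdot> g"
      using Comp_eq_assoc[OF sq, of "Dom C f" "Dom C a" "Cod C a" r "Dom C g"] fr u v r r' fA gA aA by simp
    then obtain \<beta> where \<beta>: "\<beta> \<in> Hom C (Cod C g) (Dom C a)" "\<beta> \<cdot> g = u \<cdot> r" "a \<cdot> \<beta> = v \<cdot> r'"
      using liftsD[of g a "Dom C g" "Cod C g" "Dom C a" "Cod C a" "u \<cdot> r" "v \<cdot> r'"] g a u v r r' gA aA
      by (auto simp: llp_def)
    have "(\<beta> \<cdot> i') \<cdot> f = (\<beta> \<cdot> g) \<cdot> i" using gi \<beta>(1) i i' fA gA by simp
    also have "\<dots> = u" using \<beta> i r u ri by simp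
    finally have 1: "(\<beta> \<cdot> i') \<cdot> f = u" .
    have "a \<cdot> (\<beta> \<cdot> i') = v"
      using Comp_eq_assoc[OF \<beta>(3), of "Cod C g" "Dom C a" "Cod C a" i' "Cod C f"] \<beta>(1) i' r' v ri' aA by simp
    then show "\<exists>\<alpha> \<in> Hom C (Cod C f) (Dom C a). \<alpha> \<cdot> f = u \<and> a \<cdot> \<alpha> = v"
      using 1 \<beta>(1) i' by (intro bexI[of _ "\<beta> \<cdot> i'"]) auto
  qed (use fA a A in auto)
  then show "f \<in> llp C A" using fA by (simp add: llp_def)
qed

end


section \<open>Biproducts in additive categories\<close>

context additive_category
begin

lemma Arr_Zero [simp]: "\<lbrakk>X \<in> Obj C; Y \<in> Obj C\<rbrakk> \<Longrightarrow> Zero C X Y \<in> Arr C"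
  and Dom_Zero [simp]: "\<lbrakk>X \<in> Obj C; Y \<in> Obj C\<rbrakk> \<Longrightarrow> Dom C (Zero C X Y) = X"
  and Cod_Zero [simp]: "\<lbrakk>X \<in> Obj C; Y \<in> Obj C\<rbrakk> \<Longrightarrow> Cod C (Zero C X Y) = Y"
proof -
  assume "X \<in> Obj C" "Y \<in> Obj C"
  then interpret G: comm_group "Hom_group C X Y" by (rule Hom_comm_group)
  have "Zero C X Y \<in> Hom C X Y" using G.one_closed by (simp add: Hom_group_def)
  then show "Zero C X Y \<in> Arr C" "Dom C (Zero C X Y) = X" "Cod C (Zero C X Y) = Y" by auto
qed

lemma Add_in_Hom: "\<lbrakk>f \<in> Hom C X Y; g \<in> Hom C X Y\<rbrakk> \<Longrightarrow> f \<oplus> g \<in> Hom C X Y"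
proof -
  assume fg: "f \<in> Hom C X Y" "g \<in> Hom C X Y"
  interpret G: comm_group "Hom_group C X Y" using Hom_comm_group Hom_Obj[OF fg(1)] by blast
  show ?thesis using G.m_closed[of f g] fg by (simp add: Hom_group_def)
qed

lemma Add_commute:
  assumes "f \<in> Hom C X Y" "g \<in> Hom C X Y" shows "f \<oplus> g = g \<oplus> f"
proof -
  interpret G: comm_group "Hom_group C X Y" using Hom_comm_group Hom_Obj[OF assms(1)] by blast
  show ?thesis using G.m_comm[of f g] assms by (simp add: Hom_group_def)
qed

lemma Add_right_cancel:
  assumes "f \<in> Hom C X Y" "g \<in> Hom C X Y" "h \<in> Hom C X Y" "f \<oplus> h = g \<oplus> h"
  shows "f = g"
proof -
  interpret G: comm_group "Hom_group C X Y" using Hom_comm_group Hom_Obj[OF assms(1)] by blast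
  show ?thesis using G.right_cancel[of h f g] assms by (simp add: Hom_group_def)
qed

lemma Add_Zero_left [simp]:
  assumes "f \<in> Arr C" "Dom C f = X" "Cod C f = Y" shows "Zero C X Y \<oplus> f = f"
proof -
  interpret G: comm_group "Hom_group C X Y" using Hom_comm_group Hom_Obj[of f X Y] assms by auto
  show ?thesis using G.l_one[of f] assms by (simp add: Hom_group_def)
qed

lemma Add_Zero_right [simp]:
  assumes "f \<in> Arr C" "Dom C f = X" "Cod C f = Y" shows "f \<oplus> Zero C X Y = f"
proof -
  interpret G: comm_group "Hom_group C X Y" using Hom_comm_group Hom_Obj[of f X Y] assms by auto
  show ?thesis using G.r_one[of f] assms by (simp add: Hom_group_def)
qed

lemma Neg_in_Hom: "f \<in> Hom C X Y \<Longrightarrow> Neg C f \<in> Hom C X Y"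
proof -
  assume f: "f \<in> Hom C X Y"
  interpret G: comm_group "Hom_group C X Y" using Hom_comm_group Hom_Obj[OF f] by blast
  show ?thesis using G.inv_closed[of f] f by (auto simp: Hom_group_def Neg_def)
qed

lemma Neg_Add:
  assumes f: "f \<in> Hom C X Y" shows "Neg C f \<oplus> f = Zero C X Y"
proof -
  interpret G: comm_group "Hom_group C X Y" using Hom_comm_group Hom_Obj[OF f] by blast
  show ?thesis using G.l_inv[of f] f by (auto simp: Hom_group_def Neg_def)
qed

lemma Neg_Neg:
  assumes f: "f \<in> Hom C X Y" shows "Neg C (Neg C f) = f"
proof (rule Add_right_cancel)
  show "Neg C (Neg C f) \<oplus> Neg C f = f \<oplus> Neg C f"
    using Neg_Add[OF Neg_in_Hom[OF f]] Neg_Add[OF f] Add_commute[OF Neg_in_Hom[OF f] f] by simp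
qed (use f Neg_in_Hom in blast)+

lemma Add_idem:
  assumes f: "f \<in> Hom C X Y" and "f \<oplus> f = f" shows "f = Zero C X Y"
proof (rule Add_right_cancel)
  show "f \<oplus> f = Zero C X Y \<oplus> f" using assms by simp
qed (use f Hom_Obj[OF f] in auto)

lemma Comp_Zero [simp]:
  assumes "f \<in> Arr C" "Dom C f = X" "A \<in> Obj C" shows "f \<cdot> Zero C A X = Zero C A (Cod C f)"
proof (rule Add_idem)
  have X: "X \<in> Obj C" using assms Dom_in_Obj by auto
  then have "Zero C A X \<oplus> Zero C A X = Zero C A X" using assms by simp
  then show "f \<cdot> Zero C A X \<oplus> f \<cdot> Zero C A X = f \<cdot> Zero C A X"
    using Comp_Add_right[of "Zero C A X" A X "Zero C A X" f "Cod C f"] assms X by simp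
qed (use assms Dom_in_Obj in auto)

lemma Zero_Comp [simp]:
  assumes "f \<in> Arr C" "Cod C f = X" "A \<in> Obj C" shows "Zero C X A \<cdot> f = Zero C (Dom C f) A"
proof (rule Add_idem)
  have X: "X \<in> Obj C" using assms Cod_in_Obj by auto
  then have "Zero C X A \<oplus> Zero C X A = Zero C X A" using assms by simp
  then show "Zero C X A \<cdot> f \<oplus> Zero C X A \<cdot> f = Zero C X A \<cdot> f"
    using Comp_Add_left[of f "Dom C f" X "Zero C X A" A "Zero C X A"] assms X by simp
qed (use assms Cod_in_Obj in auto)

definition diff :: "'m \<Rightarrow> 'm \<Rightarrow> 'm" (infixl "\<ominus>" 65) where
  "f \<ominus> g = f \<oplus> Neg C g"

lemma diff_in_Hom: "\<lbrakk>f \<in> Hom C X Y; g \<in> Hom C X Y\<rbrakk> \<Longrightarrow> f \<ominus> g \<in> Hom C X Y"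
  unfolding diff_def using Add_in_Hom Neg_in_Hom by blast

lemma diff_Add:
  assumes f: "f \<in> Hom C X Y" and g: "g \<in> Hom C X Y" shows "(f \<ominus> g) \<oplus> g = f"
proof -
  interpret G: comm_group "Hom_group C X Y" using Hom_comm_group Hom_Obj[OF f] by blast
  have "(f \<oplus> Neg C g) \<oplus> g = f \<oplus> (Neg C g \<oplus> g)"
    using G.m_assoc[of f "Neg C g" g] f g Neg_in_Hom[OF g] by (simp add: Hom_group_def)
  then show ?thesis using Neg_Add[OF g] f by (simp add: diff_def)
qed

lemma diff_unique:
  assumes "f \<in> Hom C X Y" "g \<in> Hom C X Y" "d \<in> Hom C X Y" "d \<oplus> g = f" shows "d = f \<ominus> g"
  using Add_right_cancel[of d X Y "f \<ominus> g" g] assms diff_in_Hom diff_Add by simp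

lemma diff_eq_Zero_iff:
  assumes f: "f \<in> Hom C X Y" and g: "g \<in> Hom C X Y" shows "f \<ominus> g = Zero C X Y \<longleftrightarrow> f = g"
proof
  assume "f \<ominus> g = Zero C X Y" then show "f = g" using diff_Add[OF f g] g by simp
next
  assume "f = g" then show "f \<ominus> g = Zero C X Y"
    using diff_unique[OF f g, of "Zero C X Y"] g Hom_Obj[OF g] by simp
qed

lemma Comp_diff:
  assumes f: "f \<in> Hom C X Y" and g: "g \<in> Hom C X Y" and h: "h \<in> Hom C Y Z"
  shows "h \<cdot> (f \<ominus> g) = h \<cdot> f \<ominus> h \<cdot> g"
proof (rule diff_unique[of _ X Z])
  show "h \<cdot> (f \<ominus> g) \<oplus> h \<cdot> g = h \<cdot> f"
    using Comp_Add_right[OF diff_in_Hom[OF f g] g h] diff_Add[OF f g] by simp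
  show "h \<cdot> (f \<ominus> g) \<in> Hom C X Z" by (rule Comp_in_Hom[OF diff_in_Hom[OF f g] h])
qed (use f g h in auto)

lemma diff_Comp:
  assumes f: "f \<in> Hom C Y Z" and g: "g \<in> Hom C Y Z" and h: "h \<in> Hom C X Y"
  shows "(f \<ominus> g) \<cdot> h = f \<cdot> h \<ominus> g \<cdot> h"
proof (rule diff_unique[of _ X Z])
  show "(f \<ominus> g) \<cdot> h \<oplus> g \<cdot> h = f \<cdot> h"
    using Comp_Add_left[OF h diff_in_Hom[OF f g] g] diff_Add[OF f g] by simp
  show "(f \<ominus> g) \<cdot> h \<in> Hom C X Z" by (rule Comp_in_Hom[OF h diff_in_Hom[OF f g]])
qed (use f g h in auto)

lemma diff_diff_cancel:
  assumes f: "f \<in> Hom C X Y" and g: "g \<in> Hom C X Y" shows "f \<ominus> (f \<ominus> g) = g"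
  by (rule diff_unique[symmetric, OF f diff_in_Hom[OF f g] g])
    (use Add_commute[OF g diff_in_Hom[OF f g]] diff_Add[OF f g] in simp)

lemma diff_Zero:
  assumes f: "f \<in> Hom C X Y" shows "f \<ominus> Zero C X Y = f"
  by (rule diff_unique[symmetric, OF f _ f]) (use f Hom_Obj[OF f] in auto)

lemma inj_from_iff_kernel:
  assumes f: "f \<in> Hom C X Y"
  shows "inj_from A f \<longleftrightarrow> (\<forall>g \<in> Hom C A X. f \<cdot> g = Zero C A Y \<longrightarrow> g = Zero C A X)"
proof
  assume inj: "inj_from A f"
  show "\<forall>g \<in> Hom C A X. f \<cdot> g = Zero C A Y \<longrightarrow> g = Zero C A X"
  proof (intro ballI impI)
    fix g assume g: "g \<in> Hom C A X" "f \<cdot> g = Zero C A Y"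
    show "g = Zero C A X"
      by (rule inj_fromD[OF inj f g(1)]) (use f g Hom_Obj[OF g(1)] in auto)
  qed
next
  assume ker: "\<forall>g \<in> Hom C A X. f \<cdot> g = Zero C A Y \<longrightarrow> g = Zero C A X"
  show "inj_from A f"
  proof (rule inj_fromI[OF f])
    fix g h assume g: "g \<in> Hom C A X" and h: "h \<in> Hom C A X" and eq: "f \<cdot> g = f \<cdot> h"
    have "f \<cdot> (g \<ominus> h) = Zero C A Y"
      unfolding Comp_diff[OF g h f]
      by (subst diff_eq_Zero_iff[OF Comp_in_Hom[OF g f] Comp_in_Hom[OF h f]]) (rule eq)
    then have "g \<ominus> h = Zero C A X" using ker diff_in_Hom[OF g h] by blast
    then show "g = h" using diff_eq_Zero_iff[OF g h] by simp
  qed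
qed

lemma zero_object_Hom_to:
  assumes "is_zero_object C Z" "f \<in> Hom C X Z" shows "f = Zero C X Z"
  using assms Hom_Obj[OF assms(2)] unfolding is_zero_object_def is_final_def
  by (metis Arr_Zero Cod_Zero Dom_Zero Hom_iff)

lemma zero_object_Hom_from:
  assumes "is_zero_object C Z" "f \<in> Hom C Z X" shows "f = Zero C Z X"
  using assms Hom_Obj[OF assms(2)] unfolding is_zero_object_def is_initial_def
  by (metis Arr_Zero Cod_Zero Dom_Zero Hom_iff)

lemma zero_objectI:
  assumes Z: "Z \<in> Obj C" and "Id C Z = Zero C Z Z" shows "is_zero_object C Z"
proof -
  have from_Z: "f = Zero C Z Y" if "f \<in> Hom C Z Y" for f Y
    using Comp_Id[OF that] that assms by auto
  have to_Z: "f = Zero C Y Z" if "f \<in> Hom C Y Z" for f Y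
    using Id_Comp[OF that] that assms by auto
  show ?thesis unfolding is_zero_object_def is_initial_def is_final_def
    using from_Z to_Z Z Arr_Zero Dom_Zero Cod_Zero by (metis Hom_iff)
qed

lemma biproductD:
  assumes "is_biproduct C X Y P i j p q"
  shows "X \<in> Obj C" "Y \<in> Obj C" "P \<in> Obj C"
    "i \<in> Hom C X P" "j \<in> Hom C Y P" "p \<in> Hom C P X" "q \<in> Hom C P Y"
    "p \<cdot> i = Id C X" "q \<cdot> j = Id C Y" "p \<cdot> j = Zero C Y X" "q \<cdot> i = Zero C X Y"
    "(i \<cdot> p) \<oplus> (j \<cdot> q) = Id C P"
  using assms unfolding is_biproduct_def by blast+

lemma biproduct_pair:
  assumes B: "is_biproduct C X Y P i j p q" and f: "f \<in> Hom C A X" and g: "g \<in> Hom C A Y"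
  obtains h where "h \<in> Hom C A P" "p \<cdot> h = f" "q \<cdot> h = g"
proof
  note b = biproductD[OF B]
  have A: "A \<in> Obj C" using Hom_Obj f by blast
  have if_in: "i \<cdot> f \<in> Hom C A P" and jg_in: "j \<cdot> g \<in> Hom C A P" using b f g by auto
  show "(i \<cdot> f) \<oplus> (j \<cdot> g) \<in> Hom C A P" by (rule Add_in_Hom[OF if_in jg_in])
  have "p \<cdot> (i \<cdot> f) = f" "p \<cdot> (j \<cdot> g) = Zero C A X" "q \<cdot> (i \<cdot> f) = Zero C A Y" "q \<cdot> (j \<cdot> g) = g"
    using Comp_eq_assoc[OF b(8) b(4) b(6) f] Comp_eq_assoc[OF b(10) b(5) b(6) g]
      Comp_eq_assoc[OF b(11) b(4) b(7) f] Comp_eq_assoc[OF b(9) b(5) b(7) g] f g b(1,2) by simp_all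
  then show "p \<cdot> ((i \<cdot> f) \<oplus> (j \<cdot> g)) = f" "q \<cdot> ((i \<cdot> f) \<oplus> (j \<cdot> g)) = g"
    using Comp_Add_right[OF if_in jg_in b(6)] Comp_Add_right[OF if_in jg_in b(7)] f g by simp_all
qed

lemma biproduct_copair:
  assumes B: "is_biproduct C X Y P i j p q" and f: "f \<in> Hom C X A" and g: "g \<in> Hom C Y A"
  obtains h where "h \<in> Hom C P A" "h \<cdot> i = f" "h \<cdot> j = g" "h = (f \<cdot> p) \<oplus> (g \<cdot> q)"
proof
  note b = biproductD[OF B]
  have A: "A \<in> Obj C" using Hom_Obj f by blast
  have fp_in: "f \<cdot> p \<in> Hom C P A" and gq_in: "g \<cdot> q \<in> Hom C P A" using b f g by auto
  show "(f \<cdot> p) \<oplus> (g \<cdot> q) \<in> Hom C P A" by (rule Add_in_Hom[OF fp_in gq_in])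
  have "(f \<cdot> p) \<cdot> i = f" "(f \<cdot> p) \<cdot> j = Zero C Y A" "(g \<cdot> q) \<cdot> i = Zero C X A" "(g \<cdot> q) \<cdot> j = g"
    using b f g A by auto
  then show "((f \<cdot> p) \<oplus> (g \<cdot> q)) \<cdot> i = f" "((f \<cdot> p) \<oplus> (g \<cdot> q)) \<cdot> j = g"
    using Comp_Add_left[OF b(4) fp_in gq_in] Comp_Add_left[OF b(5) fp_in gq_in] f g by simp_all
qed auto

lemma biproduct_to_eqI:
  assumes B: "is_biproduct C X Y P i j p q" and h: "h \<in> Hom C A P" "h' \<in> Hom C A P"
    and eq: "p \<cdot> h = p \<cdot> h'" "q \<cdot> h = q \<cdot> h'"
  shows "h = h'"
proof -
  note b = biproductD[OF B]
  have "k = (i \<cdot> (p \<cdot> k)) \<oplus> (j \<cdot> (q \<cdot> k))" if k: "k \<in> Hom C A P" for k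
    using Comp_Add_left[OF k, of "i \<cdot> p" P "j \<cdot> q"] b k by simp
  from this[OF h(1)] this[OF h(2)] show ?thesis using eq by simp
qed

lemma biproduct_from_eqI:
  assumes B: "is_biproduct C X Y P i j p q" and h: "h \<in> Hom C P A" "h' \<in> Hom C P A"
    and eq: "h \<cdot> i = h' \<cdot> i" "h \<cdot> j = h' \<cdot> j"
  shows "h = h'"
proof -
  note b = biproductD[OF B]
  have "k = ((k \<cdot> i) \<cdot> p) \<oplus> ((k \<cdot> j) \<cdot> q)" if k: "k \<in> Hom C P A" for k
    using Comp_Add_right[of "i \<cdot> p" P P "j \<cdot> q" k A] b k by simp
  from this[OF h(1)] this[OF h(2)] show ?thesis using eq by simp
qed

lemma biproduct_is_product: "is_biproduct C X Y P i j p q \<Longrightarrow> is_binary_product C X Y P p q"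
  unfolding is_binary_product_def is_product_def
proof (intro conjI ballI allI impI)
  assume B: "is_biproduct C X Y P i j p q"
  note b = biproductD[OF B]
  show "P \<in> Obj C" by (rule b)
  show "(if t then p else q) \<in> Hom C P (if t then X else Y)" for t using b by auto
  fix A f assume f: "\<forall>t \<in> UNIV. f t \<in> Hom C A (if t then X else Y)"
  then have "f True \<in> Hom C A X" "f False \<in> Hom C A Y" using bspec[OF f, of True] bspec[OF f, of False]
    by auto
  then obtain h where h: "h \<in> Hom C A P" "p \<cdot> h = f True" "q \<cdot> h = f False"
    using biproduct_pair[OF B] by blast
  show "\<exists>!h. h \<in> Hom C A P \<and> (\<forall>t \<in> UNIV. (if t then p else q) \<cdot> h = f t)"
  proof (rule ex1I[of _ h])
    show "h \<in> Hom C A P \<and> (\<forall>t \<in> UNIV. (if t then p else q) \<cdot> h = f t)"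
      using h by auto
    fix h' assume h': "h' \<in> Hom C A P \<and> (\<forall>t \<in> UNIV. (if t then p else q) \<cdot> h' = f t)"
    then have "p \<cdot> h' = f True" "q \<cdot> h' = f False" by (metis UNIV_I)+
    then show "h' = h" using biproduct_to_eqI[OF B, of h' A h] h h' by auto
  qed
qed

lemma biproduct_is_coproduct: "is_biproduct C X Y P i j p q \<Longrightarrow> is_binary_coproduct C X Y P i j"
  unfolding is_binary_coproduct_def is_coproduct_def
proof (intro conjI ballI allI impI)
  assume B: "is_biproduct C X Y P i j p q"
  note b = biproductD[OF B]
  show "P \<in> Obj C" by (rule b)
  show "(if t then i else j) \<in> Hom C (if t then X else Y) P" for t using b by auto
  fix A f assume f: "\<forall>t \<in> UNIV. f t \<in> Hom C (if t then X else Y) A"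
  then have "f True \<in> Hom C X A" "f False \<in> Hom C Y A" using bspec[OF f, of True] bspec[OF f, of False]
    by auto
  then obtain h where h: "h \<in> Hom C P A" "h \<cdot> i = f True" "h \<cdot> j = f False"
    using biproduct_copair[OF B] by blast
  show "\<exists>!h. h \<in> Hom C P A \<and> (\<forall>t \<in> UNIV. h \<cdot> (if t then i else j) = f t)"
  proof (rule ex1I[of _ h])
    show "h \<in> Hom C P A \<and> (\<forall>t \<in> UNIV. h \<cdot> (if t then i else j) = f t)"
      using h by auto
    fix h' assume h': "h' \<in> Hom C P A \<and> (\<forall>t \<in> UNIV. h' \<cdot> (if t then i else j) = f t)"
    then have "h' \<cdot> i = f True" "h' \<cdot> j = f False" by (metis UNIV_I)+
    then show "h' = h" using biproduct_from_eqI[OF B, of h' A h] h h' by auto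
  qed
qed

lemma finite_products_exist: "has_finite_products C"
  unfolding has_finite_products_def
proof (intro allI impI)
  fix n :: nat and X :: "nat \<Rightarrow> 'o"
  assume "\<forall>k<n. X k \<in> Obj C"
  then show "\<exists>P p. is_product C {..<n} X P p"
  proof (induction n)
    case 0
    obtain Z where "is_zero_object C Z" using zero_object_exists by blast
    then have "is_product C {..<0::nat} X Z p" for p
      unfolding is_zero_object_def is_final_def is_product_def by simp
    then show ?case by blast
  next
    case (Suc n)
    then obtain P p where P: "is_product C {..<n} X P p" by auto
    have "P \<in> Obj C" using P unfolding is_product_def by blast
    then obtain R i j a b where B: "is_biproduct C P (X n) R i j a b"
      using biproduct_exists Suc.prems by blast
    note bs = biproductD[OF B]
    define r where "r k = (if k < n then p k \<cdot> a else b)" for k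
    have p: "p k \<in> Hom C P (X k)" if "k < n" for k using P that unfolding is_product_def by blast
    have r: "r k \<in> Hom C R (X k)" if "k < Suc n" for k
      using p[of k] bs that unfolding r_def by (cases "k < n") (auto simp: less_Suc_eq)
    have r_less: "r k \<cdot> h = p k \<cdot> (a \<cdot> h)" if "k < n" "h \<in> Hom C A R" for k h A
      using p[OF that(1)] bs(6) that unfolding r_def by simp
    have "is_product C {..<Suc n} X R r"
      unfolding is_product_def
    proof (intro conjI ballI allI impI)
      show "R \<in> Obj C" by (rule bs)
      show "\<And>k. k \<in> {..<Suc n} \<Longrightarrow> r k \<in> Hom C R (X k)" using r by blast
      fix A f assume A: "A \<in> Obj C" and f: "\<forall>k \<in> {..<Suc n}. f k \<in> Hom C A (X k)"
      have ex1: "\<exists>!h. h \<in> Hom C A P \<and> (\<forall>k \<in> {..<n}. p k \<cdot> h = f k)"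
        using P[unfolded is_product_def, THEN conjunct2, THEN conjunct2, THEN bspec[OF _ A],
            THEN spec[of _ f], THEN mp] f by (simp del: Hom_iff)
      then obtain g where g: "g \<in> Hom C A P" "\<And>k. k < n \<Longrightarrow> p k \<cdot> g = f k" by (metis lessThan_iff)
      obtain h where h: "h \<in> Hom C A R" "a \<cdot> h = g" "b \<cdot> h = f n"
        using biproduct_pair[OF B g(1), of "f n"] bspec[OF f, of n] by blast
      show "\<exists>!h. h \<in> Hom C A R \<and> (\<forall>k \<in> {..<Suc n}. r k \<cdot> h = f k)"
      proof (rule ex1I[of _ h])
        show "h \<in> Hom C A R \<and> (\<forall>k \<in> {..<Suc n}. r k \<cdot> h = f k)"
        proof (intro conjI ballI)
          fix k assume "k \<in> {..<Suc n}"
          then consider "k < n" | "k = n" by (auto simp: less_Suc_eq)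
          then show "r k \<cdot> h = f k"
          proof cases
            case 1 then show ?thesis using r_less[OF 1 h(1)] h g(2) by simp
          next
            case 2 then show ?thesis using h by (simp add: r_def)
          qed
        qed (rule h)
        fix h' assume h': "h' \<in> Hom C A R \<and> (\<forall>k \<in> {..<Suc n}. r k \<cdot> h' = f k)"
        have "p k \<cdot> (a \<cdot> h') = f k" if "k < n" for k
          using r_less[OF that, of h' A] h' that by auto
        moreover have "a \<cdot> h' \<in> Hom C A P" using h' bs(6) by auto
        ultimately have "a \<cdot> h' = g" using ex1 g by (metis lessThan_iff)
        moreover have "b \<cdot> h' = f n" using bspec[of _ _ n, OF conjunct2[OF h']] by (simp add: r_def)
        ultimately show "h' = h" using biproduct_to_eqI[OF B, of h' A h] h h' by auto
      qed
    qed
    then show ?case by blast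
  qed
qed

lemma finite_coproducts_exist: "has_finite_coproducts C"
  unfolding has_finite_coproducts_def
proof (intro allI impI)
  fix n :: nat and X :: "nat \<Rightarrow> 'o"
  assume "\<forall>k<n. X k \<in> Obj C"
  then show "\<exists>P e. is_coproduct C {..<n} X P e"
  proof (induction n)
    case 0
    obtain Z where "is_zero_object C Z" using zero_object_exists by blast
    then have "is_coproduct C {..<0::nat} X Z e" for e
      unfolding is_zero_object_def is_initial_def is_coproduct_def by simp
    then show ?case by blast
  next
    case (Suc n)
    then obtain P e where P: "is_coproduct C {..<n} X P e" by auto
    have "P \<in> Obj C" using P unfolding is_coproduct_def by blast
    then obtain R i j a b where B: "is_biproduct C P (X n) R i j a b"
      using biproduct_exists Suc.prems by blast
    note bs = biproductD[OF B]
    define r where "r k = (if k < n then i \<cdot> e k else j)" for k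
    have e: "e k \<in> Hom C (X k) P" if "k < n" for k using P that unfolding is_coproduct_def by blast
    have r: "r k \<in> Hom C (X k) R" if "k < Suc n" for k
      using e[of k] bs that unfolding r_def by (cases "k < n") (auto simp: less_Suc_eq)
    have r_less: "h \<cdot> r k = (h \<cdot> i) \<cdot> e k" if "k < n" "h \<in> Hom C R A" for k h A
      using e[OF that(1)] bs(4) that unfolding r_def by simp
    have "is_coproduct C {..<Suc n} X R r"
      unfolding is_coproduct_def
    proof (intro conjI ballI allI impI)
      show "R \<in> Obj C" by (rule bs)
      show "\<And>k. k \<in> {..<Suc n} \<Longrightarrow> r k \<in> Hom C (X k) R" using r by blast
      fix A f assume A: "A \<in> Obj C" and f: "\<forall>k \<in> {..<Suc n}. f k \<in> Hom C (X k) A"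
      have ex1: "\<exists>!h. h \<in> Hom C P A \<and> (\<forall>k \<in> {..<n}. h \<cdot> e k = f k)"
        using P[unfolded is_coproduct_def, THEN conjunct2, THEN conjunct2, THEN bspec[OF _ A],
            THEN spec[of _ f], THEN mp] f by (simp del: Hom_iff)
      then obtain g where g: "g \<in> Hom C P A" "\<And>k. k < n \<Longrightarrow> g \<cdot> e k = f k" by (metis lessThan_iff)
      obtain h where h: "h \<in> Hom C R A" "h \<cdot> i = g" "h \<cdot> j = f n"
        using biproduct_copair[OF B g(1), of "f n"] bspec[OF f, of n] by blast
      show "\<exists>!h. h \<in> Hom C R A \<and> (\<forall>k \<in> {..<Suc n}. h \<cdot> r k = f k)"
      proof (rule ex1I[of _ h])
        show "h \<in> Hom C R A \<and> (\<forall>k \<in> {..<Suc n}. h \<cdot> r k = f k)"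
        proof (intro conjI ballI)
          fix k assume "k \<in> {..<Suc n}"
          then consider "k < n" | "k = n" by (auto simp: less_Suc_eq)
          then show "h \<cdot> r k = f k"
          proof cases
            case 1 then show ?thesis using r_less[OF 1 h(1)] h(2) g(2) by simp
          next
            case 2 then show ?thesis using h by (simp add: r_def)
          qed
        qed (rule h)
        fix h' assume h': "h' \<in> Hom C R A \<and> (\<forall>k \<in> {..<Suc n}. h' \<cdot> r k = f k)"
        have "(h' \<cdot> i) \<cdot> e k = f k" if "k < n" for k
          using r_less[OF that, of h' A] h' that by (metis lessThan_iff less_Suc_eq)
        moreover have "h' \<cdot> i \<in> Hom C P A" using h' bs(4) by auto
        ultimately have "h' \<cdot> i = g" using ex1 g by (metis lessThan_iff)
        moreover have "h' \<cdot> j = f n" using bspec[of _ _ n, OF conjunct2[OF h']] by (simp add: r_def)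
        ultimately show "h' = h" using biproduct_from_eqI[OF B, of h' A h] h h' by auto
      qed
    qed
    then show ?case by blast
  qed
qed

end


section \<open>Exactness in triangulated categories\<close>

context triangulated_category
begin

definition triangle :: "'o \<Rightarrow> 'o \<Rightarrow> 'o \<Rightarrow> 'm \<Rightarrow> 'm \<Rightarrow> 'm \<Rightarrow> bool" where
  "triangle X Y Z u v w \<longleftrightarrow> (u, v, w) \<in> Tri C \<and>
     u \<in> Hom C X Y \<and> v \<in> Hom C Y Z \<and> w \<in> Hom C Z (SuspO C X)"

lemma triangleD:
  assumes "triangle X Y Z u v w"
  shows "(u, v, w) \<in> Tri C" "u \<in> Hom C X Y" "v \<in> Hom C Y Z" "w \<in> Hom C Z (SuspO C X)"
    "X \<in> Obj C" "Y \<in> Obj C" "Z \<in> Obj C" "SuspO C X \<in> Obj C" "SuspO C Y \<in> Obj C"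
  using assms Hom_Obj[of u X Y] Hom_Obj[of v Y Z] SuspO_in_Obj unfolding triangle_def by blast+

lemma Tri_triangle:
  assumes "(u, v, w) \<in> Tri C"
  shows "triangle (Dom C u) (Cod C u) (Cod C v) u v w"
  using Tri_form[OF assms] assms unfolding triangle_def by auto

lemma Susp_Zero:
  assumes "X \<in> Obj C" "Y \<in> Obj C"
  shows "Susp C (Zero C X Y) = Zero C (SuspO C X) (SuspO C Y)"
proof (rule Add_idem)
  have Z: "Zero C X Y \<in> Hom C X Y" using assms by simp
  show "Susp C (Zero C X Y) \<in> Hom C (SuspO C X) (SuspO C Y)" by (rule Susp_in_Hom[OF Z])
  show "Susp C (Zero C X Y) \<oplus> Susp C (Zero C X Y) = Susp C (Zero C X Y)"
    using Susp_Add[OF Z Z] assms by simp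
qed

lemma Susp_faithful:
  assumes f: "f \<in> Hom C X Y" and g: "g \<in> Hom C X Y" and "Susp C f = Susp C g"
  shows "f = g"
  using inj_onD[OF bij_betw_imp_inj_on[OF Susp_fully_faithful[of X Y]] assms(3) f g] Hom_Obj[OF f]
  by blast

lemma Susp_full:
  assumes "X \<in> Obj C" "Y \<in> Obj C" "g \<in> Hom C (SuspO C X) (SuspO C Y)"
  obtains f where "f \<in> Hom C X Y" "Susp C f = g"
proof -
  have "g \<in> Susp C ` Hom C X Y"
    using bij_betw_imp_surj_on[OF Susp_fully_faithful[OF assms(1,2)]] assms(3) by simp
  then show ?thesis using that by blast
qed

lemma Susp_zero_object:
  assumes "is_zero_object C Z" shows "is_zero_object C (SuspO C Z)"
proof -
  have Z: "Z \<in> Obj C" using assms unfolding is_zero_object_def is_initial_def by blast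
  then have "Id C Z = Zero C Z Z" using zero_object_Hom_to[OF assms, of "Id C Z" Z] by simp
  then have "Id C (SuspO C Z) = Zero C (SuspO C Z) (SuspO C Z)"
    using Susp_Id[OF Z] Susp_Zero[OF Z Z] by simp
  then show ?thesis using zero_objectI SuspO_in_Obj[OF Z] by blast
qed

lemma Neg_Zero:
  assumes "X \<in> Obj C" "Y \<in> Obj C" shows "Neg C (Zero C X Y) = Zero C X Y"
proof -
  have Z: "Zero C X Y \<in> Hom C X Y" using assms by simp
  then show ?thesis using Neg_Add[OF Z] Neg_in_Hom[OF Z] by simp
qed

lemma Neg_Comp:
  assumes f: "f \<in> Hom C Y Z" and g: "g \<in> Hom C X Y" shows "Neg C f \<cdot> g = Neg C (f \<cdot> g)"
proof (rule Add_right_cancel)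
  have fg: "f \<cdot> g \<in> Hom C X Z" using f g by simp
  show "Neg C f \<cdot> g \<oplus> f \<cdot> g = Neg C (f \<cdot> g) \<oplus> f \<cdot> g"
    using Comp_Add_left[OF g Neg_in_Hom[OF f] f] Neg_Add[OF f] Neg_Add[OF fg] g Hom_Obj[OF f] by simp
  show "f \<cdot> g \<in> Hom C X Z" by (rule fg)
  show "Neg C (f \<cdot> g) \<in> Hom C X Z" by (rule Neg_in_Hom[OF fg])
  show "Neg C f \<cdot> g \<in> Hom C X Z" by (rule Comp_in_Hom[OF g Neg_in_Hom[OF f]])
qed

lemma Comp_Neg:
  assumes f: "f \<in> Hom C Y Z" and g: "g \<in> Hom C X Y" shows "f \<cdot> Neg C g = Neg C (f \<cdot> g)"
proof (rule Add_right_cancel)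
  have fg: "f \<cdot> g \<in> Hom C X Z" using f g by simp
  show "f \<cdot> Neg C g \<oplus> f \<cdot> g = Neg C (f \<cdot> g) \<oplus> f \<cdot> g"
    using Comp_Add_right[OF Neg_in_Hom[OF g] g f] Neg_Add[OF g] Neg_Add[OF fg] f Hom_Obj[OF g] by simp
  show "f \<cdot> g \<in> Hom C X Z" by (rule fg)
  show "Neg C (f \<cdot> g) \<in> Hom C X Z" by (rule Neg_in_Hom[OF fg])
  show "f \<cdot> Neg C g \<in> Hom C X Z" by (rule Comp_in_Hom[OF Neg_in_Hom[OF g] f])
qed

lemma triangle_rotate:
  assumes "triangle X Y Z u v w"
  shows "triangle Y Z (SuspO C X) v w (Neg C (Susp C u))"
  using Tri_rotate[of u X Y v Z w] triangleD[OF assms] Neg_in_Hom[OF Susp_in_Hom, of u X Y]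
  unfolding triangle_def by blast

text \<open>
  Compare the triangle with the trivial one on \<open>X\<close>: the morphism of triangles starting with the
  identity of \<open>X\<close> and \<open>u\<close> shows that \<open>vu\<close> factors through a zero object.
\<close>

lemma triangle_Comp_Zero:
  assumes t: "triangle X Y Z u v w" shows "v \<cdot> u = Zero C X Z"
proof -
  note d = triangleD[OF t]
  obtain Z0 where Z0: "is_zero_object C Z0" using zero_object_exists by blast
  then have Z0_obj: "Z0 \<in> Obj C" unfolding is_zero_object_def is_initial_def by blast
  obtain h where "h \<in> Hom C Z0 Z" "v \<cdot> u = h \<cdot> Zero C X Z0"
    using Tri_morphism[OF Tri_Id[OF d(5) Z0] d(1), of "Id C X" u] d(2-9) Z0_obj by auto
  then show ?thesis using d Z0_obj by simp
qed

lemma triangle_Comp_Zero':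
  assumes t: "triangle X Y Z u v w" shows "w \<cdot> v = Zero C Y (SuspO C X)"
  by (rule triangle_Comp_Zero[OF triangle_rotate[OF t]])

text \<open>
  The two sides of a triangle are weak kernel and weak cokernel of each other.  A map \<open>g\<close> killed by
  \<open>v\<close> extends to a morphism from the trivial triangle \<open>A \<rightarrow> 0 \<rightarrow> \<Sigma>A\<close> to the rotated triangle, and its
  third component is a suspended factorisation of \<open>g\<close>.
\<close>

lemma triangle_weak_kernel:
  assumes t: "triangle X Y Z u v w" and g: "g \<in> Hom C A Y" and vg: "v \<cdot> g = Zero C A Z"
  obtains h where "h \<in> Hom C A X" "u \<cdot> h = g"
proof -
  note d = triangleD[OF t]
  have A: "A \<in> Obj C" using Hom_Obj[OF g] by blast
  then have SA: "SuspO C A \<in> Obj C" by (rule SuspO_in_Obj)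
  obtain Z0 where Z0: "is_zero_object C Z0" using zero_object_exists by blast
  then have Z0_obj: "Z0 \<in> Obj C" unfolding is_zero_object_def is_initial_def by blast
  have "triangle A A Z0 (Id C A) (Zero C A Z0) (Zero C Z0 (SuspO C A))"
    using Tri_Id[OF A Z0] A Z0_obj SA unfolding triangle_def by simp
  then have t0: "triangle A Z0 (SuspO C A) (Zero C A Z0) (Zero C Z0 (SuspO C A)) (Neg C (Id C (SuspO C A)))"
    using triangle_rotate Susp_Id[OF A] by fastforce
  note d0 = triangleD[OF t0] and dr = triangleD[OF triangle_rotate[OF t]]
  have "\<exists>h \<in> Hom C (SuspO C A) (SuspO C X). Neg C (Susp C u) \<cdot> h = Susp C g \<cdot> Neg C (Id C (SuspO C A))"
    using Tri_morphism[OF d0(1) dr(1), of g "Zero C Z0 Z"] g vg d Z0_obj A SA d0(2-4) dr(2-4)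
    by auto
  then obtain h where h: "h \<in> Hom C (SuspO C A) (SuspO C X)"
    and eq: "Neg C (Susp C u) \<cdot> h = Susp C g \<cdot> Neg C (Id C (SuspO C A))" by blast
  have Sg: "Susp C g \<in> Hom C (SuspO C A) (SuspO C Y)" and Su: "Susp C u \<in> Hom C (SuspO C X) (SuspO C Y)"
    using Susp_in_Hom g d by blast+
  have "Neg C (Susp C u \<cdot> h) = Neg C (Susp C g)"
    using eq Neg_Comp[OF Su h] Comp_Neg[OF Sg, of "Id C (SuspO C A)" "SuspO C A"] SA Sg by simp
  then have Suh: "Susp C u \<cdot> h = Susp C g"
    using Neg_Neg[OF Comp_in_Hom[OF h Su]] Neg_Neg[OF Sg] by metis
  obtain k where k: "k \<in> Hom C A X" "Susp C k = h" using Susp_full[OF A d(5) h] .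
  have "u \<cdot> k = g"
    by (rule Susp_faithful[OF Comp_in_Hom[OF k(1) d(2)] g]) (use Susp_Comp[OF k(1) d(2)] k Suh in simp)
  then show ?thesis using that k(1) by blast
qed

lemma triangle_weak_kernel':
  assumes "triangle X Y Z u v w" "g \<in> Hom C A Z" "w \<cdot> g = Zero C A (SuspO C X)"
  obtains h where "h \<in> Hom C A Y" "v \<cdot> h = g"
  using triangle_weak_kernel[OF triangle_rotate[OF assms(1)] assms(2,3)] by blast

lemma triangle_weak_kernel'':
  assumes t: "triangle X Y Z u v w" and g: "g \<in> Hom C A (SuspO C X)"
    and "Susp C u \<cdot> g = Zero C A (SuspO C Y)"
  obtains h where "h \<in> Hom C A Z" "w \<cdot> h = g"
proof -
  note d = triangleD[OF t]
  have "Neg C (Susp C u) \<cdot> g = Zero C A (SuspO C Y)"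
    using Neg_Comp[OF Susp_in_Hom[OF d(2)] g] assms(3) Neg_Zero Hom_Obj[OF g] d by simp
  then show ?thesis using triangle_weak_kernel'[OF triangle_rotate[OF t] g] that by blast
qed

lemma triangle_weak_cokernel:
  assumes t: "triangle X Y Z u v w" and g: "g \<in> Hom C Y A" and gu: "g \<cdot> u = Zero C X A"
  obtains h where "h \<in> Hom C Z A" "h \<cdot> v = g"
proof -
  note d = triangleD[OF t]
  have A: "A \<in> Obj C" using Hom_Obj[OF g] by blast
  obtain Z0 where Z0: "is_zero_object C Z0" using zero_object_exists by blast
  then have Z0_obj: "Z0 \<in> Obj C" and SZ0_obj: "SuspO C Z0 \<in> Obj C"
    using SuspO_in_Obj unfolding is_zero_object_def is_initial_def by blast+
  have "(Id C A, Zero C A (SuspO C Z0), Neg C (Susp C (Zero C Z0 A))) \<in> Tri C"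
    using Tri_Id[OF A Susp_zero_object[OF Z0]] Susp_Zero[OF Z0_obj A] Neg_Zero SuspO_in_Obj[OF A] SZ0_obj
    by simp
  then have "(Zero C Z0 A, Id C A, Zero C A (SuspO C Z0)) \<in> Tri C"
    using Tri_rotate[of "Zero C Z0 A" Z0 A "Id C A" A "Zero C A (SuspO C Z0)"] A Z0_obj SZ0_obj by simp
  from Tri_morphism[OF d(1) this, of "Zero C X Z0" g]
  have "\<exists>h \<in> Hom C Z A. g = h \<cdot> v" using g gu d A Z0_obj by auto
  then show ?thesis using that by auto
qed

lemma triangle_weak_cokernel':
  assumes "triangle X Y Z u v w" "g \<in> Hom C Z A" "g \<cdot> v = Zero C Y A"
  obtains h where "h \<in> Hom C (SuspO C X) A" "h \<cdot> w = g"
  using triangle_weak_cokernel[OF triangle_rotate[OF assms(1)] assms(2,3)] by blast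

lemma cone_exists:
  assumes "f \<in> Hom C X Y"
  obtains Z v w where "triangle X Y Z f v w"
  using Tri_complete[of f] Tri_triangle assms by (metis Hom_iff)

text \<open>
  The suspension is only essentially surjective, so the fibre of \<open>f\<close> is obtained by replacing the
  cone by an isomorphic object of the form \<open>\<Sigma>Z\<close> and rotating back.
\<close>

lemma fibre_exists:
  assumes f: "f \<in> Hom C X Y"
  obtains Z u v where "triangle Z X Y u f v"
proof -
  obtain K v w where t: "triangle X Y K f v w" using cone_exists[OF f] .
  note d = triangleD[OF t]
  obtain Z \<phi> where Z: "Z \<in> Obj C" and \<phi>: "\<phi> \<in> Hom C (SuspO C Z) K" "is_iso C \<phi>"
    using Susp_essentially_surjective[OF d(7)] unfolding isomorphic_def by blast
  obtain \<psi> where \<psi>: "\<psi> \<in> Hom C K (SuspO C Z)" "\<psi> \<cdot> \<phi> = Id C (SuspO C Z)" "\<phi> \<cdot> \<psi> = Id C K"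
    using is_isoE[OF \<phi>(2,1)] .
  have \<psi>_iso: "is_iso C \<psi>" using is_isoI[OF \<psi>(1) \<phi>(1)] \<psi> by simp
  have w\<phi>: "w \<cdot> \<phi> \<in> Hom C (SuspO C Z) (SuspO C X)" and \<psi>v: "\<psi> \<cdot> v \<in> Hom C Y (SuspO C Z)"
    using \<phi> \<psi> d by auto
  have "(w \<cdot> \<phi>) \<cdot> \<psi> = w" using \<phi>(1) \<psi> d by simp
  then have tri: "(f, \<psi> \<cdot> v, w \<cdot> \<phi>) \<in> Tri C"
    by (intro Tri_iso[OF d(1,2) \<psi>v w\<phi>, of "Id C X" "Id C Y" \<psi>])
      (use d \<psi> \<psi>_iso Susp_Id is_iso_Id in auto)
  obtain u where u: "u \<in> Hom C Z X" "Susp C u = Neg C (w \<cdot> \<phi>)"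
    using Susp_full[OF Z d(5) Neg_in_Hom[OF w\<phi>]] .
  then have "(u, f, \<psi> \<cdot> v) \<in> Tri C"
    using Tri_rotate[OF u(1) d(2) \<psi>v] tri Neg_Neg[OF w\<phi>] by simp
  then have "triangle Z X Y u f (\<psi> \<cdot> v)" using u d \<psi>v unfolding triangle_def by blast
  then show ?thesis using that by blast
qed

text \<open>
  A map into the fibre \<open>Z\<close> that dies in \<open>X\<close> is, after suspension, induced by a map into \<open>Y\<close>: this is
  exactness of \<open>C(\<Sigma>A,X) \<rightarrow> C(\<Sigma>A,Y) \<rightarrow> C(\<Sigma>A,\<Sigma>Z) \<rightarrow> C(\<Sigma>A,\<Sigma>X)\<close> at the third place.
\<close>

lemma Susp_factors_if_killed:
  assumes t: "triangle Z X Y u f v" and x: "x \<in> Hom C A Z" and ux: "u \<cdot> x = Zero C A X"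
  obtains g where "g \<in> Hom C (SuspO C A) Y" "v \<cdot> g = Susp C x"
proof (rule triangle_weak_kernel''[OF t Susp_in_Hom[OF x]])
  have A: "A \<in> Obj C" using Hom_Obj[OF x] by blast
  show "Susp C u \<cdot> Susp C x = Zero C (SuspO C A) (SuspO C X)"
    using Susp_Comp[OF x triangleD(2)[OF t]] ux Susp_Zero[OF A triangleD(6)[OF t]] by simp
qed (use that in blast)

lemma Susp_eq_Zero:
  assumes "x \<in> Hom C A B" "Susp C x = Zero C (SuspO C A) (SuspO C B)" shows "x = Zero C A B"
  using Susp_faithful[OF assms(1), of "Zero C A B"] assms(2) Susp_Zero Hom_Obj[OF assms(1)] by simp

text \<open>
  A split epimorphism is the projection of a biproduct onto a summand: the complement is its fibre,
  whose inclusion is a monomorphism because the connecting map vanishes.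
\<close>

lemma split_epi_biproduct:
  assumes e: "e \<in> Hom C A Y" and \<sigma>: "\<sigma> \<in> Hom C Y A" and e\<sigma>: "e \<cdot> \<sigma> = Id C Y"
  obtains K k \<rho> where "is_biproduct C Y K A \<sigma> k e \<rho>"
proof -
  obtain K k v where t: "triangle K A Y k e v" using fibre_exists[OF e] .
  note d = triangleD[OF t]
  have "v = (v \<cdot> e) \<cdot> \<sigma>" using d(2-4) e \<sigma> e\<sigma> by simp
  then have v0: "v = Zero C Y (SuspO C K)" using triangle_Comp_Zero'[OF t] \<sigma> d by simp
  have mono: "inj_from B k" for B
    unfolding inj_from_iff_kernel[OF d(2)]
  proof (intro ballI impI)
    fix x assume x: "x \<in> Hom C B K" "k \<cdot> x = Zero C B A"
    then obtain g where g: "g \<in> Hom C (SuspO C B) Y" "v \<cdot> g = Susp C x"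
      using Susp_factors_if_killed[OF t] by blast
    have "Susp C x = Zero C (SuspO C B) (SuspO C K)" using g v0 d(8) by simp
    then show "x = Zero C B K" by (rule Susp_eq_Zero[OF x(1)])
  qed
  have \<sigma>e: "\<sigma> \<cdot> e \<in> Hom C A A" and id: "Id C A \<in> Hom C A A" using \<sigma> e d(6) by simp_all
  have "e \<cdot> (Id C A \<ominus> \<sigma> \<cdot> e) = Zero C A Y"
    using Comp_diff[OF id \<sigma>e e] diff_eq_Zero_iff[OF e e] Comp_eq_assoc[OF e\<sigma> \<sigma> e e] e d(6) by simp
  then obtain \<rho> where \<rho>: "\<rho> \<in> Hom C A K" "k \<cdot> \<rho> = Id C A \<ominus> \<sigma> \<cdot> e"
    using triangle_weak_kernel[OF t diff_in_Hom[OF id \<sigma>e]] by blast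
  have "k \<cdot> (\<rho> \<cdot> k) = k \<cdot> Id C K"
    using Comp_eq_assoc[OF \<rho>(2,1) d(2,2)] diff_Comp[OF id \<sigma>e d(2)] triangle_Comp_Zero[OF t]
      diff_Zero[OF d(2)] \<sigma> e d by simp
  then have \<rho>k: "\<rho> \<cdot> k = Id C K"
    using inj_fromD[OF mono d(2), of "\<rho> \<cdot> k" K "Id C K"] \<rho>(1) d by simp
  have "k \<cdot> (\<rho> \<cdot> \<sigma>) = k \<cdot> Zero C Y K"
    using Comp_eq_assoc[OF \<rho>(2,1) d(2) \<sigma>] diff_Comp[OF id \<sigma>e \<sigma>] diff_eq_Zero_iff[OF \<sigma> \<sigma>] \<sigma> e e\<sigma> d
    by simp
  then have \<rho>\<sigma>: "\<rho> \<cdot> \<sigma> = Zero C Y K"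
    using inj_fromD[OF mono d(2), of "\<rho> \<cdot> \<sigma>" Y "Zero C Y K"] \<rho>(1) \<sigma> d by simp
  have "(\<sigma> \<cdot> e) \<oplus> (k \<cdot> \<rho>) = Id C A"
    using Add_commute[OF \<sigma>e diff_in_Hom[OF id \<sigma>e]] diff_Add[OF id \<sigma>e] \<rho>(2) by simp
  then have "is_biproduct C Y K A \<sigma> k e \<rho>"
    unfolding is_biproduct_def using d e \<sigma> e\<sigma> \<rho>(1) \<rho>k \<rho>\<sigma> triangle_Comp_Zero[OF t] by blast
  then show ?thesis using that by blast
qed

text \<open>
  The cone map \<open>Y \<rightarrow> Z\<close> of an epimorphism composes with it to zero and is therefore zero, so the
  identity of \<open>Y\<close> lifts.
\<close>

lemma epi_splits:
  assumes "is_epi C e" and e: "e \<in> Hom C A Y"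
  obtains \<sigma> where "\<sigma> \<in> Hom C Y A" "e \<cdot> \<sigma> = Id C Y"
proof -
  obtain Z v w where t: "triangle A Y Z e v w" using cone_exists[OF e] .
  note d = triangleD[OF t]
  have "v \<cdot> e = Zero C Y Z \<cdot> e" using triangle_Comp_Zero[OF t] e d by simp
  moreover have "Zero C Y Z \<in> Hom C Y Z" using d by simp
  moreover have "Cod C e = Y" using e by simp
  ultimately have "v = Zero C Y Z" using assms(1) d(3,7) unfolding is_epi_def by blast
  then show ?thesis using triangle_weak_kernel[OF t, of "Id C Y" Y] that d by auto
qed

end


section \<open>The ideal and the weak equivalences of a rigid subcategory\<close>

locale rigid_subcategory = triangulated_category C
  for C :: "('o, 'm, 'c) tri_cat_scheme" (structure) +
  fixes T :: "'o set"
  assumes strictly_full: "strictly_full C T"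
    and summand_closed: "summand_closed C T"
    and rigid: "rigid C T"
    and contravariantly_finite: "contravariantly_finite C T"
begin

lemma T_Obj: "A \<in> T \<Longrightarrow> A \<in> Obj C"
  using strictly_full unfolding strictly_full_def by blast

lemma SuspO_T_Obj: "A \<in> T \<Longrightarrow> SuspO C A \<in> Obj C"
  using T_Obj SuspO_in_Obj by blast

lemma perp_iff: "U \<in> perp C T \<longleftrightarrow> U \<in> Obj C \<and> (\<forall>A \<in> T. \<forall>f \<in> Hom C A U. f = Zero C A U)"
  unfolding perp_def using T_Obj by auto

lemma perp_Obj: "U \<in> perp C T \<Longrightarrow> U \<in> Obj C"
  by (simp add: perp_iff)

lemma perp_Zero: "\<lbrakk>U \<in> perp C T; A \<in> T; f \<in> Hom C A U\<rbrakk> \<Longrightarrow> f = Zero C A U"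
  unfolding perp_iff by blast

lemma Susp_T_perp: "A \<in> T \<Longrightarrow> SuspO C A \<in> perp C T"
  using rigid unfolding rigid_def by blast

lemma right_approximation:
  assumes "X \<in> Obj C"
  obtains A a where "A \<in> T" "a \<in> Hom C A X" "\<And>B. B \<in> T \<Longrightarrow> surj_from B a"
proof -
  obtain A a where A: "A \<in> T" "a \<in> Hom C A X"
    and fac: "\<forall>B \<in> T. \<forall>g \<in> Hom C B X. \<exists>h \<in> Hom C B A. a \<cdot> h = g"
    using contravariantly_finite assms unfolding contravariantly_finite_def by blast
  have "surj_from B a" if "B \<in> T" for B
    by (rule surj_fromI[OF A(2)]) (use fac that in blast)
  then show ?thesis using that A by blast
qed

text \<open>
  Closure under direct summands is closure under retracts, because the retraction has a complement.
\<close>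

lemma T_retract:
  assumes "A \<in> T" "e \<in> Hom C A Y" "\<sigma> \<in> Hom C Y A" "e \<cdot> \<sigma> = Id C Y"
  shows "Y \<in> T"
proof -
  obtain K k \<rho> where "is_biproduct C Y K A \<sigma> k e \<rho>" using split_epi_biproduct[OF assms(2-4)] .
  then show ?thesis using summand_closed assms(1) unfolding summand_closed_def by blast
qed

text \<open>
  Rigidity enters here: a map from \<open>T\<close> to the cone of an approximation \<open>T\<^sub>0 \<rightarrow> X\<close> dies in
  \<open>\<Sigma>T\<^sub>0\<close>, so it comes from \<open>X\<close>, hence from \<open>T\<^sub>0\<close>, and vanishes.
\<close>

lemma approximation_cone_perp:
  assumes A: "A \<in> T" and surj: "\<And>B. B \<in> T \<Longrightarrow> surj_from B a" and t: "triangle A X U a v w"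
  shows "U \<in> perp C T"
  unfolding perp_iff
proof (intro conjI ballI)
  note d = triangleD[OF t]
  show "U \<in> Obj C" by (rule d)
  fix B g assume B: "B \<in> T" and g: "g \<in> Hom C B U"
  have "w \<cdot> g = Zero C B (SuspO C A)"
    by (rule perp_Zero[OF Susp_T_perp[OF A] B Comp_in_Hom[OF g d(4)]])
  then obtain x where x: "x \<in> Hom C B X" "v \<cdot> x = g" using triangle_weak_kernel'[OF t g] by blast
  obtain y where y: "y \<in> Hom C B A" "a \<cdot> y = x" using surj_fromE[OF surj[OF B] d(2) x(1)] .
  have "v \<cdot> (a \<cdot> y) = Zero C A U \<cdot> y"
    by (rule Comp_eq_assoc[OF triangle_Comp_Zero[OF t] d(2,3) y(1)])
  then show "g = Zero C B U" using x y d by simp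
qed

text \<open>
  The ideal consists of the maps that \<open>T\<close> does not see: such a map kills an approximation of its
  source and therefore factors through the cone of that approximation.
\<close>

lemma ideal_iff:
  assumes f: "f \<in> Hom C X Y"
  shows "f \<in> ideal_of C (perp C T) \<longleftrightarrow> (\<forall>A \<in> T. \<forall>x \<in> Hom C A X. f \<cdot> x = Zero C A Y)"
proof
  assume "f \<in> ideal_of C (perp C T)"
  then obtain U g h where U: "U \<in> perp C T" and g: "g \<in> Hom C X U" and h: "h \<in> Hom C U Y"
    and fgh: "f = h \<cdot> g" unfolding ideal_of_iff[OF f] by blast
  show "\<forall>A \<in> T. \<forall>x \<in> Hom C A X. f \<cdot> x = Zero C A Y"
  proof (intro ballI)
    fix A x assume A: "A \<in> T" and x: "x \<in> Hom C A X"
    have "g \<cdot> x = Zero C A U" by (rule perp_Zero[OF U A Comp_in_Hom[OF x g]])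
    then show "f \<cdot> x = Zero C A Y" using fgh g h x T_Obj[OF A] by simp
  qed
next
  assume null: "\<forall>A \<in> T. \<forall>x \<in> Hom C A X. f \<cdot> x = Zero C A Y"
  obtain A a where A: "A \<in> T" "a \<in> Hom C A X" "\<And>B. B \<in> T \<Longrightarrow> surj_from B a"
    using right_approximation Hom_Obj[OF f] by blast
  obtain U v w where t: "triangle A X U a v w" using cone_exists[OF A(2)] .
  obtain h where "h \<in> Hom C U Y" "h \<cdot> v = f" using triangle_weak_cokernel[OF t f] null A by blast
  then show "f \<in> ideal_of C (perp C T)"
    using approximation_cone_perp[OF A(1,3) t] triangleD(3)[OF t] unfolding ideal_of_iff[OF f] by blast
qed

text \<open>
  Exactness of \<open>C(A,Z) \<rightarrow> C(A,X) \<rightarrow> C(A,Y) \<rightarrow> C(A,\<Sigma>Z)\<close>: the conditions on \<open>u\<close> and \<open>v\<close> are conditions on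
  \<open>f\<close> alone, so it does not matter which triangle on \<open>f\<close> is chosen.
\<close>

lemma inj_surj_iff_ideal:
  assumes t: "triangle Z X Y u f v"
  shows "u \<in> ideal_of C (perp C T) \<longleftrightarrow> (\<forall>A \<in> T. inj_from A f)"
    and "v \<in> ideal_of C (perp C T) \<longleftrightarrow> (\<forall>A \<in> T. surj_from A f)"
proof -
  note d = triangleD[OF t]
  have "inj_from A f \<longleftrightarrow> (\<forall>x \<in> Hom C A Z. u \<cdot> x = Zero C A X)" if A: "A \<in> T" for A
    unfolding inj_from_iff_kernel[OF d(3)]
  proof
    assume ker: "\<forall>g \<in> Hom C A X. f \<cdot> g = Zero C A Y \<longrightarrow> g = Zero C A X"
    show "\<forall>x \<in> Hom C A Z. u \<cdot> x = Zero C A X"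
    proof
      fix x assume x: "x \<in> Hom C A Z"
      have "f \<cdot> (u \<cdot> x) = Zero C A Y"
        using Comp_eq_assoc[OF triangle_Comp_Zero[OF t] d(2,3) x] x d by simp
      then show "u \<cdot> x = Zero C A X" using ker Comp_in_Hom[OF x d(2)] by blast
    qed
  next
    assume null: "\<forall>x \<in> Hom C A Z. u \<cdot> x = Zero C A X"
    show "\<forall>g \<in> Hom C A X. f \<cdot> g = Zero C A Y \<longrightarrow> g = Zero C A X"
      using triangle_weak_kernel[OF t] null by metis
  qed
  then show "u \<in> ideal_of C (perp C T) \<longleftrightarrow> (\<forall>A \<in> T. inj_from A f)"
    using ideal_iff[OF d(2)] by blast
  have "surj_from A f \<longleftrightarrow> (\<forall>x \<in> Hom C A Y. v \<cdot> x = Zero C A (SuspO C Z))" if A: "A \<in> T" for A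
  proof
    assume surj: "surj_from A f"
    show "\<forall>x \<in> Hom C A Y. v \<cdot> x = Zero C A (SuspO C Z)"
    proof
      fix x assume "x \<in> Hom C A Y"
      then obtain y where y: "y \<in> Hom C A X" "f \<cdot> y = x" using surj_fromE[OF surj d(3)] by blast
      then show "v \<cdot> x = Zero C A (SuspO C Z)"
        using Comp_eq_assoc[OF triangle_Comp_Zero'[OF t] d(3,4) y(1)] d by simp
    qed
  next
    assume "\<forall>x \<in> Hom C A Y. v \<cdot> x = Zero C A (SuspO C Z)"
    then show "surj_from A f" using triangle_weak_kernel'[OF t] by (metis surj_fromI[OF d(3)])
  qed
  then show "v \<in> ideal_of C (perp C T) \<longleftrightarrow> (\<forall>A \<in> T. surj_from A f)"
    using ideal_iff[OF d(4)] by blast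
qed

abbreviation W :: "'m set" where
  "W \<equiv> weak_equivs C T"

lemma shows W_iff: "f \<in> W \<longleftrightarrow> f \<in> Arr C \<and> (\<forall>A \<in> T. inj_from A f \<and> surj_from A f)" (is ?bij)
  and W_iff_some_triangle: "f \<in> W \<longleftrightarrow> f \<in> Arr C \<and> (\<exists>u v. (u, f, v) \<in> Tri C \<and>
     u \<in> ideal_of C (perp C T) \<and> v \<in> ideal_of C (perp C T))" (is ?some)
proof -
  have tri: "u \<in> ideal_of C (perp C T) \<and> v \<in> ideal_of C (perp C T) \<longleftrightarrow>
      (\<forall>A \<in> T. inj_from A f \<and> surj_from A f)" if "(u, f, v) \<in> Tri C" for u v
    using inj_surj_iff_ideal[of "Dom C u" "Cod C u" "Cod C f" u f v] Tri_triangle[OF that] by blast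
  have ex: "\<exists>u v. (u, f, v) \<in> Tri C" if "f \<in> Arr C"
    using fibre_exists[of f "Dom C f" "Cod C f"] that triangleD(1) by (metis Hom_iff)
  show ?bij ?some unfolding weak_equivs_def using tri ex by blast+
qed

lemma W_Arr: "f \<in> W \<Longrightarrow> f \<in> Arr C"
  by (simp add: W_iff)

lemma stable_W: "stable_class C W"
  unfolding stable_class_def
proof (intro conjI ballI allI impI)
  show "W \<subseteq> Arr C" using W_Arr by blast
  show "Id C X \<in> W" if "X \<in> Obj C" for X
    using that inj_from_Id surj_from_Id by (simp add: W_iff)
  show "g \<cdot> f \<in> W" if "f \<in> W" "g \<in> W" "Cod C f = Dom C g" for f g
    using that inj_from_Comp[of f "Dom C f" "Dom C g" g "Cod C g"]
      surj_from_Comp[of f "Dom C f" "Dom C g" g "Cod C g"] by (simp add: W_iff)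
  show "f \<in> W" if "is_retract C f g \<and> g \<in> W" for f g
    using that inj_from_retract[of f g] surj_from_retract[of f g] by (auto simp: W_iff is_retract_def)
qed

lemma W_two_of_three:
  assumes f: "f \<in> Hom C X Y" and g: "g \<in> Hom C Y Z"
  shows "\<lbrakk>f \<in> W; g \<in> W\<rbrakk> \<Longrightarrow> g \<cdot> f \<in> W" "\<lbrakk>f \<in> W; g \<cdot> f \<in> W\<rbrakk> \<Longrightarrow> g \<in> W"
    "\<lbrakk>g \<in> W; g \<cdot> f \<in> W\<rbrakk> \<Longrightarrow> f \<in> W"
proof -
  show "\<lbrakk>f \<in> W; g \<in> W\<rbrakk> \<Longrightarrow> g \<cdot> f \<in> W"
    using inj_from_Comp[OF f g] surj_from_Comp[OF f g] f g by (simp add: W_iff)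
  show "\<lbrakk>f \<in> W; g \<cdot> f \<in> W\<rbrakk> \<Longrightarrow> g \<in> W"
    using inj_from_cancel_right[OF f g] surj_from_cancel_right[OF f g] g by (simp add: W_iff)
  show "\<lbrakk>g \<in> W; g \<cdot> f \<in> W\<rbrakk> \<Longrightarrow> f \<in> W"
    using inj_from_cancel_left[OF f g] surj_from_cancel_left[OF f g] f by (simp add: W_iff)
qed

text \<open>
  The functors \<open>C(A,-)\<close> do not see a summand in \<open>T\<^sup>\<bottom>\<close>.  This supplies the cylinder and path objects
  below as well as the basic trivial cofibrations \<open>X \<rightarrow> X \<oplus> \<Sigma>A\<close>.
\<close>

lemma perp_summand_W:
  assumes B: "is_biproduct C X U P i j p q" and U: "U \<in> perp C T"
  shows "i \<in> W" "p \<in> W"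
proof -
  note b = biproductD[OF B]
  show i: "i \<in> W"
    unfolding W_iff
  proof (intro conjI ballI)
    show "i \<in> Arr C" using b by simp
    fix A assume A: "A \<in> T"
    show "inj_from A i"
      by (rule inj_from_cancel_left[OF b(4,6)]) (use b inj_from_Id in simp)
    show "surj_from A i"
    proof (rule surj_fromI[OF b(4)])
      fix g assume g: "g \<in> Hom C A P"
      have pg: "p \<cdot> g \<in> Hom C A X" by (rule Comp_in_Hom[OF g b(6)])
      have "q \<cdot> g = Zero C A U" by (rule perp_Zero[OF U A Comp_in_Hom[OF g b(7)]])
      then have "i \<cdot> (p \<cdot> g) = g"
        using Comp_eq_assoc[OF b(8) b(4,6) pg] Comp_eq_assoc[OF b(11) b(4,7) pg] pg b(2)
        by (intro biproduct_to_eqI[OF B Comp_in_Hom[OF pg b(4)] g]) simp_all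
      then show "\<exists>h \<in> Hom C A X. i \<cdot> h = g" using pg by blast
    qed
  qed
  show "p \<in> W"
    by (rule W_two_of_three(2)[OF b(4,6) i]) (use b stable_W in \<open>simp add: stable_class_def\<close>)
qed


section \<open>Homotopies\<close>

text \<open>
  Both homotopy relations turn out to be equality as seen from \<open>T\<close>.  A weak equivalence identifies
  the two ends of a cylinder or path object as seen from \<open>T\<close>.  Conversely, if \<open>f - g\<close> factors as
  \<open>X \<rightarrow> U \<rightarrow> Y\<close> with \<open>U\<close> in \<open>T\<^sup>\<bottom>\<close>, then \<open>X \<oplus> U\<close> is a cylinder object and \<open>Y \<oplus> U\<close> a path object
  which carry a homotopy.
\<close>

lemma T_equal_factor:
  assumes f: "f \<in> Hom C X Y" and g: "g \<in> Hom C X Y"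
    and eq: "\<forall>A \<in> T. \<forall>x \<in> Hom C A X. f \<cdot> x = g \<cdot> x"
  obtains U k h where "U \<in> perp C T" "k \<in> Hom C X U" "h \<in> Hom C U Y" "g \<oplus> (h \<cdot> k) = f"
proof -
  note fg = diff_in_Hom[OF f g]
  have "f \<ominus> g \<in> ideal_of C (perp C T)"
    unfolding ideal_iff[OF fg]
  proof (intro ballI)
    fix A x assume A: "A \<in> T" and x: "x \<in> Hom C A X"
    show "(f \<ominus> g) \<cdot> x = Zero C A Y"
      unfolding diff_Comp[OF f g x] diff_eq_Zero_iff[OF Comp_in_Hom[OF x f] Comp_in_Hom[OF x g]]
      using eq A x by blast
  qed
  then obtain U k h where "U \<in> perp C T" "k \<in> Hom C X U" "h \<in> Hom C U Y" "f \<ominus> g = h \<cdot> k"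
    unfolding ideal_of_iff[OF fg] by blast
  then show ?thesis using that diff_Add[OF f g] Add_commute[OF g fg] by metis
qed

lemma right_homotopic_iff:
  assumes f: "f \<in> Hom C X Y" and g: "g \<in> Hom C X Y"
  shows "right_homotopic C W f g \<longleftrightarrow> (\<forall>A \<in> T. \<forall>x \<in> Hom C A X. f \<cdot> x = g \<cdot> x)"
proof
  have DC: "Dom C f = X" "Cod C f = Y" using f by simp_all
  assume "right_homotopic C W f g"
  then obtain P p q Y' s d K where
    "is_binary_product C Y Y P p q" and s: "s \<in> Hom C Y Y'" "s \<in> W" and d: "d \<in> Hom C Y' P"
    and ps: "p \<cdot> (d \<cdot> s) = Id C Y" "q \<cdot> (d \<cdot> s) = Id C Y"
    and K: "K \<in> Hom C X Y'" "p \<cdot> (d \<cdot> K) = f" "q \<cdot> (d \<cdot> K) = g"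
    unfolding right_homotopic_def DC by blast
  then have p: "p \<in> Hom C P Y" and q: "q \<in> Hom C P Y"
    unfolding is_binary_product_def is_product_def by (metis UNIV_I)+
  show "\<forall>A \<in> T. \<forall>x \<in> Hom C A X. f \<cdot> x = g \<cdot> x"
  proof (intro ballI)
    fix A x assume A: "A \<in> T" and x: "x \<in> Hom C A X"
    obtain y where y: "y \<in> Hom C A Y" "s \<cdot> y = K \<cdot> x"
      using surj_fromE[OF _ s(1) Comp_in_Hom[OF x K(1)]] s(2) A W_iff by blast
    have "f \<cdot> x = p \<cdot> (d \<cdot> (s \<cdot> y))" using K x y p d by auto
    also have "\<dots> = (p \<cdot> (d \<cdot> s)) \<cdot> y" using p d s(1) y(1) by simp
    also have "\<dots> = (q \<cdot> (d \<cdot> s)) \<cdot> y" using ps by simp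
    also have "\<dots> = q \<cdot> (d \<cdot> (s \<cdot> y))" using q d s(1) y(1) by simp
    also have "\<dots> = g \<cdot> x" using K x y q d by auto
    finally show "f \<cdot> x = g \<cdot> x" .
  qed
next
  have Y: "Y \<in> Obj C" using Hom_Obj[OF f] by blast
  assume "\<forall>A \<in> T. \<forall>x \<in> Hom C A X. f \<cdot> x = g \<cdot> x"
  then obtain U k h where U: "U \<in> perp C T" and k: "k \<in> Hom C X U" and h: "h \<in> Hom C U Y"
    and fgh: "g \<oplus> (h \<cdot> k) = f" using T_equal_factor[OF f g] by blast
  obtain Y' i j p q where B: "is_biproduct C Y U Y' i j p q"
    using biproduct_exists[OF Y perp_Obj[OF U]] by blast
  note b = biproductD[OF B]
  obtain P i' j' p' q' where B': "is_biproduct C Y Y P i' j' p' q'"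
    using biproduct_exists[OF Y Y] by blast
  note b' = biproductD[OF B']
  \<comment> \<open>The two ends of the path object \<open>Y \<oplus> U\<close> are \<open>(1, h)\<close> and \<open>(1, 0)\<close>, and the homotopy is \<open>(g, k)\<close>.\<close>
  obtain a where a: "a \<in> Hom C Y' Y" "a \<cdot> i = Id C Y" "a = (Id C Y \<cdot> p) \<oplus> (h \<cdot> q)"
    using biproduct_copair[OF B Id_in_Hom[OF Y] h] by metis
  obtain d where d: "d \<in> Hom C Y' P" "p' \<cdot> d = a" "q' \<cdot> d = p" using biproduct_pair[OF B' a(1) b(6)] .
  obtain K where K: "K \<in> Hom C X Y'" "p \<cdot> K = g" "q \<cdot> K = k" using biproduct_pair[OF B g k] .
  have hq: "h \<cdot> q \<in> Hom C Y' Y" using h b by simp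
  have "a = p \<oplus> (h \<cdot> q)" using a(3) b(6) by simp
  then have "a \<cdot> K = f" using Comp_Add_left[OF K(1) b(6) hq] K h b(7) fgh by simp
  then have "p' \<cdot> (d \<cdot> K) = f" using Comp_eq_assoc[OF d(2,1) b'(6) K(1)] by simp
  moreover have "q' \<cdot> (d \<cdot> K) = g" using Comp_eq_assoc[OF d(3,1) b'(7) K(1)] K(2) by simp
  moreover have "p' \<cdot> (d \<cdot> i) = Id C Y" using Comp_eq_assoc[OF d(2,1) b'(6) b(4)] a(2) by simp
  moreover have "q' \<cdot> (d \<cdot> i) = Id C Y" using Comp_eq_assoc[OF d(3,1) b'(7) b(4)] b(8) by simp
  moreover have "Dom C f = X" "Cod C f = Y" "f \<in> Arr C" using f by simp_all
  ultimately show "right_homotopic C W f g"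
    unfolding right_homotopic_def
    using g biproduct_is_product[OF B'] b(4) perp_summand_W(1)[OF B U] d(1) K(1) by blast
qed

lemma left_homotopic_iff:
  assumes f: "f \<in> Hom C X Y" and g: "g \<in> Hom C X Y"
  shows "left_homotopic C W f g \<longleftrightarrow> (\<forall>A \<in> T. \<forall>x \<in> Hom C A X. f \<cdot> x = g \<cdot> x)"
proof
  have DC: "Dom C f = X" "Cod C f = Y" using f by simp_all
  assume "left_homotopic C W f g"
  then obtain P i j X' c s H where
    "is_binary_coproduct C X X P i j" and c: "c \<in> Hom C P X'" and s: "s \<in> Hom C X' X" "s \<in> W"
    and si: "(s \<cdot> c) \<cdot> i = Id C X" "(s \<cdot> c) \<cdot> j = Id C X"
    and H: "H \<in> Hom C X' Y" "(H \<cdot> c) \<cdot> i = f" "(H \<cdot> c) \<cdot> j = g"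
    unfolding left_homotopic_def DC by blast
  then have i: "i \<in> Hom C X P" and j: "j \<in> Hom C X P"
    unfolding is_binary_coproduct_def is_coproduct_def by (metis UNIV_I)+
  show "\<forall>A \<in> T. \<forall>x \<in> Hom C A X. f \<cdot> x = g \<cdot> x"
  proof (intro ballI)
    fix A x assume A: "A \<in> T" and x: "x \<in> Hom C A X"
    have "s \<cdot> (c \<cdot> (i \<cdot> x)) = ((s \<cdot> c) \<cdot> i) \<cdot> x" using s(1) c i x by simp
    also have "\<dots> = ((s \<cdot> c) \<cdot> j) \<cdot> x" using si by simp
    also have "\<dots> = s \<cdot> (c \<cdot> (j \<cdot> x))" using s(1) c j x by simp
    finally have eq: "c \<cdot> (i \<cdot> x) = c \<cdot> (j \<cdot> x)"
      using inj_fromD[OF _ s(1), of A "c \<cdot> (i \<cdot> x)" "c \<cdot> (j \<cdot> x)"] s(2) A W_iff c i j x by auto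
    have "f \<cdot> x = H \<cdot> (c \<cdot> (i \<cdot> x))" using H(1) H(2)[symmetric] c i x by simp
    also have "\<dots> = g \<cdot> x" unfolding eq using H(1) H(3)[symmetric] c j x by simp
    finally show "f \<cdot> x = g \<cdot> x" .
  qed
next
  have X: "X \<in> Obj C" using Hom_Obj[OF f] by blast
  assume "\<forall>A \<in> T. \<forall>x \<in> Hom C A X. f \<cdot> x = g \<cdot> x"
  then obtain U k h where U: "U \<in> perp C T" and k: "k \<in> Hom C X U" and h: "h \<in> Hom C U Y"
    and fgh: "g \<oplus> (h \<cdot> k) = f" using T_equal_factor[OF f g] by blast
  obtain X' i j p q where B: "is_biproduct C X U X' i j p q"
    using biproduct_exists[OF X perp_Obj[OF U]] by blast
  note b = biproductD[OF B]
  obtain P i' j' p' q' where B': "is_biproduct C X X P i' j' p' q'"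
    using biproduct_exists[OF X X] by blast
  note b' = biproductD[OF B']
  \<comment> \<open>The two ends of the cylinder \<open>X \<oplus> U\<close> are \<open>(1, k)\<close> and \<open>(1, 0)\<close>, and the homotopy is \<open>(g, h)\<close>.\<close>
  obtain m where m: "m \<in> Hom C X X'" "p \<cdot> m = Id C X" "q \<cdot> m = k"
    using biproduct_pair[OF B Id_in_Hom[OF X] k] .
  obtain c where c: "c \<in> Hom C P X'" "c \<cdot> i' = m" "c \<cdot> j' = i"
    using biproduct_copair[OF B' m(1) b(4)] by metis
  obtain H where H: "H \<in> Hom C X' Y" "H \<cdot> i = g" "H = (g \<cdot> p) \<oplus> (h \<cdot> q)"
    using biproduct_copair[OF B g h] by metis
  have gp: "g \<cdot> p \<in> Hom C X' Y" and hq: "h \<cdot> q \<in> Hom C X' Y" using g h b by simp_all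
  have Hm: "H \<cdot> m = f" using H(3) Comp_Add_left[OF m(1) gp hq] m g h b(6,7) fgh by simp
  have "(H \<cdot> c) \<cdot> i' = f" "(H \<cdot> c) \<cdot> j' = g" "(p \<cdot> c) \<cdot> i' = Id C X" "(p \<cdot> c) \<cdot> j' = Id C X"
    using H(1,2) c b'(4,5) Hm b(6,8) m(2) by simp_all
  moreover have "Dom C f = X" "Cod C f = Y" "f \<in> Arr C" using f by simp_all
  ultimately show "left_homotopic C W f g"
    unfolding left_homotopic_def
    using g biproduct_is_coproduct[OF B'] b(6) perp_summand_W(2)[OF B U] c(1) H(1) by blast
qed

lemma null_homotopic_iff: "null_homotopic C W f \<longleftrightarrow> f \<in> ideal_of C (perp C T)"
proof (cases "f \<in> Arr C")
  case True
  then have f: "f \<in> Hom C (Dom C f) (Cod C f)" by simp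
  then have Z: "Zero C (Dom C f) (Cod C f) \<in> Hom C (Dom C f) (Cod C f)" using Hom_Obj[OF f] by simp
  have "Zero C (Dom C f) (Cod C f) \<cdot> x = Zero C A (Cod C f)" if "x \<in> Hom C A (Dom C f)" for A x
    using that Hom_Obj[OF f] by simp
  then show ?thesis
    unfolding null_homotopic_def homotopic_def left_homotopic_iff[OF f Z] right_homotopic_iff[OF f Z]
      ideal_iff[OF f] by auto
next
  case False
  then show ?thesis unfolding null_homotopic_def homotopic_def left_homotopic_def ideal_of_def by blast
qed


section \<open>Fibrations and cofibrations\<close>

text \<open>
  These are the maps with the right lifting property against \<open>0 \<rightarrow> \<Sigma>A\<close> for \<open>A\<close> in \<open>T\<close>.  They are chosen
  so that the inclusions \<open>X \<rightarrow> X \<oplus> \<Sigma>A\<close>, which are weak equivalences by rigidity, become trivial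
  cofibrations.
\<close>

definition Fib :: "'m set" where
  "Fib = {f \<in> Arr C. \<forall>A \<in> T. surj_from (SuspO C A) f}"

definition Cof :: "'m set" where
  "Cof = llp C (W \<inter> Fib)"

lemma Fib_iff: "f \<in> Fib \<longleftrightarrow> f \<in> Arr C \<and> (\<forall>A \<in> T. surj_from (SuspO C A) f)"
  by (simp add: Fib_def)

lemma stable_Fib: "stable_class C Fib"
  unfolding stable_class_def
proof (intro conjI ballI allI impI)
  show "Fib \<subseteq> Arr C" by (auto simp: Fib_iff)
  show "Id C X \<in> Fib" if "X \<in> Obj C" for X using that surj_from_Id by (simp add: Fib_iff)
  show "g \<cdot> f \<in> Fib" if "f \<in> Fib" "g \<in> Fib" "Cod C f = Dom C g" for f g
    using that surj_from_Comp[of f "Dom C f" "Dom C g" g "Cod C g"] by (simp add: Fib_iff)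
  show "f \<in> Fib" if "is_retract C f g \<and> g \<in> Fib" for f g
    using that surj_from_retract[of f g] by (auto simp: Fib_iff is_retract_def)
qed

lemma stable_Cof: "stable_class C Cof"
  unfolding Cof_def by (rule stable_class_llp) (use W_Arr in auto)

lemma trivial_fibration_Comp:
  assumes "f \<in> Hom C X Y" "g \<in> Hom C Y Z" "f \<in> W \<inter> Fib" "g \<in> W \<inter> Fib"
  shows "g \<cdot> f \<in> W \<inter> Fib"
  using assms stable_W stable_Fib unfolding stable_class_def by simp

text \<open>
  In the long exact sequence of a triangle \<open>N \<rightarrow> E \<rightarrow> B \<rightarrow> \<Sigma>N\<close>, the group \<open>C(A,N) \<cong> C(\<Sigma>A,\<Sigma>N)\<close> is an
  extension of the kernel of \<open>C(A,E) \<rightarrow> C(A,B)\<close> by the cokernel of \<open>C(\<Sigma>A,E) \<rightarrow> C(\<Sigma>A,B)\<close>.  Hence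
  trivial fibrations are characterised by surjectivity of \<open>C(A,-)\<close> for \<open>A\<close> in \<open>T\<close> and a fibre in
  \<open>T\<^sup>\<bottom>\<close>.
\<close>

lemma trivial_fibration_fibre_perp:
  assumes p: "p \<in> W \<inter> Fib" and t: "triangle N E B n p q"
  shows "N \<in> perp C T"
  unfolding perp_iff
proof (intro conjI ballI)
  note d = triangleD[OF t]
  show "N \<in> Obj C" by (rule d)
  fix A g assume A: "A \<in> T" and g: "g \<in> Hom C A N"
  have ng: "n \<cdot> g \<in> Hom C A E" by (rule Comp_in_Hom[OF g d(2)])
  have "p \<cdot> (n \<cdot> g) = Zero C A B"
    using Comp_eq_assoc[OF triangle_Comp_Zero[OF t] d(2,3) g] g d by simp
  then have "n \<cdot> g = Zero C A E"
    using p A ng inj_from_iff_kernel[OF d(3), of A] by (simp add: W_iff)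
  then obtain x where x: "x \<in> Hom C (SuspO C A) B" "q \<cdot> x = Susp C g"
    using Susp_factors_if_killed[OF t g] by blast
  have "surj_from (SuspO C A) p" using p A by (simp add: Fib_iff)
  then obtain y where y: "y \<in> Hom C (SuspO C A) E" "p \<cdot> y = x" using surj_fromE[OF _ d(3) x(1)] by blast
  have "Susp C g = Zero C (SuspO C A) (SuspO C N)"
    using Comp_eq_assoc[OF triangle_Comp_Zero'[OF t] d(3,4) y(1)] x(2) y d by simp
  then show "g = Zero C A N" by (rule Susp_eq_Zero[OF g])
qed

lemma trivial_fibrationI:
  assumes t: "triangle N E B n p q" and N: "N \<in> perp C T" and surj: "\<And>A. A \<in> T \<Longrightarrow> surj_from A p"
  shows "p \<in> W \<inter> Fib"
proof
  note d = triangleD[OF t]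
  have "n \<in> ideal_of C (perp C T)"
    unfolding ideal_of_iff[OF d(2)]
    using N d(2,5) by (intro bexI[of _ N] bexI[of _ "Id C N"] bexI[of _ n]) simp_all
  then show "p \<in> W" using inj_surj_iff_ideal(1)[OF t] surj d(3) by (simp add: W_iff)
  have "surj_from (SuspO C A) p" if A: "A \<in> T" for A
  proof (rule surj_fromI[OF d(3)])
    fix g assume g: "g \<in> Hom C (SuspO C A) B"
    obtain x where x: "x \<in> Hom C A N" "Susp C x = q \<cdot> g"
      using Susp_full[OF T_Obj[OF A] d(5) Comp_in_Hom[OF g d(4)]] .
    have "x = Zero C A N" by (rule perp_Zero[OF N A x(1)])
    then have "q \<cdot> g = Zero C (SuspO C A) (SuspO C N)" using x(2) Susp_Zero[OF T_Obj[OF A] d(5)] by simp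
    then show "\<exists>h \<in> Hom C (SuspO C A) E. p \<cdot> h = g" using triangle_weak_kernel'[OF t g] by blast
  qed
  then show "p \<in> Fib" using d(3) by (simp add: Fib_iff)
qed

lemma Zero_lifts_iff_surj:
  assumes Z0: "is_zero_object C Z0" and A: "A \<in> Obj C" and f: "f \<in> Arr C"
  shows "lifts C (Zero C Z0 A) f \<longleftrightarrow> surj_from A f"
proof -
  have Z0_obj: "Z0 \<in> Obj C" using Z0 unfolding is_zero_object_def is_initial_def by blast
  have f': "f \<in> Hom C (Dom C f) (Cod C f)" and z: "Zero C Z0 A \<in> Hom C Z0 A" using f A Z0_obj by simp_all
  have Df: "Dom C f \<in> Obj C" using Dom_in_Obj[OF f] .
  show ?thesis
  proof
    assume l: "lifts C (Zero C Z0 A) f"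
    show "surj_from A f"
    proof (rule surj_fromI[OF f'])
      fix g assume g: "g \<in> Hom C A (Cod C f)"
      have "Zero C Z0 (Dom C f) \<in> Hom C Z0 (Dom C f)" using Z0_obj Df by simp
      moreover have "f \<cdot> Zero C Z0 (Dom C f) = g \<cdot> Zero C Z0 A" using f g Z0_obj by simp
      ultimately show "\<exists>h \<in> Hom C A (Dom C f). f \<cdot> h = g" using liftsD[OF l z f' _ g] by blast
    qed
  next
    assume surj: "surj_from A f"
    show "lifts C (Zero C Z0 A) f"
    proof (rule liftsI[OF z f'])
      fix u v assume u: "u \<in> Hom C Z0 (Dom C f)" and v: "v \<in> Hom C A (Cod C f)"
      obtain \<alpha> where \<alpha>: "\<alpha> \<in> Hom C A (Dom C f)" "f \<cdot> \<alpha> = v" using surj_fromE[OF surj f' v] .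
      have "\<alpha> \<cdot> Zero C Z0 A = u"
        using zero_object_Hom_from[OF Z0 u] zero_object_Hom_from[OF Z0 Comp_in_Hom[OF z \<alpha>(1)]] by simp
      then show "\<exists>\<alpha> \<in> Hom C A (Dom C f). \<alpha> \<cdot> Zero C Z0 A = u \<and> f \<cdot> \<alpha> = v" using \<alpha> by blast
    qed
  qed
qed

lemma Zero_lifts_iff_inj:
  assumes Z0: "is_zero_object C Z0" and A: "A \<in> Obj C" and f: "f \<in> Arr C"
  shows "lifts C (Zero C A Z0) f \<longleftrightarrow> inj_from A f"
proof -
  have Z0_obj: "Z0 \<in> Obj C" using Z0 unfolding is_zero_object_def is_initial_def by blast
  have f': "f \<in> Hom C (Dom C f) (Cod C f)" and z: "Zero C A Z0 \<in> Hom C A Z0" using f A Z0_obj by simp_all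
  have Df: "Dom C f \<in> Obj C" and Cf: "Cod C f \<in> Obj C" using Dom_in_Obj[OF f] Cod_in_Obj[OF f] .
  show ?thesis
    unfolding inj_from_iff_kernel[OF f']
  proof (intro iffI ballI impI)
    fix g assume l: "lifts C (Zero C A Z0) f" and g: "g \<in> Hom C A (Dom C f)"
      and fg: "f \<cdot> g = Zero C A (Cod C f)"
    have v: "Zero C Z0 (Cod C f) \<in> Hom C Z0 (Cod C f)" using Z0_obj Cf by simp
    have "f \<cdot> g = Zero C Z0 (Cod C f) \<cdot> Zero C A Z0" using fg A Z0_obj Cf by simp
    then obtain \<alpha> where \<alpha>: "\<alpha> \<in> Hom C Z0 (Dom C f)" "\<alpha> \<cdot> Zero C A Z0 = g"
      using liftsD[OF l z f' g v] by blast
    have "\<alpha> \<cdot> Zero C A Z0 = Zero C A (Dom C f)" using \<alpha>(1) A by simp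
    then show "g = Zero C A (Dom C f)" using \<alpha>(2) by simp
  next
    assume ker: "\<forall>g \<in> Hom C A (Dom C f). f \<cdot> g = Zero C A (Cod C f) \<longrightarrow> g = Zero C A (Dom C f)"
    show "lifts C (Zero C A Z0) f"
    proof (rule liftsI[OF z f'])
      fix u v assume u: "u \<in> Hom C A (Dom C f)" and v: "v \<in> Hom C Z0 (Cod C f)"
        and sq: "f \<cdot> u = v \<cdot> Zero C A Z0"
      have "v \<cdot> Zero C A Z0 = Zero C A (Cod C f)" using v A by simp
      then have u0: "u = Zero C A (Dom C f)" using sq ker u by simp
      have \<alpha>: "Zero C Z0 (Dom C f) \<in> Hom C Z0 (Dom C f)" using Z0_obj Df by simp
      have "f \<cdot> Zero C Z0 (Dom C f) = v"
        using zero_object_Hom_from[OF Z0 v] f Z0_obj by simp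
      moreover have "Zero C Z0 (Dom C f) \<cdot> Zero C A Z0 = u" using u0 A Z0_obj Df by simp
      ultimately show "\<exists>\<alpha> \<in> Hom C Z0 (Dom C f). \<alpha> \<cdot> Zero C A Z0 = u \<and> f \<cdot> \<alpha> = v" using \<alpha> by blast
    qed
  qed
qed

lemma initial_is_zero_object:
  assumes "is_initial C Z" shows "is_zero_object C Z"
proof (rule zero_objectI)
  show Z: "Z \<in> Obj C" using assms unfolding is_initial_def by blast
  then have "Id C Z \<in> Hom C Z Z" "Zero C Z Z \<in> Hom C Z Z" by simp_all
  then show "Id C Z = Zero C Z Z" using assms Z unfolding is_initial_def by blast
qed

lemma fibrant_iff: "fibrant C Fib X \<longleftrightarrow> X \<in> Obj C"
proof
  assume "fibrant C Fib X" then show "X \<in> Obj C" unfolding fibrant_def using Hom_Obj by blast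
next
  assume X: "X \<in> Obj C"
  obtain Z0 where Z0: "is_zero_object C Z0" using zero_object_exists by blast
  then have Z0_obj: "Z0 \<in> Obj C" and fin: "is_final C Z0"
    unfolding is_zero_object_def is_initial_def by blast+
  have z: "Zero C X Z0 \<in> Hom C X Z0" using X Z0_obj by simp
  have "surj_from B (Zero C X Z0)" if B: "B \<in> Obj C" for B
  proof (rule surj_fromI[OF z])
    fix g assume "g \<in> Hom C B Z0"
    then have "g = Zero C B Z0" by (rule zero_object_Hom_to[OF Z0])
    then have "Zero C X Z0 \<cdot> Zero C B X = g" using X Z0_obj B by simp
    then show "\<exists>h \<in> Hom C B X. Zero C X Z0 \<cdot> h = g" using X B by (intro bexI[of _ "Zero C B X"]) simp_all
  qed
  then have "Zero C X Z0 \<in> Fib" using z SuspO_T_Obj by (simp add: Fib_iff)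
  then show "fibrant C Fib X" unfolding fibrant_def using fin z by blast
qed

text \<open>
  Initial objects are zero objects here, and lifting \<open>0 \<rightarrow> B\<close> against \<open>p\<close> means lifting maps out of \<open>B\<close>
  along \<open>p\<close>.
\<close>

lemma cofibrant_iff:
  "cofibrant C Cof B \<longleftrightarrow> B \<in> Obj C \<and> (\<forall>p \<in> W \<inter> Fib. surj_from B p)"
proof
  assume "cofibrant C Cof B"
  then obtain Z f where Z: "is_initial C Z" and f: "f \<in> Hom C Z B" "f \<in> Cof"
    unfolding cofibrant_def by blast
  have B: "B \<in> Obj C" using Hom_Obj[OF f(1)] by blast
  have Z': "is_zero_object C Z" by (rule initial_is_zero_object[OF Z])
  have "\<forall>p \<in> W \<inter> Fib. lifts C (Zero C Z B) p"
    using f(2) zero_object_Hom_from[OF Z' f(1)] unfolding Cof_def llp_def by simp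
  then show "B \<in> Obj C \<and> (\<forall>p \<in> W \<inter> Fib. surj_from B p)"
    using B Zero_lifts_iff_surj[OF Z' B] W_Arr by blast
next
  assume B: "B \<in> Obj C \<and> (\<forall>p \<in> W \<inter> Fib. surj_from B p)"
  obtain Z0 where Z0: "is_zero_object C Z0" using zero_object_exists by blast
  then have Z0_obj: "Z0 \<in> Obj C" and init: "is_initial C Z0"
    unfolding is_zero_object_def is_initial_def by blast+
  have z: "Zero C Z0 B \<in> Hom C Z0 B" using B Z0_obj by simp
  have "Zero C Z0 B \<in> Cof"
    using z B Zero_lifts_iff_surj[OF Z0, of B] W_Arr unfolding Cof_def llp_def by auto
  then show "cofibrant C Cof B" unfolding cofibrant_def using init z by blast
qed


section \<open>The cofibrant objects\<close>

text \<open>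
  A presentation of the functor \<open>C(-,B)\<close> on \<open>T\<close> provides a cofibrant replacement: approximate \<open>B\<close> by
  \<open>T\<^sub>0\<close> and the fibre \<open>V\<close> of \<open>T\<^sub>0 \<rightarrow> B\<close> by \<open>T\<^sub>1\<close>, and let \<open>Q\<close> be the cone of \<open>T\<^sub>1 \<rightarrow> V \<rightarrow> T\<^sub>0\<close>.  The
  octahedral axiom identifies the fibre of \<open>Q \<rightarrow> B\<close> with the cone of \<open>T\<^sub>1 \<rightarrow> V\<close>, which is in \<open>T\<^sup>\<bottom>\<close>.
\<close>

lemma cofibrant_replacement:
  assumes B: "B \<in> Obj C"
  obtains V T0 T1 N Q v c d e n m a b where
    "T0 \<in> T" "T1 \<in> T" "Q \<in> star_susp C T" "triangle V T0 B v c d" "triangle T1 V N e n m"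
    "triangle N Q B a b (Susp C n \<cdot> d)" "N \<in> perp C T" "b \<in> W \<inter> Fib"
proof -
  obtain T0 c where T0: "T0 \<in> T" and c: "c \<in> Hom C T0 B" and c_surj: "\<And>A. A \<in> T \<Longrightarrow> surj_from A c"
    using right_approximation[OF B] by blast
  obtain V v d where tV: "triangle V T0 B v c d" using fibre_exists[OF c] .
  note dV = triangleD[OF tV]
  obtain T1 e where T1: "T1 \<in> T" and e: "e \<in> Hom C T1 V" and e_surj: "\<And>A. A \<in> T \<Longrightarrow> surj_from A e"
    using right_approximation[OF dV(5)] by blast
  obtain N n m where tN: "triangle T1 V N e n m" using cone_exists[OF e] .
  note dN = triangleD[OF tN]
  have N: "N \<in> perp C T" by (rule approximation_cone_perp[OF T1 e_surj tN])
  obtain Q r s where tQ: "triangle T1 T0 Q (v \<cdot> e) r s" using cone_exists[OF Comp_in_Hom[OF e dV(2)]] .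
  note dQ = triangleD[OF tQ]
  have Q: "Q \<in> star_susp C T" unfolding star_susp_def using dQ T0 T1 by blast
  have cods: "Cod C n = N" "Cod C r = Q" "Cod C c = B" using dN dQ dV by simp_all
  obtain a b where a: "a \<in> Hom C N Q" and b: "b \<in> Hom C Q B"
    and tri: "(a, b, Susp C n \<cdot> d) \<in> Tri C" and br: "b \<cdot> r = c"
    using Tri_octahedral[OF e dV(2) dN(1) dQ(1) dV(1)] unfolding cods by blast
  have "Susp C n \<cdot> d \<in> Hom C B (SuspO C N)" by (rule Comp_in_Hom[OF dV(4) Susp_in_Hom[OF dN(3)]])
  then have tB: "triangle N Q B a b (Susp C n \<cdot> d)" unfolding triangle_def using tri a b by blast
  have "surj_from A b" if "A \<in> T" for A
    by (rule surj_from_cancel_right[OF dQ(3) b]) (use br c_surj[OF that] in simp)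
  then have "b \<in> W \<inter> Fib" using trivial_fibrationI[OF tB N] by blast
  then show ?thesis using that T0 T1 Q tV tN tB N by blast
qed

text \<open>
  With the fibre \<open>N\<close> of \<open>p\<close> in \<open>T\<^sup>\<bottom>\<close>, the obstruction \<open>Y \<rightarrow> \<Sigma>N\<close> to lifting a map along \<open>p\<close> vanishes on
  \<open>T\<^sub>0\<close>, so it factors through a map \<open>\<Sigma>T\<^sub>1 \<rightarrow> \<Sigma>N\<close>, which is zero.
\<close>

lemma star_susp_surj_trivial_fibration:
  assumes Y: "Y \<in> star_susp C T" and p: "p \<in> W \<inter> Fib"
  shows "surj_from Y p"
proof -
  obtain T1 T0 u v w where T1: "T1 \<in> T" and T0: "T0 \<in> T" and t: "triangle T1 T0 Y u v w"
    using Y unfolding star_susp_def triangle_def by blast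
  note d = triangleD[OF t]
  have p_hom: "p \<in> Hom C (Dom C p) (Cod C p)" using p W_Arr by simp
  obtain N n q where tp: "triangle N (Dom C p) (Cod C p) n p q" using fibre_exists[OF p_hom] .
  note dp = triangleD[OF tp]
  have N: "N \<in> perp C T" by (rule trivial_fibration_fibre_perp[OF p tp])
  show ?thesis
  proof (rule surj_fromI[OF p_hom])
    fix g assume g: "g \<in> Hom C Y (Cod C p)"
    have gv: "g \<cdot> v \<in> Hom C T0 (Cod C p)" and qg: "q \<cdot> g \<in> Hom C Y (SuspO C N)"
      using g d(3) dp(4) by (blast intro: Comp_in_Hom)+
    have "surj_from T0 p" using p T0 by (simp add: W_iff)
    then obtain x where x: "x \<in> Hom C T0 (Dom C p)" "p \<cdot> x = g \<cdot> v" using surj_fromE[OF _ p_hom gv] by blast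
    have "q \<cdot> (p \<cdot> x) = Zero C T0 (SuspO C N)"
      using Comp_eq_assoc[OF triangle_Comp_Zero'[OF tp] dp(3,4) x(1)] x(1) dp by simp
    then have "(q \<cdot> g) \<cdot> v = Zero C T0 (SuspO C N)" using x(2) g d(3) dp(4) by simp
    then obtain y where y: "y \<in> Hom C (SuspO C T1) (SuspO C N)" "y \<cdot> w = q \<cdot> g"
      using triangle_weak_cokernel'[OF t qg] by blast
    obtain z where z: "z \<in> Hom C T1 N" "Susp C z = y" using Susp_full[OF d(5) dp(5) y(1)] .
    have "z = Zero C T1 N" by (rule perp_Zero[OF N T1 z(1)])
    then have "y = Zero C (SuspO C T1) (SuspO C N)" using z(2) Susp_Zero[OF d(5) dp(5)] by simp
    then have "q \<cdot> g = Zero C Y (SuspO C N)" using y(2) d dp by simp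
    then show "\<exists>h \<in> Hom C Y (Dom C p). p \<cdot> h = g" using triangle_weak_kernel'[OF tp g] by blast
  qed
qed

text \<open>
  For cofibrant \<open>B\<close> the replacement \<open>Q \<rightarrow> B\<close> splits, so the map \<open>B \<rightarrow> \<Sigma>V \<rightarrow> \<Sigma>N\<close> vanishes and \<open>V \<rightarrow> N\<close>
  factors through \<open>T\<^sub>0\<close>.  Hence \<open>V \<rightarrow> N\<close> is zero and \<open>V\<close> is a direct summand of \<open>T\<^sub>1\<close>.
\<close>

lemma surj_trivial_fibration_star_susp:
  assumes B: "B \<in> Obj C" and surj: "\<forall>p \<in> W \<inter> Fib. surj_from B p"
  shows "B \<in> star_susp C T"
proof -
  obtain V T0 T1 N Q v c d e n m a b where T0: "T0 \<in> T" and T1: "T1 \<in> T"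
    and tV: "triangle V T0 B v c d" and tN: "triangle T1 V N e n m"
    and tB: "triangle N Q B a b (Susp C n \<cdot> d)" and N: "N \<in> perp C T" and b: "b \<in> W \<inter> Fib"
    using cofibrant_replacement[OF B] .
  note dV = triangleD[OF tV] and dN = triangleD[OF tN] and dB = triangleD[OF tB]
  have Sn: "Susp C n \<in> Hom C (SuspO C V) (SuspO C N)" by (rule Susp_in_Hom[OF dN(3)])
  obtain \<sigma> where \<sigma>: "\<sigma> \<in> Hom C B Q" "b \<cdot> \<sigma> = Id C B"
    using surj_fromE[OF _ dB(3) Id_in_Hom[OF B]] surj b by blast
  have "(Susp C n \<cdot> d) \<cdot> (b \<cdot> \<sigma>) = Zero C Q (SuspO C N) \<cdot> \<sigma>"
    by (rule Comp_eq_assoc[OF triangle_Comp_Zero'[OF tB] dB(3,4) \<sigma>(1)])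
  then have "Susp C n \<cdot> d = Zero C B (SuspO C N)" using \<sigma> dB(4,8) by simp
  then obtain x where x: "x \<in> Hom C (SuspO C T0) (SuspO C N)" "x \<cdot> Neg C (Susp C v) = Susp C n"
    using triangle_weak_cokernel'[OF triangle_rotate[OF tV] Sn] by blast
  obtain z where z: "z \<in> Hom C T0 N" "Susp C z = x" using Susp_full[OF dV(6) dN(7) x(1)] .
  have "z = Zero C T0 N" by (rule perp_Zero[OF N T0 z(1)])
  then have "x = Zero C (SuspO C T0) (SuspO C N)" using z(2) Susp_Zero[OF dV(6) dN(7)] by simp
  then have "Susp C n = Zero C (SuspO C V) (SuspO C N)"
    using x(2) Neg_in_Hom[OF Susp_in_Hom[OF dV(2)]] dB(8) by simp
  then have "n = Zero C V N" by (rule Susp_eq_Zero[OF dN(3)])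
  then have "n \<cdot> Id C V = Zero C V N" using dN by simp
  then obtain \<tau> where "\<tau> \<in> Hom C V T1" "e \<cdot> \<tau> = Id C V"
    using triangle_weak_kernel[OF tN Id_in_Hom[OF dV(5)]] by blast
  then have "V \<in> T" using T_retract[OF T1 dN(2)] by blast
  then show ?thesis unfolding star_susp_def using T0 dV by blast
qed

lemma cofibrant_iff_star_susp: "cofibrant C Cof B \<longleftrightarrow> B \<in> star_susp C T"
proof -
  have "B \<in> star_susp C T \<Longrightarrow> B \<in> Obj C" unfolding star_susp_def by blast
  then show ?thesis
    using cofibrant_iff star_susp_surj_trivial_fibration surj_trivial_fibration_star_susp by blast
qed


section \<open>Factorisations\<close>

text \<open>
  Approximations from \<open>\<Sigma>T\<close> are suspensions of approximations from \<open>T\<close>, after replacing the target by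
  an isomorphic suspension.
\<close>

lemma Susp_approximation:
  assumes Y: "Y \<in> Obj C"
  obtains A a where "A \<in> T" "a \<in> Hom C (SuspO C A) Y" "\<And>B. B \<in> T \<Longrightarrow> surj_from (SuspO C B) a"
proof -
  obtain Y0 \<phi> where Y0: "Y0 \<in> Obj C" and \<phi>: "\<phi> \<in> Hom C (SuspO C Y0) Y" "is_iso C \<phi>"
    using Susp_essentially_surjective[OF Y] unfolding isomorphic_def by blast
  obtain \<psi> where \<psi>: "\<psi> \<in> Hom C Y (SuspO C Y0)" "\<psi> \<cdot> \<phi> = Id C (SuspO C Y0)" "\<phi> \<cdot> \<psi> = Id C Y"
    using is_isoE[OF \<phi>(2,1)] .
  obtain A a where A: "A \<in> T" "a \<in> Hom C A Y0" "\<And>B. B \<in> T \<Longrightarrow> surj_from B a"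
    using right_approximation[OF Y0] by blast
  have Sa: "Susp C a \<in> Hom C (SuspO C A) (SuspO C Y0)" by (rule Susp_in_Hom[OF A(2)])
  have \<phi>Sa: "\<phi> \<cdot> Susp C a \<in> Hom C (SuspO C A) Y" by (rule Comp_in_Hom[OF Sa \<phi>(1)])
  have "surj_from (SuspO C B) (\<phi> \<cdot> Susp C a)" if B: "B \<in> T" for B
  proof (rule surj_fromI[OF \<phi>Sa])
    fix g assume g: "g \<in> Hom C (SuspO C B) Y"
    obtain x where x: "x \<in> Hom C B Y0" "Susp C x = \<psi> \<cdot> g"
      using Susp_full[OF T_Obj[OF B] Y0 Comp_in_Hom[OF g \<psi>(1)]] .
    obtain y where y: "y \<in> Hom C B A" "a \<cdot> y = x" using surj_fromE[OF A(3)[OF B] A(2) x(1)] .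
    have Sy: "Susp C y \<in> Hom C (SuspO C B) (SuspO C A)" by (rule Susp_in_Hom[OF y(1)])
    have "(\<phi> \<cdot> Susp C a) \<cdot> Susp C y = \<phi> \<cdot> Susp C x"
      using Susp_Comp[OF y(1) A(2)] y(2) Sa Sy \<phi>(1) by simp
    also have "\<dots> = g" unfolding x(2) using Comp_eq_assoc[OF \<psi>(3,1) \<phi>(1) g] g by simp
    finally show "\<exists>h \<in> Hom C (SuspO C B) (SuspO C A). (\<phi> \<cdot> Susp C a) \<cdot> h = g" using Sy by blast
  qed
  then show ?thesis using that A(1) \<phi>Sa by blast
qed

text \<open>
  The basic trivial cofibrations are the inclusions \<open>X \<rightarrow> X \<oplus> \<Sigma>A\<close>; adding an approximation
  \<open>\<Sigma>A \<rightarrow> Y\<close> to \<open>X \<rightarrow> Y\<close> makes it a fibration.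
\<close>

lemma factor_llp_Fib:
  assumes f: "f \<in> Hom C X Y"
  obtains Z j p where "j \<in> Hom C X Z" "p \<in> Hom C Z Y" "j \<in> W" "j \<in> llp C Fib" "p \<in> Fib" "f = p \<cdot> j"
proof -
  have X: "X \<in> Obj C" and Y: "Y \<in> Obj C" using Hom_Obj[OF f] by blast+
  obtain A a where A: "A \<in> T" and a: "a \<in> Hom C (SuspO C A) Y"
    and surj: "\<And>B. B \<in> T \<Longrightarrow> surj_from (SuspO C B) a" using Susp_approximation[OF Y] by blast
  obtain Z i j p q where B: "is_biproduct C X (SuspO C A) Z i j p q"
    using biproduct_exists[OF X SuspO_T_Obj[OF A]] by blast
  note b = biproductD[OF B]
  obtain r where r: "r \<in> Hom C Z Y" "r \<cdot> i = f" "r \<cdot> j = a" using biproduct_copair[OF B f a] by metis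
  have "r \<in> Fib"
    unfolding Fib_iff using r surj surj_from_cancel_right[OF b(5) r(1)] by simp
  moreover have "i \<in> W" by (rule perp_summand_W(1)[OF B Susp_T_perp[OF A]])
  moreover have "lifts C i g" if g: "g \<in> Fib" for g
    by (rule coproduct_inclusion_lifts[OF biproduct_is_coproduct[OF B], of g "Dom C g" "Cod C g"])
      (use g A in \<open>simp_all add: Fib_iff\<close>)
  then have "i \<in> llp C Fib" unfolding llp_def using b(4) by simp
  ultimately show ?thesis using that b(4) r by blast
qed

lemma llp_Fib_Cof: "llp C Fib \<subseteq> Cof"
  unfolding Cof_def llp_def by blast

text \<open>
  Lifting \<open>f\<close> against the second factor of its factorisation \<open>f = pj\<close>, a trivial fibration by two out
  of three, exhibits \<open>f\<close> as a retract of \<open>j\<close>, and left lifting properties pass to retracts.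
\<close>

lemma trivial_cofibration_llp_Fib:
  assumes "f \<in> W \<inter> Cof" shows "f \<in> llp C Fib"
proof -
  define X Y where "X = Dom C f" and "Y = Cod C f"
  have f: "f \<in> Hom C X Y" using assms W_Arr by (simp add: X_def Y_def)
  have Y: "Y \<in> Obj C" and X: "X \<in> Obj C" using Hom_Obj[OF f] by blast+
  obtain Z j p where j: "j \<in> Hom C X Z" and p: "p \<in> Hom C Z Y" and "j \<in> W" and j_llp: "j \<in> llp C Fib"
    and "p \<in> Fib" and fpj: "f = p \<cdot> j" using factor_llp_Fib[OF f] .
  then have "p \<in> W \<inter> Fib" using W_two_of_three(2)[OF j p] assms by blast
  then have "lifts C f p" using assms unfolding Cof_def llp_def by blast
  moreover have "p \<cdot> j = Id C Y \<cdot> f" using fpj f by simp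
  ultimately obtain \<alpha> where \<alpha>: "\<alpha> \<in> Hom C Y Z" "\<alpha> \<cdot> f = j" "p \<cdot> \<alpha> = Id C Y"
    using liftsD[OF _ f p j Id_in_Hom[OF Y]] by blast
  have "is_retract C f j"
    unfolding is_retract_def
    using f j p \<alpha> X fpj by (intro conjI bexI[of _ "Id C X"] bexI[of _ \<alpha>] bexI[of _ p]) auto
  moreover have "stable_class C (llp C Fib)" using stable_class_llp stable_Fib unfolding stable_class_def by blast
  ultimately show ?thesis using j_llp unfolding stable_class_def by blast
qed

text \<open>A strict lift is a lift up to homotopy, because homotopy is reflexive.\<close>

lemma cofibration_homotopy_cofibration:
  assumes "j \<in> Cof" shows "homotopy_cofibration C W Fib j"
  unfolding homotopy_cofibration_def
proof (intro conjI ballI)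
  show j: "j \<in> Arr C" using assms unfolding Cof_def llp_def by blast
  then have j': "j \<in> Hom C (Dom C j) (Cod C j)" by simp
  fix p assume p: "p \<in> W \<inter> Fib"
  then have p': "p \<in> Hom C (Dom C p) (Cod C p)" using W_Arr by simp
  have l: "lifts C j p" using assms p unfolding Cof_def llp_def by blast
  show "lifts_right C W j p"
    unfolding lifts_right_def
  proof (intro ballI impI)
    fix u v assume u: "u \<in> Hom C (Dom C j) (Dom C p)" and v: "v \<in> Hom C (Cod C j) (Cod C p)"
      and "p \<cdot> u = v \<cdot> j"
    then obtain \<alpha> where "\<alpha> \<in> Hom C (Cod C j) (Dom C p)" "\<alpha> \<cdot> j = u" "p \<cdot> \<alpha> = v"
      using liftsD[OF l j' p' u v] by blast
    then show "\<exists>\<alpha> \<in> Hom C (Cod C j) (Dom C p). p \<cdot> \<alpha> = v \<and> right_homotopic C W (\<alpha> \<cdot> j) u"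
      using right_homotopic_iff[OF u u] by blast
  qed
  show "lifts_left C W j p"
    unfolding lifts_left_def
  proof (intro ballI impI)
    fix u v assume u: "u \<in> Hom C (Dom C j) (Dom C p)" and v: "v \<in> Hom C (Cod C j) (Cod C p)"
      and "p \<cdot> u = v \<cdot> j"
    then obtain \<alpha> where "\<alpha> \<in> Hom C (Cod C j) (Dom C p)" "\<alpha> \<cdot> j = u" "p \<cdot> \<alpha> = v"
      using liftsD[OF l j' p' u v] by blast
    then show "\<exists>\<alpha> \<in> Hom C (Cod C j) (Dom C p). left_homotopic C W (p \<cdot> \<alpha>) v \<and> \<alpha> \<cdot> j = u"
      using left_homotopic_iff[OF v v] by blast
  qed
qed

text \<open>
  To solve a lifting problem \<open>pu = vJ\<close>, start with a lift \<open>\<alpha>\<close> of \<open>v\<close> along \<open>p\<close>, which exists because \<open>R\<close>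
  is cofibrant.  The defect \<open>\<alpha>J - u\<close> is killed by \<open>p\<close>, so it comes from the fibre of \<open>p\<close>, an object of
  \<open>T\<^sup>\<bottom>\<close>; extending it along \<open>J\<close> and subtracting corrects \<open>\<alpha>\<close> without changing \<open>p\<alpha>\<close>.
\<close>

lemma cofibration_if_extends_to_perp:
  assumes J: "J \<in> Hom C X R" and R: "cofibrant C Cof R"
    and ext: "\<And>N k. \<lbrakk>N \<in> perp C T; k \<in> Hom C X N\<rbrakk> \<Longrightarrow> \<exists>h \<in> Hom C R N. h \<cdot> J = k"
  shows "J \<in> Cof"
proof -
  have "lifts C J p" if p: "p \<in> W \<inter> Fib" for p
  proof -
    have p': "p \<in> Hom C (Dom C p) (Cod C p)" using p W_Arr by simp
    obtain N n q where t: "triangle N (Dom C p) (Cod C p) n p q" using fibre_exists[OF p'] .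
    note d = triangleD[OF t]
    have N: "N \<in> perp C T" by (rule trivial_fibration_fibre_perp[OF p t])
    show ?thesis
    proof (rule liftsI[OF J p'])
      fix u v assume u: "u \<in> Hom C X (Dom C p)" and v: "v \<in> Hom C R (Cod C p)" and sq: "p \<cdot> u = v \<cdot> J"
      have "surj_from R p" using R p cofibrant_iff by blast
      then obtain \<alpha> where \<alpha>: "\<alpha> \<in> Hom C R (Dom C p)" "p \<cdot> \<alpha> = v" using surj_fromE[OF _ p' v] by blast
      have \<alpha>J: "\<alpha> \<cdot> J \<in> Hom C X (Dom C p)" by (rule Comp_in_Hom[OF J \<alpha>(1)])
      have "p \<cdot> (\<alpha> \<cdot> J \<ominus> u) = v \<cdot> J \<ominus> v \<cdot> J"
        using Comp_diff[OF \<alpha>J u p'] Comp_eq_assoc[OF \<alpha>(2,1) p' J] sq by simp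
      also have "\<dots> = Zero C X (Cod C p)"
        using diff_eq_Zero_iff[OF Comp_in_Hom[OF J v] Comp_in_Hom[OF J v]] by simp
      finally obtain k where k: "k \<in> Hom C X N" "n \<cdot> k = \<alpha> \<cdot> J \<ominus> u"
        using triangle_weak_kernel[OF t diff_in_Hom[OF \<alpha>J u]] by blast
      obtain h where h: "h \<in> Hom C R N" "h \<cdot> J = k" using ext[OF N k(1)] by blast
      have nh: "n \<cdot> h \<in> Hom C R (Dom C p)" by (rule Comp_in_Hom[OF h(1) d(2)])
      have "(\<alpha> \<ominus> n \<cdot> h) \<cdot> J = \<alpha> \<cdot> J \<ominus> (\<alpha> \<cdot> J \<ominus> u)"
        using diff_Comp[OF \<alpha>(1) nh J] h k(2) J d(2) by simp
      then have 1: "(\<alpha> \<ominus> n \<cdot> h) \<cdot> J = u" using diff_diff_cancel[OF \<alpha>J u] by simp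
      have "p \<cdot> (n \<cdot> h) = Zero C R (Cod C p)"
        using Comp_eq_assoc[OF triangle_Comp_Zero[OF t] d(2,3) h(1)] h(1) d by simp
      then have 2: "p \<cdot> (\<alpha> \<ominus> n \<cdot> h) = v" using Comp_diff[OF \<alpha>(1) nh p'] \<alpha>(2) diff_Zero[OF v] by simp
      show "\<exists>\<alpha> \<in> Hom C R (Dom C p). \<alpha> \<cdot> J = u \<and> p \<cdot> \<alpha> = v"
        using 1 2 diff_in_Hom[OF \<alpha>(1) nh] by blast
    qed
  qed
  then show ?thesis using J unfolding Cof_def llp_def by simp
qed

text \<open>
  Let \<open>T\<^sub>1 \<rightarrow> T\<^sub>0 \<rightarrow> X \<rightarrow> \<Sigma>T\<^sub>1\<close> be a triangle and \<open>X \<rightarrow> Q\<close> a lift of \<open>f\<close> to a cofibrant replacement of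
  \<open>Y\<close>.  A map from \<open>X\<close> to \<open>T\<^sup>\<bottom>\<close> vanishes on \<open>T\<^sub>0\<close> and factors through \<open>\<Sigma>T\<^sub>1\<close>, so enlarging \<open>Q\<close> to
  \<open>Q \<oplus> \<Sigma>T\<^sub>1\<close> makes the lift a cofibration.
\<close>

lemma factor_Cof_trivial_fibration:
  assumes f: "f \<in> Hom C X Y" and X: "cofibrant C Cof X"
  obtains Z j p where "j \<in> Hom C X Z" "p \<in> Hom C Z Y" "j \<in> Cof" "p \<in> W \<inter> Fib" "f = p \<cdot> j"
proof -
  have Y: "Y \<in> Obj C" using Hom_Obj[OF f] by blast
  obtain T1 T0 u v w where T1: "T1 \<in> T" and T0: "T0 \<in> T" and t: "triangle T1 T0 X u v w"
    using X unfolding cofibrant_iff_star_susp star_susp_def triangle_def by blast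
  note d = triangleD[OF t]
  obtain Q b where Q: "cofibrant C Cof Q" and b: "b \<in> Hom C Q Y" "b \<in> W \<inter> Fib"
    using cofibrant_replacement[OF Y] cofibrant_iff_star_susp triangleD(3) by metis
  have Q_obj: "Q \<in> Obj C" using Q cofibrant_iff by blast
  have "surj_from X b" using X b(2) cofibrant_iff by blast
  then obtain j0 where j0: "j0 \<in> Hom C X Q" "b \<cdot> j0 = f" using surj_fromE[OF _ b(1) f] by blast
  obtain R i j p q where B: "is_biproduct C Q (SuspO C T1) R i j p q"
    using biproduct_exists[OF Q_obj d(8)] by blast
  note bs = biproductD[OF B]
  have p_surj: "surj_from A p" for A
    by (rule surj_from_cancel_right[OF bs(4,6)]) (use bs surj_from_Id in simp)
  have p: "p \<in> W \<inter> Fib"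
    using perp_summand_W(2)[OF B Susp_T_perp[OF T1]] p_surj bs(6) by (simp add: Fib_iff)
  have R: "cofibrant C Cof R"
    unfolding cofibrant_iff
  proof (intro conjI ballI)
    show "R \<in> Obj C" by (rule bs)
    fix r assume r: "r \<in> W \<inter> Fib"
    then have r': "r \<in> Hom C (Dom C r) (Cod C r)" using W_Arr by simp
    have r_surj: "surj_from Q r" "surj_from (SuspO C T1) r" using r Q T1 cofibrant_iff Fib_iff by blast+
    show "surj_from R r"
    proof (rule surj_fromI[OF r'])
      fix g assume g: "g \<in> Hom C R (Cod C r)"
      obtain x where x: "x \<in> Hom C Q (Dom C r)" "r \<cdot> x = g \<cdot> i"
        using surj_fromE[OF r_surj(1) r' Comp_in_Hom[OF bs(4) g]] .
      have "lifts C i r" by (rule coproduct_inclusion_lifts[OF biproduct_is_coproduct[OF B] r' r_surj(2)])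
      then show "\<exists>h \<in> Hom C R (Dom C r). r \<cdot> h = g" using liftsD[OF _ bs(4) r' x(1) g x(2)] by blast
    qed
  qed
  obtain J where J: "J \<in> Hom C X R" "p \<cdot> J = j0" "q \<cdot> J = w" using biproduct_pair[OF B j0(1) d(4)] .
  have "J \<in> Cof"
  proof (rule cofibration_if_extends_to_perp[OF J(1) R])
    fix N k assume N: "N \<in> perp C T" and k: "k \<in> Hom C X N"
    have "k \<cdot> v = Zero C T0 N" by (rule perp_Zero[OF N T0 Comp_in_Hom[OF d(3) k]])
    then obtain h where h: "h \<in> Hom C (SuspO C T1) N" "h \<cdot> w = k"
      using triangle_weak_cokernel'[OF t k] by blast
    have "(h \<cdot> q) \<cdot> J = k" using h J bs(7) by simp
    then show "\<exists>h \<in> Hom C R N. h \<cdot> J = k" using Comp_in_Hom[OF bs(7) h(1)] by blast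
  qed
  moreover have "b \<cdot> p \<in> W \<inter> Fib" by (rule trivial_fibration_Comp[OF bs(6) b(1) p b(2)])
  moreover have "f = (b \<cdot> p) \<cdot> J" using j0 J b(1) bs(6) by simp
  ultimately show ?thesis using that J(1) Comp_in_Hom[OF bs(6) b(1)] by blast
qed


section \<open>The left-weak model structure\<close>

text \<open>
  Since epimorphisms split, the pull-back of any \<open>p : E \<rightarrow> Y\<close> along an epimorphism \<open>e : A \<rightarrow> Y\<close> with
  complement \<open>K\<close> is \<open>E \<oplus> K\<close>.
\<close>

lemma pullback_along_epi_exists:
  assumes p: "p \<in> Hom C E Y" and "is_epi C e" and e: "e \<in> Hom C A Y"
  shows "\<exists>q r. is_pullback C p e q r"
proof -
  obtain \<sigma> where \<sigma>: "\<sigma> \<in> Hom C Y A" "e \<cdot> \<sigma> = Id C Y" using epi_splits assms by blast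
  obtain K k \<rho> where B: "is_biproduct C Y K A \<sigma> k e \<rho>" using split_epi_biproduct[OF e \<sigma>] .
  note b = biproductD[OF B]
  have E: "E \<in> Obj C" using Hom_Obj[OF p] by blast
  obtain R i j r s where B': "is_biproduct C E K R i j r s" using biproduct_exists[OF E b(2)] by blast
  note b' = biproductD[OF B']
  \<comment> \<open>Under \<open>A \<cong> Y \<oplus> K\<close> the pulled-back map is \<open>p \<oplus> 1 : E \<oplus> K \<rightarrow> Y \<oplus> K\<close>.\<close>
  obtain q where q: "q \<in> Hom C R A" "e \<cdot> q = p \<cdot> r" "\<rho> \<cdot> q = s"
    using biproduct_pair[OF B Comp_in_Hom[OF b'(6) p] b'(7)] .
  have "\<exists>!h. h \<in> Hom C V R \<and> q \<cdot> h = x \<and> r \<cdot> h = y"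
    if x: "x \<in> Hom C V A" and y: "y \<in> Hom C V E" and sq: "p \<cdot> y = e \<cdot> x" for V x y
  proof -
    obtain h where h: "h \<in> Hom C V R" "r \<cdot> h = y" "s \<cdot> h = \<rho> \<cdot> x"
      using biproduct_pair[OF B' y Comp_in_Hom[OF x b(7)]] .
    have "e \<cdot> (q \<cdot> h) = e \<cdot> x"
      using Comp_eq_assoc[OF q(2,1) e h(1)] h p b'(6) sq by simp
    moreover have "\<rho> \<cdot> (q \<cdot> h) = \<rho> \<cdot> x" using Comp_eq_assoc[OF q(3,1) b(7) h(1)] h(3) by simp
    ultimately have qh: "q \<cdot> h = x" using biproduct_to_eqI[OF B Comp_in_Hom[OF h(1) q(1)] x] by blast
    show ?thesis
    proof (rule ex1I[of _ h])
      show "h \<in> Hom C V R \<and> q \<cdot> h = x \<and> r \<cdot> h = y" using h qh by blast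
      fix h' assume h': "h' \<in> Hom C V R \<and> q \<cdot> h' = x \<and> r \<cdot> h' = y"
      then have "s \<cdot> h' = \<rho> \<cdot> x" using Comp_eq_assoc[OF q(3,1) b(7), of h' V] by metis
      then show "h' = h" using biproduct_to_eqI[OF B', of h' V h] h h' by simp
    qed
  qed
  then have "\<forall>V \<in> Obj C. \<forall>x \<in> Hom C V A. \<forall>y \<in> Hom C V E. p \<cdot> y = e \<cdot> x \<longrightarrow>
      (\<exists>!h. h \<in> Hom C V R \<and> q \<cdot> h = x \<and> r \<cdot> h = y)" by blast
  then have "is_pullback C p e q r" unfolding is_pullback_def using p e q b'(6) by simp
  then show ?thesis by blast
qed

text \<open>
  The universal property, tested on maps out of \<open>A\<close>, transfers surjectivity and injectivity of
  \<open>C(A,-)\<close> from \<open>p\<close> to its pull-back.  With \<open>A\<close> in \<open>T\<close> and in \<open>\<Sigma>T\<close> this preserves trivial fibrations.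
\<close>

lemma pullback_surj_from:
  assumes pb: "is_pullback C p e q r" and A: "A \<in> Obj C" and "surj_from A p"
  shows "surj_from A q"
proof -
  have p: "p \<in> Hom C (Dom C p) (Cod C p)" and e: "e \<in> Hom C (Dom C e) (Cod C p)"
    and q: "q \<in> Hom C (Dom C q) (Dom C e)" using pb unfolding is_pullback_def by simp_all
  have univ: "\<exists>h. h \<in> Hom C A (Dom C q) \<and> q \<cdot> h = a \<and> r \<cdot> h = b"
    if "a \<in> Hom C A (Dom C e)" "b \<in> Hom C A (Dom C p)" "p \<cdot> b = e \<cdot> a" for a b
    using pb A that unfolding is_pullback_def by blast
  show ?thesis
  proof (rule surj_fromI[OF q])
    fix g assume g: "g \<in> Hom C A (Dom C e)"
    obtain y where y: "y \<in> Hom C A (Dom C p)" "p \<cdot> y = e \<cdot> g"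
      using surj_fromE[OF assms(3) p Comp_in_Hom[OF g e]] .
    then show "\<exists>h \<in> Hom C A (Dom C q). q \<cdot> h = g" using univ[OF g y] by blast
  qed
qed

lemma pullback_inj_from:
  assumes pb: "is_pullback C p e q r" and A: "A \<in> Obj C" and inj: "inj_from A p"
  shows "inj_from A q"
proof -
  have p: "p \<in> Hom C (Dom C p) (Cod C p)" and e: "e \<in> Hom C (Dom C e) (Cod C p)"
    and q: "q \<in> Hom C (Dom C q) (Dom C e)" and r: "r \<in> Hom C (Dom C q) (Dom C p)"
    and sq: "p \<cdot> r = e \<cdot> q" using pb unfolding is_pullback_def by simp_all
  have univ: "\<exists>!h. h \<in> Hom C A (Dom C q) \<and> q \<cdot> h = a \<and> r \<cdot> h = b"
    if "a \<in> Hom C A (Dom C e)" "b \<in> Hom C A (Dom C p)" "p \<cdot> b = e \<cdot> a" for a b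
    using pb A that unfolding is_pullback_def by blast
  show ?thesis
  proof (rule inj_fromI[OF q])
    fix g h assume g: "g \<in> Hom C A (Dom C q)" and h: "h \<in> Hom C A (Dom C q)" and qgh: "q \<cdot> g = q \<cdot> h"
    have prg: "p \<cdot> (r \<cdot> x) = e \<cdot> (q \<cdot> x)" if x: "x \<in> Hom C A (Dom C q)" for x
      using Comp_eq_assoc[OF sq r p x] Comp_reassoc[of x q e] q e x by simp
    have "r \<cdot> g = r \<cdot> h"
      by (rule inj_fromD[OF inj p Comp_in_Hom[OF g r] Comp_in_Hom[OF h r]])
        (use prg[OF g] prg[OF h] qgh in simp)
    then show "g = h"
      using univ[OF Comp_in_Hom[OF g q] Comp_in_Hom[OF g r] prg[OF g]] g h qgh by metis
  qed
qed

lemma model_structure: "left_weak_model_category C W Cof Fib"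
proof (intro left_weak_model_category.intro left_weak_model_category_axioms.intro)
  show "category C" by (rule category_axioms)
  show "has_finite_products C" by (rule finite_products_exist)
  show "has_finite_coproducts C" by (rule finite_coproducts_exist)
  show "stable_class C W" by (rule stable_W)
  show "stable_class C Cof" by (rule stable_Cof)
  show "stable_class C Fib" by (rule stable_Fib)
  show "W \<inter> Cof \<subseteq> llp C Fib" using trivial_cofibration_llp_Fib by blast
  show "Cof \<subseteq> llp C (Fib \<inter> W)" unfolding Cof_def by (simp add: Int_commute)
next
  fix p e assume p: "p \<in> W \<inter> Fib" and e: "is_epi C e" "Cod C e = Cod C p"
  then have "p \<in> Hom C (Dom C p) (Cod C p)" "e \<in> Hom C (Dom C e) (Cod C p)"
    using W_Arr unfolding is_epi_def by simp_all
  then show "\<exists>q r. is_pullback C p e q r" using pullback_along_epi_exists e(1) by blast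
next
  fix p e q r assume p: "p \<in> W \<inter> Fib" and pb: "is_pullback C p e q r"
  have "q \<in> Arr C" using pb unfolding is_pullback_def by blast
  then show "q \<in> W \<inter> Fib"
    using p pullback_surj_from[OF pb] pullback_inj_from[OF pb] T_Obj SuspO_T_Obj
    by (simp add: W_iff Fib_iff)
next
  fix A B j assume A: "cofibrant C Cof A" and j: "j \<in> Hom C A B" and hj: "homotopy_cofibration C W Fib j"
  have "surj_from B p" if p: "p \<in> W \<inter> Fib" for p
  proof -
    have p': "p \<in> Hom C (Dom C p) (Cod C p)" using p W_Arr by simp
    have dj: "Dom C j = A" "Cod C j = B" using j by simp_all
    have lift: "\<exists>\<alpha> \<in> Hom C B (Dom C p). p \<cdot> \<alpha> = v"
      if "u \<in> Hom C A (Dom C p)" "v \<in> Hom C B (Cod C p)" "p \<cdot> u = v \<cdot> j" for u v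
      using hj p that unfolding homotopy_cofibration_def lifts_right_def dj by blast
    show ?thesis
    proof (rule surj_fromI[OF p'])
      fix v assume v: "v \<in> Hom C B (Cod C p)"
      have "surj_from A p" using A p cofibrant_iff by blast
      then obtain u where "u \<in> Hom C A (Dom C p)" "p \<cdot> u = v \<cdot> j"
        using surj_fromE[OF _ p' Comp_in_Hom[OF j v]] by blast
      then show "\<exists>h \<in> Hom C B (Dom C p). p \<cdot> h = v" using lift[OF _ v] by blast
    qed
  qed
  then show "cofibrant C Cof B" unfolding cofibrant_iff using Hom_Obj[OF j] by blast
next
  have incl: "i \<in> Cof" if B: "cofibrant C Cof B" and P: "is_binary_coproduct C A B P i j" for A B P i j
  proof -
    have "lifts C i p" if "p \<in> W \<inter> Fib" for p
      by (rule coproduct_inclusion_lifts[OF P, of p "Dom C p" "Cod C p"])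
        (use that W_Arr B cofibrant_iff in auto)
    then show ?thesis using binary_coproductD(2)[OF P] unfolding Cof_def llp_def by simp
  qed
  show "i \<in> Cof" if "cofibrant C Cof B" "A \<in> Obj C" "is_binary_coproduct C A B P i j" for A B P i j
    using incl that by blast
  show "j \<in> Cof" if "cofibrant C Cof B" "A \<in> Obj C" "is_binary_coproduct C B A P i j" for A B P i j
    using incl[OF that(1) binary_coproduct_swap[OF that(3)]] .
next
  fix f X Y g Z assume "f \<in> Hom C X Y" "g \<in> Hom C Y Z"
  from W_two_of_three[OF this]
  show "(f \<in> W \<and> g \<in> W \<longrightarrow> g \<cdot> f \<in> W) \<and> (f \<in> W \<and> g \<cdot> f \<in> W \<longrightarrow> g \<in> W) \<and>
      (g \<in> W \<and> g \<cdot> f \<in> W \<longrightarrow> f \<in> W)" by blast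
next
  fix f X Y assume "f \<in> Hom C X Y"
  from factor_llp_Fib[OF this] obtain Z j p where "j \<in> Hom C X Z" "p \<in> Hom C Z Y" "j \<in> W"
    "j \<in> llp C Fib" "p \<in> Fib" "f = p \<cdot> j" .
  then show "\<exists>Z. \<exists>j \<in> Hom C X Z. \<exists>p \<in> Hom C Z Y. j \<in> W \<inter> Cof \<and> p \<in> Fib \<and> f = p \<cdot> j"
    using llp_Fib_Cof by blast
next
  fix f X Y assume "f \<in> Hom C X Y" "cofibrant C Cof X"
  from factor_Cof_trivial_fibration[OF this] obtain Z j p where "j \<in> Hom C X Z" "p \<in> Hom C Z Y"
    "j \<in> Cof" "p \<in> W \<inter> Fib" "f = p \<cdot> j" .
  then show "\<exists>Z. \<exists>j \<in> Hom C X Z. \<exists>p \<in> Hom C Z Y.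
      homotopy_cofibration C W Fib j \<and> p \<in> W \<inter> Fib \<and> f = p \<cdot> j"
    using cofibration_homotopy_cofibration by blast
qed

lemma isomorphic_Susp:
  assumes "isomorphic C A B" shows "isomorphic C (SuspO C A) (SuspO C B)"
proof -
  obtain a where a: "a \<in> Hom C A B" "is_iso C a" using assms unfolding isomorphic_def by blast
  obtain b where b: "b \<in> Hom C B A" "b \<cdot> a = Id C A" "a \<cdot> b = Id C B" using is_isoE[OF a(2,1)] .
  have "is_iso C (Susp C a)"
    by (rule is_isoI[OF Susp_in_Hom[OF a(1)] Susp_in_Hom[OF b(1)]])
      (use Susp_Comp[OF a(1) b(1)] Susp_Comp[OF b(1) a(1)] b Susp_Id Hom_Obj[OF a(1)] in simp_all)
  then show ?thesis unfolding isomorphic_def using Susp_in_Hom[OF a(1)] by blast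
qed

text \<open>
  The generators encode the defining conditions as liftings: \<open>0 \<rightarrow> A\<close> tests surjectivity and \<open>A \<rightarrow> 0\<close>
  tests injectivity of \<open>C(A,f)\<close>.  One object from each isomorphism class of \<open>T\<close> suffices.
\<close>

lemma cofibrantly_generated_if_skeletally_small:
  fixes \<kappa> :: "'k rel"
  assumes \<kappa>: "Card_order \<kappa>" "infinite (Field \<kappa>)" and "skeletally_small \<kappa> C T"
  shows "cofibrantly_generated \<kappa> C W Cof Fib"
proof -
  obtain S where S: "S \<subseteq> T" "small_wrt \<kappa> S" and skel: "\<And>X. X \<in> T \<Longrightarrow> \<exists>Y \<in> S. isomorphic C X Y"
    using assms(3) unfolding skeletally_small_def by blast
  obtain Z0 where Z0: "is_zero_object C Z0" using zero_object_exists by blast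
  then have Z0_obj: "Z0 \<in> Obj C" unfolding is_zero_object_def is_initial_def by blast
  define J where "J = (\<lambda>A. Zero C Z0 (SuspO C A)) ` S"
  define I where "I = J \<union> ((\<lambda>A. Zero C Z0 A) ` S \<union> (\<lambda>A. Zero C A Z0) ` S)"
  have S_obj: "A \<in> Obj C" "SuspO C A \<in> Obj C" if "A \<in> S" for A using that S(1) T_Obj SuspO_T_Obj by blast+
  have image_small: "small_wrt \<kappa> (h ` S)" for h :: "'o \<Rightarrow> 'm"
    using S(2) card_of_image[of h S] ordLeq_ordLess_trans unfolding small_wrt_def by blast
  have "small_wrt \<kappa> J" unfolding J_def by (rule image_small)
  moreover from this have "small_wrt \<kappa> I"
    using image_small card_of_Un_ordLess_infinite_Field[OF \<kappa>(2,1)] unfolding small_wrt_def I_def by blast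
  moreover have "J \<subseteq> Arr C" "I \<subseteq> Arr C" unfolding I_def J_def using S_obj Z0_obj by auto
  moreover have Fib: "Fib = rlp C J"
  proof -
    have "(\<forall>A \<in> T. surj_from (SuspO C A) f) \<longleftrightarrow> (\<forall>a \<in> J. lifts C a f)" if f: "f \<in> Arr C" for f
    proof -
      have "(\<forall>a \<in> J. lifts C a f) \<longleftrightarrow> (\<forall>A \<in> S. surj_from (SuspO C A) f)"
        unfolding J_def using Zero_lifts_iff_surj[OF Z0 _ f] S_obj by simp
      moreover have "(\<forall>A \<in> S. surj_from (SuspO C A) f) \<longleftrightarrow> (\<forall>A \<in> T. surj_from (SuspO C A) f)"
        using S(1) skel isomorphic_Susp surj_from_isomorphic[OF _ _ f] by (metis subsetD)
      ultimately show ?thesis by blast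
    qed
    then show ?thesis unfolding Fib_def rlp_def by blast
  qed
  moreover have WFib: "W \<inter> Fib = rlp C I"
  proof -
    have "(\<forall>A \<in> T. inj_from A f \<and> surj_from A f) \<longleftrightarrow>
        (\<forall>a \<in> (\<lambda>A. Zero C Z0 A) ` S \<union> (\<lambda>A. Zero C A Z0) ` S. lifts C a f)" if f: "f \<in> Arr C" for f
    proof -
      have "(\<forall>a \<in> (\<lambda>A. Zero C Z0 A) ` S \<union> (\<lambda>A. Zero C A Z0) ` S. lifts C a f) \<longleftrightarrow>
          (\<forall>A \<in> S. inj_from A f \<and> surj_from A f)"
        unfolding ball_Un ball_simps(9)
        using Zero_lifts_iff_surj[OF Z0 _ f] Zero_lifts_iff_inj[OF Z0 _ f] S_obj(1) by (simp cong: ball_cong) blast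
      moreover have "(\<forall>A \<in> S. inj_from A f \<and> surj_from A f) \<longleftrightarrow> (\<forall>A \<in> T. inj_from A f \<and> surj_from A f)"
        using S(1) skel surj_from_isomorphic[OF _ _ f] inj_from_isomorphic[OF _ _ f] by (metis subsetD)
      ultimately show ?thesis by blast
    qed
    then have "W = rlp C ((\<lambda>A. Zero C Z0 A) ` S \<union> (\<lambda>A. Zero C A Z0) ` S)"
      unfolding rlp_def by (auto simp: W_iff)
    moreover have "rlp C (J \<union> L) = rlp C L \<inter> rlp C J" for L unfolding rlp_def by blast
    ultimately show ?thesis unfolding I_def Fib by simp
  qed
  moreover have "Cof = llp C (rlp C I)" unfolding Cof_def WFib ..
  ultimately show ?thesis unfolding cofibrantly_generated_def by blast
qed

end

theorem theorem2p2:
  fixes C :: "('o, 'm, 'c) tri_cat_scheme" and T :: "'o set" and \<kappa> :: "'k rel"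
  assumes "triangulated_category C"
    and "strictly_full C T" and "summand_closed C T"
    and "rigid C T" and "contravariantly_finite C T"
    and "Card_order \<kappa>" and "infinite (Field \<kappa>)"
  shows "weak_equivs C T =
           {f \<in> Arr C. \<exists>u v. (u, f, v) \<in> Tri C \<and>
              u \<in> ideal_of C (perp C T) \<and> v \<in> ideal_of C (perp C T)}
       \<and> (\<exists>Cof Fib.
            left_weak_model_category C (weak_equivs C T) Cof Fib \<and>
            {f. null_homotopic C (weak_equivs C T) f} = ideal_of C (perp C T) \<and>
            {X. fibrant C Fib X \<and> cofibrant C Cof X} = star_susp C T \<and>
            (skeletally_small \<kappa> C T \<longrightarrow>
               cofibrantly_generated \<kappa> C (weak_equivs C T) Cof Fib))"
proof -
  interpret rigid_subcategory C T
    using assms by (simp add: rigid_subcategory_def rigid_subcategory_axioms_def)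
  have "weak_equivs C T = {f \<in> Arr C. \<exists>u v. (u, f, v) \<in> Tri C \<and>
      u \<in> ideal_of C (perp C T) \<and> v \<in> ideal_of C (perp C T)}"
    using W_iff_some_triangle by blast
  moreover have "{f. null_homotopic C (weak_equivs C T) f} = ideal_of C (perp C T)"
    using null_homotopic_iff by blast
  moreover have "{X. fibrant C Fib X \<and> cofibrant C Cof X} = star_susp C T"
    using fibrant_iff cofibrant_iff_star_susp cofibrant_iff by blast
  moreover have "skeletally_small \<kappa> C T \<Longrightarrow> cofibrantly_generated \<kappa> C (weak_equivs C T) Cof Fib"
    by (rule cofibrantly_generated_if_skeletally_small[OF assms(6,7)])
  ultimately show ?thesis using model_structure by blast
qed

end
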